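(* Suppose $A\in C^\gamma_tC^{2+\eta}_x$ for some $\gamma\in(\frac12,1]^2$ and $\eta\in(0,1)$, where $A:[0,T]^2\times\mathbb R^d\to\mathbb R^d$. Let $\xi\in C^\gamma([0,T]^2;\mathbb R^d)$ be such that $\square_{s,t}\xi=0$ for all $s<t$ in $[0,T]^2$. If $(1+\eta)\gamma_i>1$ for $i=1,2$, then there exists a unique solution $\theta\in C^\gamma([0,T]^2;\mathbb R^d)$ to the equation $$\theta_t=\xi_t+\int_0^tA(ds,\theta_s),\qquad t\in[0,T]^2,$$ where the integral is a 2D nonlinear Young integral.
   Context: For $s,t\in[0,T]^2$, $s<t$ means $s_1<t_1$, $s_2<t_2$. For $f:[0,T]^2\to E$ ($E$ Banach), $\square_{s,t}f=f(t_1,t_2)-f(t_1,s_2)-f(s_1,t_2)+f(s_1,s_2)$; $C^\gamma_tE=C^\gamma([0,T]^2;E)$ is the space of $f$ such that, uniformly in $s,t$, $|f(t_1,s_2)-f(s_1,s_2)|_E\lesssim|t_1-s_1|^{\gamma_1}$, $|f(s_1,t_2)-f(s_1,s_2)|_E\lesssim|t_2-s_2|^{\gamma_2}$, $|\square_{s,t}f|_E\lesssim|t_1-s_1|^{\gamma_1}|t_2-s_2|^{\gamma_2}$. $C^{2+\eta}_x$ is the Banach space of bounded $C^2$ functions $\mathbb R^d\to\mathbb R^d$ with bounded derivatives and globally $\eta$-Hölder second derivatives, and $A\in C^\gamma_tC^{2+\eta}_x$ means $t\mapsto A(t,\cdot)$ belongs to $C^\gamma_tE$ with $E=C^{2+\eta}_x$.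 Nonlinear Young integral: $\int_0^tA(ds,y_s)=\lim_{|\mathcal P|\to0}\sum_{[u,v]\in\mathcal P}\square_{u,v}A(y_u)$, with $\square_{u,v}A(x)$ the rectangular increment of $t\mapsto A(t,x)$, where $\mathcal P=\mathcal P^1\times\mathcal P^2$ runs over products of partitions of $[0,t_1]$ and $[0,t_2]$, $[u,v]=[u_1,v_1]\times[u_2,v_2]$. *)

theory Defs
  imports "HOL-Analysis.Analysis" "HOL-Library.Function_Algebras"
begin

definition square :: "real \<Rightarrow> (real \<times> real) set" where
  "square T = {0..T} \<times> {0..T}"

definition rect_incr :: "real \<times> real \<Rightarrow> real \<times> real \<Rightarrow> (real \<times> real \<Rightarrow> 'e::ab_group_add) \<Rightarrow> 'e" where
  "rect_incr s t f = f (fst t, snd t) - f (fst t, snd s) - f (fst s, snd t) + f (fst s, snd s)"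

text \<open>
  The space \<open>C\<^sup>\<gamma>([0,T]\<^sup>2; E)\<close>. The Banach space \<open>E\<close> is given by its carrier \<open>V\<close>, a subspace of
  the ambient group \<open>'e\<close>, and its norm \<open>N\<close>, because \<open>C\<^sup>2\<^sup>+\<^sup>\<eta>\<close> depends on the real number \<open>\<eta>\<close> and is
  therefore not a type. No order between \<open>s\<close> and \<open>t\<close> is imposed: up to the constant \<open>C\<close>, the
  bounds for \<open>s < t\<close> imply those for all \<open>s\<close> and \<open>t\<close>.
\<close>

definition holder_plane ::
    "'e set \<Rightarrow> ('e::ab_group_add \<Rightarrow> real) \<Rightarrow> real \<Rightarrow> real \<times> real \<Rightarrow> (real \<times> real \<Rightarrow> 'e) \<Rightarrow> bool" where
  "holder_plane V N T \<gamma> f \<longleftrightarrow>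
     (\<forall>t\<in>square T. f t \<in> V) \<and>
     (\<exists>C. \<forall>s\<in>square T. \<forall>t\<in>square T.
        N (f (fst t, snd s) - f (fst s, snd s)) \<le> C * \<bar>fst t - fst s\<bar> powr fst \<gamma> \<and>
        N (f (fst s, snd t) - f (fst s, snd s)) \<le> C * \<bar>snd t - snd s\<bar> powr snd \<gamma> \<and>
        N (rect_incr s t f)
          \<le> C * (\<bar>fst t - fst s\<bar> powr fst \<gamma> * \<bar>snd t - snd s\<bar> powr snd \<gamma>))"

definition fderiv :: "('a::real_normed_vector \<Rightarrow> 'b::real_normed_vector) \<Rightarrow> 'a \<Rightarrow> 'a \<Rightarrow>\<^sub>L 'b" where
  "fderiv f x = Blinfun (frechet_derivative f (at x))"

text \<open>The set \<open>C\<^sup>2\<^sup>+\<^sup>\<eta>\<close> and its norm, with operator norms on the derivatives.\<close>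

definition C2_holder :: "real \<Rightarrow> ('a::real_normed_vector \<Rightarrow> 'b::real_normed_vector) set" where
  "C2_holder \<eta> = {f.
     (\<forall>x. f differentiable (at x)) \<and>
     (\<forall>x. fderiv f differentiable (at x)) \<and>
     continuous_on UNIV (fderiv (fderiv f)) \<and>
     bounded (range f) \<and> bounded (range (fderiv f)) \<and> bounded (range (fderiv (fderiv f))) \<and>
     (\<exists>C. \<forall>x y. norm (fderiv (fderiv f) x - fderiv (fderiv f) y) \<le> C * norm (x - y) powr \<eta>)}"

text \<open>In the last supremum, pairs with \<open>x = y\<close> contribute \<open>0 / 0 = 0\<close>.\<close>

definition C2_holder_norm :: "real \<Rightarrow> ('a::real_normed_vector \<Rightarrow> 'b::real_normed_vector) \<Rightarrow> real" where
  "C2_holder_norm \<eta> f =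
     (SUP x. norm (f x)) + (SUP x. norm (fderiv f x)) + (SUP x. norm (fderiv (fderiv f) x)) +
     (SUP (x, y). norm (fderiv (fderiv f) x - fderiv (fderiv f) y) / norm (x - y) powr \<eta>)"

text \<open>The nodes \<open>p 0 < \<dots> < p n\<close> of a partition of \<open>[0, b]\<close>; for \<open>b = 0\<close> this forces \<open>n = 0\<close>.\<close>

definition is_partition :: "real \<Rightarrow> nat \<Rightarrow> (nat \<Rightarrow> real) \<Rightarrow> bool" where
  "is_partition b n p \<longleftrightarrow> p 0 = 0 \<and> p n = b \<and> (\<forall>i<n. p i < p (Suc i))"

definition mesh_less :: "real \<Rightarrow> nat \<Rightarrow> (nat \<Rightarrow> real) \<Rightarrow> bool" where
  "mesh_less \<delta> n p \<longleftrightarrow> (\<forall>i<n. p (Suc i) - p i < \<delta>)"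

definition young_sum ::
    "(real \<times> real \<Rightarrow> 'a \<Rightarrow> 'b::real_normed_vector) \<Rightarrow> (real \<times> real \<Rightarrow> 'a) \<Rightarrow>
     nat \<Rightarrow> (nat \<Rightarrow> real) \<Rightarrow> nat \<Rightarrow> (nat \<Rightarrow> real) \<Rightarrow> 'b" where
  "young_sum A y m p n q =
     (\<Sum>i<m. \<Sum>j<n. rect_incr (p i, q j) (p (Suc i), q (Suc j)) (\<lambda>r. A r (y (p i, q j))))"

text \<open>The integral \<open>\<integral>\<^sub>0\<^sup>t A(ds, y\<^sub>s)\<close> exists and equals \<open>I\<close>.\<close>

definition has_young_integral ::
    "(real \<times> real \<Rightarrow> 'a \<Rightarrow> 'b::real_normed_vector) \<Rightarrow> (real \<times> real \<Rightarrow> 'a) \<Rightarrow>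
     real \<times> real \<Rightarrow> 'b \<Rightarrow> bool" where
  "has_young_integral A y t I \<longleftrightarrow>
     (\<forall>\<epsilon>>0. \<exists>\<delta>>0. \<forall>m p n q.
        is_partition (fst t) m p \<and> mesh_less \<delta> m p \<and>
        is_partition (snd t) n q \<and> mesh_less \<delta> n q
        \<longrightarrow> norm (young_sum A y m p n q - I) < \<epsilon>)"

lemma ex_partition_mesh_less:
  assumes "b \<ge> 0" "\<delta> > 0"
  shows "\<exists>n p. is_partition b n p \<and> mesh_less \<delta> n p"
proof (cases "b = 0")
  case True
  then have "is_partition b 0 (\<lambda>_. 0) \<and> mesh_less \<delta> 0 (\<lambda>_. 0)"
    by (simp add: is_partition_def mesh_less_def)
  then show ?thesis by blast
next
  case False
  with assms have b: "b > 0" by simp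
  obtain n :: nat where n: "b / \<delta> < real n"
    using reals_Archimedean2 by blast
  moreover have "0 < b / \<delta>" using b assms by simp
  ultimately have n0: "real n > 0" by linarith
  define p where "p = (\<lambda>i. real i * (b / real n))"
  have step: "p (Suc i) - p i = b / real n" for i
    by (simp add: p_def algebra_simps add_divide_distrib)
  have "b / real n < \<delta>"
    using n n0 assms by (simp add: field_simps)
  then have "mesh_less \<delta> n p"
    by (simp add: mesh_less_def step)
  moreover have "p i < p (Suc i)" for i
  proof -
    have "b / real n > 0" using b n0 by simp
    with step[of i] show ?thesis by linarith
  qed
  then have "is_partition b n p"
    using n0 by (simp add: is_partition_def p_def)
  ultimately show ?thesis by blast
qed

lemma has_young_integral_unique:
  assumes "fst t \<ge> 0" "snd t \<ge> 0" "has_young_integral A y t I" "has_young_integral A y t J"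
  shows "I = J"
proof (rule ccontr)
  assume "I \<noteq> J"
  define \<epsilon> where "\<epsilon> = norm (I - J) / 2"
  have \<epsilon>: "\<epsilon> > 0" using \<open>I \<noteq> J\<close> by (simp add: \<epsilon>_def)
  obtain d where d: "d > 0"
    "\<And>m p n q. is_partition (fst t) m p \<Longrightarrow> mesh_less d m p \<Longrightarrow> is_partition (snd t) n q \<Longrightarrow>
       mesh_less d n q \<Longrightarrow> norm (young_sum A y m p n q - I) < \<epsilon>"
    using assms(3) \<epsilon> unfolding has_young_integral_def by meson
  obtain e where e: "e > 0"
    "\<And>m p n q. is_partition (fst t) m p \<Longrightarrow> mesh_less e m p \<Longrightarrow> is_partition (snd t) n q \<Longrightarrow>
       mesh_less e n q \<Longrightarrow> norm (young_sum A y m p n q - J) < \<epsilon>"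
    using assms(4) \<epsilon> unfolding has_young_integral_def by meson
  obtain m p where p: "is_partition (fst t) m p" "mesh_less (min d e) m p"
    using ex_partition_mesh_less[of "fst t" "min d e"] assms d e by auto
  obtain n q where q: "is_partition (snd t) n q" "mesh_less (min d e) n q"
    using ex_partition_mesh_less[of "snd t" "min d e"] assms d e by auto
  let ?S = "young_sum A y m p n q"
  have "norm (?S - I) < \<epsilon>" "norm (?S - J) < \<epsilon>"
    using p q by (auto intro!: d(2) e(2) simp: mesh_less_def)
  moreover have "norm (I - J) \<le> norm (?S - I) + norm (?S - J)"
    using norm_triangle_ineq4[of "?S - J" "?S - I"] by (simp add: algebra_simps)
  ultimately show False unfolding \<epsilon>_def by simp
qed

definition young_solution ::
    "real \<Rightarrow> real \<times> real \<Rightarrow> (real \<times> real \<Rightarrow> 'a \<Rightarrow> 'a::real_normed_vector) \<Rightarrow>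
     (real \<times> real \<Rightarrow> 'a) \<Rightarrow> (real \<times> real \<Rightarrow> 'a) \<Rightarrow> bool" where
  "young_solution T \<gamma> A \<xi> \<theta> \<longleftrightarrow>
     holder_plane UNIV norm T \<gamma> \<theta> \<and>
     (\<forall>t\<in>square T. \<exists>I. has_young_integral A \<theta> t I \<and> \<theta> t = \<xi> t + I)"

end

(*
  Applying the one-dimensional sewing lemma once in each variable bounds double sums over product
  partitions, so the nonlinear Young integral exists for integrands in C^gamma, and its increment
  over a rectangle differs from the one-term approximation by terms of higher order.

  Existence. Fix a scale h and consider the functions y whose increments along the axes are
  bounded by K0 and whose rectangular increments over rectangles with sides at most h are bounded
  by a constant M depending only on A and gamma.  Summing over cells, the one-dimensional
  increments of y at scale h are at most K0 + (T/h + 1) M h^g2 (resp. with h^g1), so the products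
  that enter the sewing estimate are small as soon as h is small, because g1 + g2 > 1: the set is
  invariant under Gamma y = xi + int A(ds, y_s).  It is also invariant under the delay
  y(t1 - e, t2).  Iterating Gamma composed with the delay stabilises after finitely many steps, at
  a solution of the delayed equation; letting e tend to 0, Arzela-Ascoli gives a solution.

  Uniqueness. On a strip [a, a + h] x [0, T] over whose left edge two solutions agree, an
  eight-point estimate for C^(2+eta) maps shows that the difference of the solutions satisfies its
  own rectangular Hoelder bound with a factor O(h^(eta g1)); for small h it vanishes.
*)
theory Submission
  imports Defs "HOL-Complex_Analysis.Great_Picard"
begin

section \<open>Sewing on an interval\<close>

text \<open>The obstacle to solving strip by strip is that the one-dimensional Hoelder constants
  reached on each new edge feed into the next strip. It is avoided because the leading term of the
  integral over a cell, an increment of A evaluated at one point, is bounded whatever the solution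
  is, and \<open>\<xi>\<close> contributes nothing to rectangular increments. Hence the rectangular
  bound is universal and h can be fixed once for the whole square. Compactness costs no regularity:
  the invariant set is closed under pointwise limits with its exponents and constants, and partition
  sums converge at a rate depending only on the constants, so the integral passes to the limit. In
  the uniqueness part the factor h^(eta g1) has two sources: the difference of two solutions
  vanishes on the left edge of the strip, and the defects in the first variable have exponent (1 +
  eta) g1 instead of g1. That exponent replaces 2 g1 because a difference of two germs consumes one
  more derivative of A, and the second derivative is only eta-Hoelder; its modulus is used along the
  first direction, so the second keeps 2 g2.\<close>

fun psum :: "('a \<Rightarrow> 'a \<Rightarrow> 'b::real_normed_vector) \<Rightarrow> 'a list \<Rightarrow> 'b" where
  "psum f (x # y # xs) = f x y + psum f (y # xs)"
| "psum f _ = 0"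

lemma psum_append: "psum f (xs @ x # ys) = psum f (xs @ [x]) + psum f (x # ys)"
proof (induction xs)
  case (Cons a xs)
  then show ?case by (cases xs) (auto simp: algebra_simps)
qed simp

lemma psum_add: "psum (\<lambda>a b. f a b + g a b) xs = psum f xs + psum g xs"
  by (induction f xs rule: psum.induct) (auto simp: algebra_simps)

lemma psum_diff: "psum (\<lambda>a b. f a b - g a b) xs = psum f xs - psum g xs"
  by (induction f xs rule: psum.induct) (auto simp: algebra_simps)

lemma psum_zero: "psum (\<lambda>a b. 0) xs = 0"
  using psum_diff[of "\<lambda>a b. 0" "\<lambda>a b. 0" xs] by simp

lemma psum_swap: "psum (\<lambda>a b. psum (\<lambda>c d. f a b c d) ys) xs = psum (\<lambda>c d. psum (\<lambda>a b. f a b c d) xs) ys"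
  by (induction "\<lambda>a b. psum (\<lambda>c d. f a b c d) ys" xs rule: psum.induct) (auto simp: psum_add psum_zero)

lemma psum_map_upt: "psum f (map p [0..<Suc n]) = (\<Sum>i<n. f (p i) (p (Suc i)))"
proof (induction n)
  case (Suc n)
  have "psum f (map p [0..<Suc (Suc n)]) = psum f (map p [0..<n] @ p n # [p (Suc n)])"
    by simp
  also have "\<dots> = psum f (map p [0..<n] @ [p n]) + f (p n) (p (Suc n))"
    by (subst psum_append) simp
  finally show ?case using Suc by simp
qed simp

text \<open>Nodes may repeat: a common refinement is then just a sorted concatenation, and
  degenerate intervals need no special treatment. Repeated nodes are harmless because the defect
  bounds below force a germ to vanish on them.\<close>

definition part :: "real \<Rightarrow> real \<Rightarrow> real list \<Rightarrow> bool" where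
  "part a b xs \<longleftrightarrow> xs \<noteq> [] \<and> sorted xs \<and> hd xs = a \<and> last xs = b"

abbreviation mesh_le :: "real \<Rightarrow> real list \<Rightarrow> bool" where
  "mesh_le \<mu> \<equiv> successively (\<lambda>x y. y - x \<le> \<mu>)"

lemma part_bounds:
  assumes "part a b xs" "x \<in> set xs" shows "a \<le> x" "x \<le> b"
proof -
  show "a \<le> x" using assms by (cases xs) (auto simp: part_def)
  show "x \<le> b" using assms
    by (cases xs rule: rev_cases) (auto simp: part_def sorted_append)
qed

lemma part_le: "part a b xs \<Longrightarrow> a \<le> b"
  using part_bounds[of a b xs "hd xs"] by (auto simp: part_def)

lemma part_split:
  assumes "part a b (us @ x # vs)"
  shows "part a x (us @ [x])" "part x b (x # vs)"
  using assms by (cases us; auto simp: part_def sorted_append)+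

lemma part_join:
  assumes "part a x (us @ [x])" "part x b (x # vs)"
  shows "part a b (us @ x # vs)"
  using assms by (cases us; force simp: part_def sorted_append)+

text \<open>The solution \<open>K\<close> of \<open>K = 2 K 2\<^sup>-\<^sup>z + 2\<close>: \<open>sewing1\<close> cuts a partition at its midpoint into two halves.\<close>

definition sew_const :: "real \<Rightarrow> real" where
  "sew_const z = 2 / (1 - 2 powr (1 - z))"

lemma sew_const:
  assumes "1 < z" shows "0 < sew_const z" "2 * (sew_const z * (1/2) powr z) + 2 = sew_const z"
proof -
  have "2 powr (1 - z) < 2 powr 0" using assms by (intro powr_less_mono) auto
  then have l: "2 powr (1 - z) < 1" by simp
  then show "0 < sew_const z" by (simp add: sew_const_def)
  have e: "2 powr (1 - z) = 2 * (1/2) powr z"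
    by (simp add: powr_diff powr_divide)
  then show "2 * (sew_const z * (1/2) powr z) + 2 = sew_const z"
    using l unfolding sew_const_def e by (simp add: field_simps)
qed

text \<open>Let x be the last node up to the midpoint and y the next one. The nodes up to x and
  those from y on partition intervals at most half as long, so induction on the number of nodes
  applies to both. Inserting x and y into \<open>f a b\<close> costs two defects; the constant
  solves the resulting recursion and is independent of the number of nodes.\<close>

lemma sewing1:
  assumes z: "1 < z" and L: "0 \<le> L"
    and f: "\<And>u v w. A \<le> u \<Longrightarrow> u \<le> v \<Longrightarrow> v \<le> w \<Longrightarrow> w \<le> B \<Longrightarrow>
              norm (f u w - f u v - f v w) \<le> L * (w - u) powr z"
    and "part a b xs" "A \<le> a" "b \<le> B"
  shows "norm (psum f xs - f a b) \<le> sew_const z * L * (b - a) powr z"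
  using assms(4-6)
proof (induction "length xs" arbitrary: xs a b rule: less_induct)
  case less
  note p = \<open>part a b xs\<close>
  have ab: "a \<le> b" using part_le[OF p] .
  \<comment> \<open>With u = v = w the defect is \<open>- f u u\<close>, and the bound is a power of
    0, hence 0.\<close>
  have f0: "f u u = 0" if "A \<le> u" "u \<le> B" for u
    using f[of u u u] that by simp
  show ?case
  proof (cases "a = b")
    case True
    have "set ys \<subseteq> {a} \<Longrightarrow> psum f ys = 0" for ys
      using f0[of a] less.prems True ab by (induction f ys rule: psum.induct) auto
    moreover have "set xs \<subseteq> {a}" using part_bounds[OF p] True by force
    ultimately show ?thesis using f0[of a] True less.prems ab by simp
  next
    case False
    then have lt: "a < b" using ab by simp
    define m where "m = (a + b) / 2"
    define us where "us = takeWhile (\<lambda>x. x \<le> m) xs"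
    define vs where "vs = dropWhile (\<lambda>x. x \<le> m) xs"
    have xs: "xs = us @ vs" by (simp add: us_def vs_def)
    have "us \<noteq> []" using p lt by (cases xs) (auto simp: us_def m_def part_def)
    then obtain us' x where us: "us = us' @ [x]" by (cases us rule: rev_cases) auto
    have "vs \<noteq> []"
    proof
      assume "vs = []"
      then have "\<forall>x\<in>set xs. x \<le> m" by (simp add: vs_def dropWhile_eq_Nil_conv)
      then have "b \<le> m" using p by (metis last_in_set part_def)
      then show False using lt by (simp add: m_def)
    qed
    then obtain y vs' where vs: "vs = y # vs'" by (cases vs) auto
    have xm: "x \<le> m" using us by (metis us_def in_set_conv_decomp set_takeWhileD)
    have my: "m < y" using vs hd_dropWhile[of "\<lambda>x. x \<le> m" xs] by (simp add: vs_def)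
    have X: "xs = us' @ x # (y # vs')" using xs us vs by simp
    have p1: "part a x (us' @ [x])" and p2: "part x b (x # y # vs')"
      using part_split[of a b us' x "y # vs'"] p X by auto
    have p3: "part y b (y # vs')"
      using p2 by (auto simp: part_def)
    have ax: "a \<le> x" "x \<le> y" "y \<le> b" using part_le[OF p1] xm my part_le[OF p3] by auto
    have half: "(b - a) / 2 = m - a" "b - m = (b-a)/2" by (simp_all add: m_def field_simps)
    have K: "0 \<le> sew_const z * L" using sew_const(1)[OF z] L by simp
    have pw: "((b-a)/2) powr z = (1/2) powr z * (b-a) powr z"
      using lt by (simp add: powr_mult[symmetric])
    have e1: "norm (psum f (us' @ [x]) - f a x) \<le> sew_const z * L * ((b-a)/2) powr z"
    proof -
      have "norm (psum f (us' @ [x]) - f a x) \<le> sew_const z * L * (x - a) powr z"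
        by (rule less.hyps) (use p1 X ax less.prems in auto)
      also have "\<dots> \<le> sew_const z * L * ((b-a)/2) powr z"
        using K z ax xm half by (intro mult_left_mono powr_mono2) auto
      finally show ?thesis .
    qed
    have e2: "norm (psum f (y # vs') - f y b) \<le> sew_const z * L * ((b-a)/2) powr z"
    proof -
      have "norm (psum f (y # vs') - f y b) \<le> sew_const z * L * (b - y) powr z"
        by (rule less.hyps) (use p3 X ax less.prems in auto)
      also have "\<dots> \<le> sew_const z * L * ((b-a)/2) powr z"
        using K z ax my half by (intro mult_left_mono powr_mono2) auto
      finally show ?thesis .
    qed
    have e3: "norm (f a b - f a x - f x b) \<le> L * (b-a) powr z"
      using ax less.prems by (intro f) auto
    have e4: "norm (f x b - f x y - f y b) \<le> L * (b-a) powr z"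
    proof -
      have "norm (f x b - f x y - f y b) \<le> L * (b-x) powr z"
        using ax less.prems by (intro f) auto
      also have "\<dots> \<le> L * (b-a) powr z"
        using L z ax by (intro mult_left_mono powr_mono2) auto
      finally show ?thesis .
    qed
    have "psum f xs = psum f (us' @ [x]) + f x y + psum f (y # vs')"
      unfolding X by (subst psum_append) simp
    then have "psum f xs - f a b = (psum f (us' @ [x]) - f a x) + (psum f (y # vs') - f y b)
       - (f a b - f a x - f x b) - (f x b - f x y - f y b)"
      by (simp add: algebra_simps)
    also have "norm \<dots> \<le> norm (psum f (us' @ [x]) - f a x) + norm (psum f (y # vs') - f y b)
       + norm (f a b - f a x - f x b) + norm (f x b - f x y - f y b)"
      by norm
    also have "\<dots> \<le> L * (b-a) powr z * (2 * (sew_const z * (1/2) powr z) + 2)"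
      using e1 e2 e3 e4 unfolding pw by (simp add: algebra_simps)
    also have "\<dots> = sew_const z * L * (b-a) powr z"
      unfolding sew_const(2)[OF z] by simp
    finally show ?thesis .
  qed
qed

text \<open>On each interval of the coarse partition \<open>sewing1\<close> compares its single term
  with the finer sum. An interval of length l at most \<open>\<mu>\<close> costs l^z, which is at
  most \<open>\<mu>\<close>^(z-1) l, and the lengths l add up to b - a.\<close>

lemma refine1:
  assumes z: "1 < z" and L: "0 \<le> L"
    and f: "\<And>u v w. A \<le> u \<Longrightarrow> u \<le> v \<Longrightarrow> v \<le> w \<Longrightarrow> w \<le> B \<Longrightarrow>
              norm (f u w - f u v - f v w) \<le> L * (w - u) powr z"
    and "part a b xs" "A \<le> a" "b \<le> B" "part a b ys" "set xs \<subseteq> set ys" "mesh_le \<mu> xs"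
  shows "norm (psum f ys - psum f xs) \<le> sew_const z * L * \<mu> powr (z - 1) * (b - a)"
  using assms(4,5,7-9)
proof (induction xs arbitrary: a ys)
  case (Cons x xs)
  have xa: "x = a" using Cons.prems by (simp add: part_def)
  have K: "0 \<le> sew_const z * L" using sew_const(1)[OF z] L by simp
  show ?case
  proof (cases xs)
    case Nil
    then have "a = b" using Cons.prems by (simp add: part_def)
    moreover have "f b b = 0" using f[of b b b] \<open>b \<le> B\<close> Cons.prems \<open>a = b\<close> by simp
    ultimately show ?thesis
      using sewing1[OF z L f, of A B a b ys] Nil Cons.prems assms(6) by simp
  next
    case (Cons y xs')
    note xs = this
    have y: "y \<in> set ys" using Cons.prems xs by auto
    then obtain us vs where ys: "ys = us @ y # vs" by (meson split_list)
    have p1: "part a y (us @ [y])" and p2: "part y b (y # vs)"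
      using part_split[of a b us y vs] Cons.prems ys by auto
    have p3: "part y b xs" using Cons.prems(1) xs by (auto simp: part_def)
    have ay: "a \<le> y" "y \<le> b" using part_le[OF p1] part_le[OF p2] by auto
    \<comment> \<open>As nodes may repeat, a remaining coarse node may sit before the chosen
      occurrence of y; it then equals y.\<close>
    have sub: "set xs \<subseteq> set (y # vs)"
    proof
      fix e assume e: "e \<in> set xs"
      then have "e \<in> set ys" "y \<le> e" using Cons.prems part_bounds[OF p3] by auto
      moreover have "e \<in> set us \<Longrightarrow> e \<le> y" using part_bounds[OF p1] by auto
      ultimately show "e \<in> set (y # vs)" using ys by fastforce
    qed
    have ym: "y - a \<le> \<mu>" using Cons.prems xs xa by simp
    have "norm (psum f (us @ [y]) - f a y) \<le> sew_const z * L * (y - a) powr z"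
      using ay Cons.prems assms(6) by (intro sewing1[OF z L f, of A B] p1) auto
    also have "\<dots> \<le> sew_const z * L * (\<mu> powr (z - 1) * (y - a))"
    proof (intro mult_left_mono K)
      have "(y - a) powr z = (y - a) powr (z - 1) * (y - a)"
        using ay by (cases "y = a") (auto simp: powr_diff)
      also have "\<dots> \<le> \<mu> powr (z - 1) * (y - a)"
        using ay ym z by (intro mult_right_mono powr_mono2) auto
      finally show "(y - a) powr z \<le> \<mu> powr (z - 1) * (y - a)" .
    qed
    finally have e1: "norm (psum f (us @ [y]) - f a y) \<le> sew_const z * L * \<mu> powr (z - 1) * (y - a)"
      by (simp add: mult_ac)
    have e2: "norm (psum f (y # vs) - psum f xs) \<le> sew_const z * L * \<mu> powr (z - 1) * (b - y)"
      using Cons.prems ay xs by (intro Cons.IH p2 p3 sub) auto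
    have "psum f ys - psum f (x # xs) = (psum f (us @ [y]) - f a y) + (psum f (y # vs) - psum f xs)"
      unfolding ys xs xa by (subst psum_append) (simp add: algebra_simps)
    also have "norm \<dots> \<le> sew_const z * L * \<mu> powr (z - 1) * (y - a) + sew_const z * L * \<mu> powr (z - 1) * (b - y)"
      using e1 e2 norm_triangle_le add_mono by blast
    also have "\<dots> = sew_const z * L * \<mu> powr (z - 1) * (b - a)" by (simp add: algebra_simps)
    finally show ?thesis .
  qed
qed (simp add: part_def)

lemma part_merge: "part a b xs \<Longrightarrow> part a b ys \<Longrightarrow> part a b (sort (xs @ ys))"
proof -
  assume p: "part a b xs" "part a b ys"
  let ?l = "sort (xs @ ys)"
  have ne: "?l \<noteq> []" using p by (simp add: part_def) (metis append_is_Nil_conv length_0_conv length_sort p(1) part_def)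
  have ab: "a \<in> set ?l" "b \<in> set ?l" using p by (auto simp: part_def)
  have s: "sorted ?l" by simp
  have "a \<le> hd ?l" "last ?l \<le> b"
    using part_bounds p hd_in_set[OF ne] last_in_set[OF ne] by (auto simp del: sort_append)
  moreover have "hd ?l \<le> a" using s ab(1) by (cases ?l) auto
  moreover have "b \<le> last ?l" using s ab(2) by (cases ?l rule: rev_cases) (auto simp: sorted_append)
  ultimately show ?thesis using ne s unfolding part_def by simp
qed

section \<open>Sewing on a rectangle\<close>

definition dsum :: "('a \<Rightarrow> 'a \<Rightarrow> 'c \<Rightarrow> 'c \<Rightarrow> 'b::real_normed_vector) \<Rightarrow> 'a list \<Rightarrow> 'c list \<Rightarrow> 'b" where
  "dsum \<Xi> xs ys = psum (\<lambda>u v. psum (\<Xi> u v) ys) xs"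

text \<open>Exchanges the two variables, so that estimates in the second variable follow from those
  in the first.\<close>

lemma dsum_flip: "dsum (\<lambda>r s u v. \<Xi> u v r s) ys xs = dsum \<Xi> xs ys"
  unfolding dsum_def by (rule psum_swap)

lemma dsum_append1: "dsum \<Xi> (us @ x # vs) ys = dsum \<Xi> (us @ [x]) ys + dsum \<Xi> (x # vs) ys"
  unfolding dsum_def by (rule psum_append)

lemma dsum_append2: "dsum \<Xi> xs (us @ x # vs) = dsum \<Xi> xs (us @ [x]) + dsum \<Xi> xs (x # vs)"
  using dsum_append1[of "\<lambda>r s u v. \<Xi> u v r s" us x vs xs] unfolding dsum_flip[of \<Xi>] .

lemma dsum_diff: "dsum (\<lambda>u v r s. f u v r s - g u v r s) xs ys = dsum f xs ys - dsum g xs ys"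
  by (simp add: dsum_def psum_diff)

text \<open>The hypotheses \<open>d1\<close>, \<open>d2\<close> and \<open>d12\<close> bound the
  defect of additivity in the first variable, in the second, and the second-variable defect of the
  first-variable defect. The mixed defect has exponents above 1 in both variables, which allows
  first-variable defects to be sewn along the second variable.\<close>

locale germ =
  fixes a b c d g1 g2 z1 z2 L1 L2 L12 :: real
    and \<Xi> :: "real \<Rightarrow> real \<Rightarrow> real \<Rightarrow> real \<Rightarrow> 'b::banach"
  assumes z1: "1 < z1" and z2: "1 < z2"
    and L1: "0 \<le> L1" and L2: "0 \<le> L2" and L12: "0 \<le> L12"
    and g1: "0 < g1" and g2: "0 < g2"
    and d1: "\<And>u v w r s. a \<le> u \<Longrightarrow> u \<le> v \<Longrightarrow> v \<le> w \<Longrightarrow> w \<le> b \<Longrightarrow> c \<le> r \<Longrightarrow> r \<le> s \<Longrightarrow> s \<le> d \<Longrightarrow>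
      norm (\<Xi> u w r s - \<Xi> u v r s - \<Xi> v w r s) \<le> L1 * (w - u) powr z1 * (s - r) powr g2"
    and d2: "\<And>u v r s t. a \<le> u \<Longrightarrow> u \<le> v \<Longrightarrow> v \<le> b \<Longrightarrow> c \<le> r \<Longrightarrow> r \<le> s \<Longrightarrow> s \<le> t \<Longrightarrow> t \<le> d \<Longrightarrow>
      norm (\<Xi> u v r t - \<Xi> u v r s - \<Xi> u v s t) \<le> L2 * (v - u) powr g1 * (t - r) powr z2"
    and d12: "\<And>u v w r s t. a \<le> u \<Longrightarrow> u \<le> v \<Longrightarrow> v \<le> w \<Longrightarrow> w \<le> b \<Longrightarrow> c \<le> r \<Longrightarrow> r \<le> s \<Longrightarrow> s \<le> t \<Longrightarrow> t \<le> d \<Longrightarrow>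
      norm ((\<Xi> u w r t - \<Xi> u v r t - \<Xi> v w r t) - (\<Xi> u w r s - \<Xi> u v r s - \<Xi> v w r s)
        - (\<Xi> u w s t - \<Xi> u v s t - \<Xi> v w s t)) \<le> L12 * (w - u) powr z1 * (t - r) powr z2"
begin

lemma flip: "germ c d a b g2 g1 z2 z1 L2 L1 L12 (\<lambda>r s u v. \<Xi> u v r s)"
proof (unfold_locales, goal_cases)
  case (8 u v w r s)
  then show ?case using d2[of r s u v w] by (simp add: mult_ac)
next
  case (9 u v r s t)
  then show ?case using d1[of r s t u v] by (simp add: mult_ac)
next
  case (10 u v w r s t)
  then show ?case using d12[of r s t u v w] by (simp add: mult_ac algebra_simps)
qed (use z1 z2 L1 L2 L12 g1 g2 in auto)

definition R1 where "R1 = L1 * (d - c) powr g2 + sew_const z2 * L12 * (d - c) powr z2"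
definition R2 where "R2 = L2 * (b - a) powr g1 + sew_const z1 * L12 * (b - a) powr z1"

lemma R1_nonneg: "0 \<le> R1"
  using L1 L12 sew_const(1)[OF z2] by (simp add: R1_def)

text \<open>For fixed u, v, w the first-variable defect is a germ in the second variable, and its
  own defect is bounded by \<open>d12\<close>. Sewing it along the row shows that the row sums form
  a one-dimensional germ whose constant \<open>R1\<close> does not depend on the partition
  \<open>ys\<close>.\<close>

lemma row_defect:
  assumes ys: "part c d ys" and "a \<le> u" "u \<le> v" "v \<le> w" "w \<le> b"
  shows "norm (psum (\<Xi> u w) ys - psum (\<Xi> u v) ys - psum (\<Xi> v w) ys) \<le> R1 * (w - u) powr z1"
proof -
  define \<Phi> where "\<Phi> = (\<lambda>r s. \<Xi> u w r s - \<Xi> u v r s - \<Xi> v w r s)"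
  have cd: "c \<le> d" using part_le[OF ys] .
  have "norm (psum \<Phi> ys - \<Phi> c d) \<le> sew_const z2 * (L12 * (w - u) powr z1) * (d - c) powr z2"
  proof (rule sewing1[where A=c and B=d])
    show "norm (\<Phi> r t - \<Phi> r s - \<Phi> s t) \<le> L12 * (w - u) powr z1 * (t - r) powr z2"
      if "c \<le> r" "r \<le> s" "s \<le> t" "t \<le> d" for r s t
      unfolding \<Phi>_def using d12 that assms by blast
  qed (use z2 L12 ys in auto)
  moreover have "norm (\<Phi> c d) \<le> L1 * (w - u) powr z1 * (d - c) powr g2"
    unfolding \<Phi>_def using assms cd by (intro d1) auto
  moreover have "psum \<Phi> ys = psum (\<Xi> u w) ys - psum (\<Xi> u v) ys - psum (\<Xi> v w) ys"
    unfolding \<Phi>_def by (simp add: psum_diff)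
  ultimately have "norm (psum (\<Xi> u w) ys - psum (\<Xi> u v) ys - psum (\<Xi> v w) ys)
      \<le> sew_const z2 * (L12 * (w - u) powr z1) * (d - c) powr z2 + L1 * (w - u) powr z1 * (d - c) powr g2"
    using norm_diff_triangle_le[of "psum \<Phi> ys" "\<Phi> c d" _ 0] by simp
  then show ?thesis by (simp add: R1_def algebra_simps)
qed

text \<open>Sewing the row sums in the first variable leaves a single row over the whole of [a, b];
  sewing that row in the second variable leaves a single cell.\<close>

lemma dsum_bound:
  assumes xs: "part a b xs" and ys: "part c d ys"
  shows "norm (dsum \<Xi> xs ys - \<Xi> a b c d)
    \<le> sew_const z1 * R1 * (b - a) powr z1 + sew_const z2 * L2 * (b - a) powr g1 * (d - c) powr z2"
proof -
  have ab: "a \<le> b" using part_le[OF xs] .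
  have "norm (dsum \<Xi> xs ys - psum (\<Xi> a b) ys) \<le> sew_const z1 * R1 * (b - a) powr z1"
    unfolding dsum_def
    by (rule sewing1[OF z1 R1_nonneg, where A=a and B=b]) (use row_defect[OF ys] xs in auto)
  moreover have "norm (psum (\<Xi> a b) ys - \<Xi> a b c d) \<le> sew_const z2 * (L2 * (b - a) powr g1) * (d - c) powr z2"
    by (rule sewing1[OF z2, where A=c and B=d]) (use d2[of a b] ab L2 ys in auto)
  ultimately show ?thesis using norm_diff_triangle_le by (fastforce simp: mult.assoc)
qed

text \<open>Both partitions are compared with their common refinement, at the level of row
  sums.\<close>

lemma dsum_refine1:
  assumes xs: "part a b xs" "part a b xs'" "mesh_le \<mu> xs" "mesh_le \<mu> xs'" and ys: "part c d ys"
  shows "norm (dsum \<Xi> xs ys - dsum \<Xi> xs' ys) \<le> 2 * (sew_const z1 * R1 * \<mu> powr (z1 - 1) * (b - a))"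
proof -
  define X where "X = sort (xs @ xs')"
  have "norm (dsum \<Xi> X ys - dsum \<Xi> ws ys) \<le> sew_const z1 * R1 * \<mu> powr (z1 - 1) * (b - a)"
    if "part a b ws" "set ws \<subseteq> set X" "mesh_le \<mu> ws" for ws
    unfolding dsum_def
    by (rule refine1[OF z1 R1_nonneg, where A=a and B=b])
       (use row_defect[OF ys] that part_merge[OF xs(1,2)] in \<open>auto simp: X_def\<close>)
  from this[of xs] this[of xs'] xs
  have "norm (dsum \<Xi> xs ys - dsum \<Xi> X ys) \<le> sew_const z1 * R1 * \<mu> powr (z1 - 1) * (b - a)"
    "norm (dsum \<Xi> X ys - dsum \<Xi> xs' ys) \<le> sew_const z1 * R1 * \<mu> powr (z1 - 1) * (b - a)"
    by (auto simp: X_def norm_minus_commute)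
  from norm_diff_triangle_le[OF this] show ?thesis by (simp only: mult_2)
qed

text \<open>Involves only the rectangle and the constants of the germ, not the germ itself:
  partition sums converge at a common rate for all integrands with the same bounds, which is what
  \<open>J_tendsto\<close> relies on.\<close>

definition sew_mod where
  "sew_mod \<mu> = 2 * (sew_const z1 * R1 * \<mu> powr (z1 - 1) * (b - a)) + 2 * (sew_const z2 * R2 * \<mu> powr (z2 - 1) * (d - c))"

lemma dsum_refine:
  assumes "part a b xs" "part a b xs'" "mesh_le \<mu> xs" "mesh_le \<mu> xs'"
    "part c d ys" "part c d ys'" "mesh_le \<mu> ys" "mesh_le \<mu> ys'"
  shows "norm (dsum \<Xi> xs ys - dsum \<Xi> xs' ys') \<le> sew_mod \<mu>"
proof -
  interpret F: germ c d a b g2 g1 z2 z1 L2 L1 L12 "\<lambda>r s u v. \<Xi> u v r s" by (rule flip)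
  have "norm (dsum \<Xi> xs' ys - dsum \<Xi> xs' ys') \<le> 2 * (sew_const z2 * R2 * \<mu> powr (z2 - 1) * (d - c))"
    using F.dsum_refine1[OF assms(5-8,2)] unfolding dsum_flip[of \<Xi>] F.R1_def R2_def .
  with dsum_refine1[of xs xs' \<mu> ys] assms show ?thesis
    unfolding sew_mod_def by (intro norm_diff_triangle_le)
qed

end

section \<open>Convergence of the partition sums\<close>

lemma part_map_upt:
  assumes "\<And>i. i < n \<Longrightarrow> p i \<le> p (Suc i)"
  shows "part (p 0) (p n) (map p [0..<Suc n])"
proof -
  have "sorted (map p [0..<Suc n])" unfolding sorted_iff_nth_Suc
    using assms by (simp del: upt_Suc)
  then show ?thesis by (simp add: part_def hd_map del: upt_Suc) simp
qed

lemma mesh_le_map_upt: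
  assumes "\<And>i. i < n \<Longrightarrow> p (Suc i) - p i \<le> \<delta>"
  shows "mesh_le \<delta> (map p [0..<Suc n])"
  unfolding successively_conv_nth using assms by (simp del: upt_Suc)

lemma ex_part:
  assumes "a \<le> b" "0 < \<delta>"
  shows "\<exists>xs. part a b xs \<and> mesh_le \<delta> xs"
proof -
  obtain n p where p: "is_partition (b - a) n p" "mesh_less \<delta> n p"
    using ex_partition_mesh_less[of "b - a" \<delta>] assms by auto
  then have "part a b (map (\<lambda>i. a + p i) [0..<Suc n])"
    using part_map_upt[of n "\<lambda>i. a + p i"] by (simp add: is_partition_def less_imp_le del: upt_Suc)
  moreover have "mesh_le \<delta> (map (\<lambda>i. a + p i) [0..<Suc n])"
    using p by (intro mesh_le_map_upt) (simp add: mesh_less_def less_imp_le)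
  ultimately show ?thesis by blast
qed

text \<open>Unlike \<open>has_young_integral\<close>, it allows any base point, repeated nodes, and
  a mesh equal to \<open>\<delta>\<close>. With base point 0 it tests more partitions and hence
  implies the existence of the Young integral.\<close>

definition has_sewing :: "(real \<Rightarrow> real \<Rightarrow> real \<Rightarrow> real \<Rightarrow> 'b::banach) \<Rightarrow> real \<Rightarrow> real \<Rightarrow> real \<Rightarrow> real \<Rightarrow> 'b \<Rightarrow> bool" where
  "has_sewing \<Xi> a b c d I \<longleftrightarrow> (\<forall>\<epsilon>>0. \<exists>\<delta>>0. \<forall>xs ys.
     part a b xs \<and> mesh_le \<delta> xs \<and> part c d ys \<and> mesh_le \<delta> ys \<longrightarrow> norm (dsum \<Xi> xs ys - I) < \<epsilon>)"

lemma mesh_le_mono: "mesh_le \<delta> xs \<Longrightarrow> \<delta> \<le> \<delta>' \<Longrightarrow> mesh_le \<delta>' xs"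
  by (erule successively_mono) auto

context germ
begin

lemma sew_mod_tendsto: "(sew_mod \<longlongrightarrow> 0) (at_right 0)"
proof -
  have *: "((\<lambda>\<mu>. \<mu> powr w) \<longlongrightarrow> 0 powr w) (at_right 0)" if "0 < w" for w :: real
    by (rule tendsto_powr') (use that in \<open>auto simp: eventually_at_filter\<close>)
  have "((\<lambda>\<mu>. 2 * (sew_const z1 * R1 * \<mu> powr (z1 - 1) * (b - a)) + 2 * (sew_const z2 * R2 * \<mu> powr (z2 - 1) * (d - c)))
     \<longlongrightarrow> 2 * (sew_const z1 * R1 * 0 powr (z1 - 1) * (b - a)) + 2 * (sew_const z2 * R2 * 0 powr (z2 - 1) * (d - c))) (at_right 0)"
    using z1 z2 by (intro tendsto_intros *) auto
  then show ?thesis by (simp add: sew_mod_def[abs_def])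
qed

lemma sew_mod_small:
  assumes "0 < \<epsilon>" shows "\<exists>\<delta>>0. \<forall>\<mu>. 0 < \<mu> \<longrightarrow> \<mu> \<le> \<delta> \<longrightarrow> sew_mod \<mu> < \<epsilon>"
proof -
  have "\<forall>\<^sub>F \<mu> in at_right 0. sew_mod \<mu> < \<epsilon>"
    using order_tendstoD(2)[OF sew_mod_tendsto assms] .
  then obtain \<delta> where "\<delta> > 0" "\<And>\<mu>. 0 < \<mu> \<Longrightarrow> \<mu> < \<delta> \<Longrightarrow> sew_mod \<mu> < \<epsilon>"
    unfolding eventually_at_right_field by blast
  then show ?thesis by (intro exI[of _ "\<delta>/2"]) auto
qed

text \<open>Sums along meshes 1/(n+1) form a Cauchy sequence by \<open>dsum_refine\<close>. Letting
  one of the two pairs of partitions in that estimate run along the sequence gives the rate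
  \<open>sew_mod\<close>, and not merely convergence.\<close>

lemma ex_limit:
  assumes "a \<le> b" "c \<le> d"
  shows "\<exists>I. \<forall>\<mu>>0. \<forall>xs ys. part a b xs \<longrightarrow> mesh_le \<mu> xs \<longrightarrow> part c d ys \<longrightarrow> mesh_le \<mu> ys
    \<longrightarrow> norm (dsum \<Xi> xs ys - I) \<le> sew_mod \<mu>"
proof -
  have "\<exists>xs. part a b xs \<and> mesh_le (1 / Suc n) xs" "\<exists>xs. part c d xs \<and> mesh_le (1 / Suc n) xs" for n :: nat
    by (intro ex_part assms; simp)+
  then obtain X Y where X: "part a b (X n)" "mesh_le (1 / Suc n) (X n)"
    and Y: "part c d (Y n)" "mesh_le (1 / Suc n) (Y n)" for n :: nat by metis
  have XY: "mesh_le \<mu> (X n)" "mesh_le \<mu> (Y n)" if "n \<ge> m" "1 / Suc m \<le> \<mu>" for n m \<mu>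
  proof -
    have "1 / real (Suc n) \<le> 1 / real (Suc m)" using that by (simp add: frac_le)
    then have "1 / real (Suc n) \<le> \<mu>" using that by linarith
    then show "mesh_le \<mu> (X n)" "mesh_le \<mu> (Y n)" using X Y mesh_le_mono by blast+
  qed
  have "Cauchy (\<lambda>n. dsum \<Xi> (X n) (Y n))"
  proof (rule CauchyI)
    fix \<epsilon> :: real assume "0 < \<epsilon>"
    then obtain \<delta> where \<delta>: "\<delta> > 0" "\<And>\<mu>. 0 < \<mu> \<Longrightarrow> \<mu> \<le> \<delta> \<Longrightarrow> sew_mod \<mu> < \<epsilon>" using sew_mod_small by blast
    obtain m :: nat where m: "1 / Suc m < \<delta>" using \<delta>(1) nat_approx_posE by blast
    show "\<exists>M. \<forall>m\<ge>M. \<forall>n\<ge>M. norm (dsum \<Xi> (X m) (Y m) - dsum \<Xi> (X n) (Y n)) < \<epsilon>"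
    proof (intro exI[of _ m] allI impI)
      fix i j assume "i \<ge> m" "j \<ge> m"
      then have "norm (dsum \<Xi> (X i) (Y i) - dsum \<Xi> (X j) (Y j)) \<le> sew_mod \<delta>"
        using X Y XY[of m _ \<delta>] m by (intro dsum_refine) auto
      then show "norm (dsum \<Xi> (X i) (Y i) - dsum \<Xi> (X j) (Y j)) < \<epsilon>" using \<delta>(2)[of \<delta>] \<delta>(1) by auto
    qed
  qed
  then obtain I where I: "(\<lambda>n. dsum \<Xi> (X n) (Y n)) \<longlonglongrightarrow> I"
    using Cauchy_convergent convergent_def by blast
  have "norm (dsum \<Xi> xs ys - I) \<le> sew_mod \<mu>"
    if \<mu>: "0 < \<mu>" and p: "part a b xs" "mesh_le \<mu> xs" "part c d ys" "mesh_le \<mu> ys" for \<mu> xs ys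
  proof -
    obtain m :: nat where m: "1 / Suc m < \<mu>" by (rule nat_approx_posE[OF \<mu>])
    show ?thesis
    proof (rule Lim_bounded)
    show "(\<lambda>n. norm (dsum \<Xi> xs ys - dsum \<Xi> (X n) (Y n))) \<longlonglongrightarrow> norm (dsum \<Xi> xs ys - I)"
      by (intro tendsto_intros I)
    show "\<forall>n\<ge>m. norm (dsum \<Xi> xs ys - dsum \<Xi> (X n) (Y n)) \<le> sew_mod \<mu>"
      using X Y XY[of m _ \<mu>] p m by (intro allI impI dsum_refine) auto
    qed
  qed
  then show ?thesis by blast
qed

lemma has_sewingI:
  assumes "\<forall>\<mu>>0. \<forall>xs ys. part a b xs \<longrightarrow> mesh_le \<mu> xs \<longrightarrow> part c d ys \<longrightarrow> mesh_le \<mu> ys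
    \<longrightarrow> norm (dsum \<Xi> xs ys - I) \<le> sew_mod \<mu>"
  shows "has_sewing \<Xi> a b c d I"
  unfolding has_sewing_def
proof (intro allI impI)
  fix \<epsilon> :: real assume "0 < \<epsilon>"
  then obtain \<delta> where \<delta>: "\<delta> > 0" "\<And>\<mu>. 0 < \<mu> \<Longrightarrow> \<mu> \<le> \<delta> \<Longrightarrow> sew_mod \<mu> < \<epsilon>" using sew_mod_small by blast
  then show "\<exists>\<delta>>0. \<forall>xs ys. part a b xs \<and> mesh_le \<delta> xs \<and> part c d ys \<and> mesh_le \<delta> ys
      \<longrightarrow> norm (dsum \<Xi> xs ys - I) < \<epsilon>"
    using assms by (intro exI[of _ \<delta>]) (meson order_refl order_le_less_trans)
qed

end

lemma has_sewing_diff: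
  assumes "has_sewing f a b c d I" "has_sewing g a b c d J"
  shows "has_sewing (\<lambda>u v r s. f u v r s - g u v r s) a b c d (I - J)"
  unfolding has_sewing_def
proof (intro allI impI)
  fix \<epsilon> :: real assume "0 < \<epsilon>"
  then have e: "0 < \<epsilon>/2" by simp
  obtain \<delta>1 where 1: "\<delta>1 > 0" "\<And>xs ys. part a b xs \<and> mesh_le \<delta>1 xs \<and> part c d ys \<and> mesh_le \<delta>1 ys \<longrightarrow> norm (dsum f xs ys - I) < \<epsilon>/2"
    using assms(1)[unfolded has_sewing_def, rule_format, OF e] by blast
  obtain \<delta>2 where 2: "\<delta>2 > 0" "\<And>xs ys. part a b xs \<and> mesh_le \<delta>2 xs \<and> part c d ys \<and> mesh_le \<delta>2 ys \<longrightarrow> norm (dsum g xs ys - J) < \<epsilon>/2"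
    using assms(2)[unfolded has_sewing_def, rule_format, OF e] by blast
  show "\<exists>\<delta>>0. \<forall>xs ys. part a b xs \<and> mesh_le \<delta> xs \<and> part c d ys \<and> mesh_le \<delta> ys \<longrightarrow>
     norm (dsum (\<lambda>u v r s. f u v r s - g u v r s) xs ys - (I - J)) < \<epsilon>"
  proof (intro exI[of _ "min \<delta>1 \<delta>2"] conjI allI impI; (elim conjE)?)
    fix xs ys assume p: "part a b xs" "mesh_le (min \<delta>1 \<delta>2) xs" "part c d ys" "mesh_le (min \<delta>1 \<delta>2) ys"
    have "mesh_le \<delta>' xs" "mesh_le \<delta>' ys" if "min \<delta>1 \<delta>2 \<le> \<delta>'" for \<delta>'
      using mesh_le_mono p that by blast+
    then have "mesh_le \<delta>1 xs" "mesh_le \<delta>2 xs" "mesh_le \<delta>1 ys" "mesh_le \<delta>2 ys" by simp_all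
    then have "norm (dsum f xs ys - I) < \<epsilon>/2" "norm (dsum g xs ys - J) < \<epsilon>/2" using 1(2) 2(2) p by blast+
    then show "norm (dsum (\<lambda>u v r s. f u v r s - g u v r s) xs ys - (I - J)) < \<epsilon>"
      unfolding dsum_diff by norm
  qed (use 1 2 in simp)
qed

lemma mesh_le_join: "mesh_le \<delta> (us @ [x]) \<Longrightarrow> mesh_le \<delta> (x # vs) \<Longrightarrow> mesh_le \<delta> (us @ x # vs)"
  by (auto simp: successively_append_iff)

text \<open>Partitions through the nodes s1 and s2 make the sum over the inner rectangle the
  rectangular increment of four sums that start at (a1, a2). A bound on inner sums thus passes to
  the increment of the integrals, with no integral defined on the inner rectangle.\<close>

lemma has_sewing_rect_bound:
  assumes I: "has_sewing \<Xi> a1 t1 a2 t2 I11" "has_sewing \<Xi> a1 s1 a2 t2 I01"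
      "has_sewing \<Xi> a1 t1 a2 s2 I10" "has_sewing \<Xi> a1 s1 a2 s2 I00"
    and le: "a1 \<le> s1" "s1 \<le> t1" "a2 \<le> s2" "s2 \<le> t2"
    and B: "\<And>xs ys. part s1 t1 xs \<Longrightarrow> part s2 t2 ys \<Longrightarrow> norm (dsum \<Xi> xs ys - X) \<le> B"
  shows "norm (I11 - I10 - I01 + I00 - X) \<le> B"
proof (rule field_le_epsilon)
  fix \<epsilon> :: real assume "0 < \<epsilon>"
  then have e: "0 < \<epsilon>/4" by simp
  note D = I[unfolded has_sewing_def, rule_format, OF e]
  obtain \<delta>1 where 1: "\<delta>1 > 0" "\<And>xs ys. part a1 t1 xs \<and> mesh_le \<delta>1 xs \<and> part a2 t2 ys \<and> mesh_le \<delta>1 ys \<longrightarrow> norm (dsum \<Xi> xs ys - I11) < \<epsilon>/4"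
    using D(1) by blast
  obtain \<delta>2 where 2: "\<delta>2 > 0" "\<And>xs ys. part a1 s1 xs \<and> mesh_le \<delta>2 xs \<and> part a2 t2 ys \<and> mesh_le \<delta>2 ys \<longrightarrow> norm (dsum \<Xi> xs ys - I01) < \<epsilon>/4"
    using D(2) by blast
  obtain \<delta>3 where 3: "\<delta>3 > 0" "\<And>xs ys. part a1 t1 xs \<and> mesh_le \<delta>3 xs \<and> part a2 s2 ys \<and> mesh_le \<delta>3 ys \<longrightarrow> norm (dsum \<Xi> xs ys - I10) < \<epsilon>/4"
    using D(3) by blast
  obtain \<delta>4 where 4: "\<delta>4 > 0" "\<And>xs ys. part a1 s1 xs \<and> mesh_le \<delta>4 xs \<and> part a2 s2 ys \<and> mesh_le \<delta>4 ys \<longrightarrow> norm (dsum \<Xi> xs ys - I00) < \<epsilon>/4"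
    using D(4) by blast
  define \<delta> where "\<delta> = min (min \<delta>1 \<delta>2) (min \<delta>3 \<delta>4)"
  have \<delta>: "\<delta> > 0" "\<delta> \<le> \<delta>1" "\<delta> \<le> \<delta>2" "\<delta> \<le> \<delta>3" "\<delta> \<le> \<delta>4" using 1 2 3 4 by (auto simp: \<delta>_def)
  obtain xs where xs: "part a1 s1 xs" "mesh_le \<delta> xs" using ex_part le \<delta> by blast
  obtain us where us: "xs = us @ [s1]" using xs unfolding part_def by (metis append_butlast_last_id)
  obtain xs' where xs': "part s1 t1 xs'" "mesh_le \<delta> xs'" using ex_part le \<delta> by blast
  obtain vs where vs: "xs' = s1 # vs" using xs' unfolding part_def by (metis list.collapse)
  obtain ys where ys: "part a2 s2 ys" "mesh_le \<delta> ys" using ex_part le \<delta> by blast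
  obtain ps where ps: "ys = ps @ [s2]" using ys unfolding part_def by (metis append_butlast_last_id)
  obtain ys' where ys': "part s2 t2 ys'" "mesh_le \<delta> ys'" using ex_part le \<delta> by blast
  obtain qs where qs: "ys' = s2 # qs" using ys' unfolding part_def by (metis list.collapse)
  define X1 where "X1 = us @ s1 # vs"
  define Y1 where "Y1 = ps @ s2 # qs"
  have X1: "part a1 t1 X1" "mesh_le \<delta> X1"
    unfolding X1_def using xs xs' us vs by (auto intro!: part_join mesh_le_join)
  have Y1: "part a2 t2 Y1" "mesh_le \<delta> Y1"
    unfolding Y1_def using ys ys' ps qs by (auto intro!: part_join mesh_le_join)
  have m: "mesh_le \<delta>1 X1" "mesh_le \<delta>1 Y1" "mesh_le \<delta>2 xs" "mesh_le \<delta>2 Y1"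
    "mesh_le \<delta>3 X1" "mesh_le \<delta>3 ys" "mesh_le \<delta>4 xs" "mesh_le \<delta>4 ys"
    using X1 Y1 xs ys \<delta> mesh_le_mono by blast+
  have E: "norm (dsum \<Xi> X1 Y1 - I11) < \<epsilon>/4" "norm (dsum \<Xi> xs Y1 - I01) < \<epsilon>/4"
     "norm (dsum \<Xi> X1 ys - I10) < \<epsilon>/4" "norm (dsum \<Xi> xs ys - I00) < \<epsilon>/4"
    using 1(2)[of X1 Y1] 2(2)[of xs Y1] 3(2)[of X1 ys] 4(2)[of xs ys] X1 Y1 xs ys m by auto
  have a: "dsum \<Xi> X1 w = dsum \<Xi> xs w + dsum \<Xi> xs' w" for w
    unfolding X1_def us vs by (rule dsum_append1)
  have a2: "dsum \<Xi> w Y1 = dsum \<Xi> w ys + dsum \<Xi> w ys'" for w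
    unfolding Y1_def ps qs by (rule dsum_append2)
  have "norm (dsum \<Xi> xs' ys' - X) \<le> B" using B xs' ys' by blast
  moreover have "dsum \<Xi> xs' ys' = dsum \<Xi> X1 Y1 - dsum \<Xi> X1 ys - dsum \<Xi> xs Y1 + dsum \<Xi> xs ys"
    by (simp add: a a2)
  ultimately have "norm (dsum \<Xi> X1 Y1 - dsum \<Xi> X1 ys - dsum \<Xi> xs Y1 + dsum \<Xi> xs ys - X) \<le> B" by simp
  moreover have "norm (I11 - I10 - I01 + I00 - X)
      \<le> norm (dsum \<Xi> X1 Y1 - dsum \<Xi> X1 ys - dsum \<Xi> xs Y1 + dsum \<Xi> xs ys - X) + norm (dsum \<Xi> X1 Y1 - I11)
      + norm (dsum \<Xi> X1 ys - I10) + norm (dsum \<Xi> xs Y1 - I01) + norm (dsum \<Xi> xs ys - I00)"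
    by norm
  ultimately show "norm (I11 - I10 - I01 + I00 - X) \<le> B + \<epsilon>" using E by linarith
qed

text \<open>The increment is taken in the group of maps and evaluated afterwards, so that the
  Hoelder bound of A as a C^(2+eta)-valued function applies to it; \<open>rect_incr_apply\<close>
  gives the pointwise form used in \<open>young_sum\<close>.\<close>

definition young_germ :: "(real \<times> real \<Rightarrow> 'a \<Rightarrow> 'b::banach) \<Rightarrow> (real \<times> real \<Rightarrow> 'a) \<Rightarrow> real \<Rightarrow> real \<Rightarrow> real \<Rightarrow> real \<Rightarrow> 'b" where
  "young_germ A y a b c d = rect_incr (a, c) (b, d) A (y (a, c))"

lemma rect_incr_apply: "rect_incr s t A x = rect_incr s t (\<lambda>r. A r x)"
  by (simp add: rect_incr_def)

lemma young_sum_eq_dsum: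
  "young_sum A y m p n q = dsum (young_germ A y) (map p [0..<Suc m]) (map q [0..<Suc n])"
  unfolding young_sum_def dsum_def psum_map_upt young_germ_def rect_incr_apply ..

lemma has_sewing_imp_young:
  assumes "has_sewing (young_germ A y) 0 t1 0 t2 I"
  shows "has_young_integral A y (t1, t2) I"
  unfolding has_young_integral_def
proof (intro allI impI)
  fix \<epsilon> :: real assume "0 < \<epsilon>"
  then obtain \<delta> where \<delta>: "\<delta> > 0" "\<And>xs ys. part 0 t1 xs \<and> mesh_le \<delta> xs \<and> part 0 t2 ys \<and> mesh_le \<delta> ys
     \<longrightarrow> norm (dsum (young_germ A y) xs ys - I) < \<epsilon>"
    using assms unfolding has_sewing_def by blast
  have *: "part 0 b (map p [0..<Suc n])" "mesh_le \<delta> (map p [0..<Suc n])"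
    if "is_partition b n p" "mesh_less \<delta> n p" for b n p
    using that part_map_upt[of n p] mesh_le_map_upt[of n p \<delta>]
    by (simp_all add: is_partition_def mesh_less_def less_imp_le del: upt_Suc)
  show "\<exists>\<delta>>0. \<forall>m p n q. is_partition (fst (t1, t2)) m p \<and> mesh_less \<delta> m p \<and>
      is_partition (snd (t1, t2)) n q \<and> mesh_less \<delta> n q \<longrightarrow> norm (young_sum A y m p n q - I) < \<epsilon>"
    unfolding young_sum_eq_dsum fst_conv snd_conv using \<delta> * by (intro exI[of _ \<delta>]) blast
qed

section \<open>Difference estimates for smooth maps\<close>

lemma norm_increment_le_on_unit_interval:
  fixes g :: "real \<Rightarrow> 'b::real_normed_vector"
  assumes "\<And>r. 0 \<le> r \<Longrightarrow> r \<le> 1 \<Longrightarrow> (g has_vector_derivative g' r) (at r)"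
    and "\<And>r. 0 \<le> r \<Longrightarrow> r \<le> 1 \<Longrightarrow> norm (g' r) \<le> B"
  shows "norm (g 1 - g 0) \<le> B"
proof -
  have "norm (g 1 - g 0) \<le> B * norm (1 - 0 :: real)"
  proof (rule differentiable_bound[where S = "{0..1}" and f' = "\<lambda>r h. h *\<^sub>R g' r"])
    fix r :: real assume r: "r \<in> {0..1}"
    show "(g has_derivative (\<lambda>h. h *\<^sub>R g' r)) (at r within {0..1})"
      using assms(1)[of r] r unfolding has_vector_derivative_def
      by (auto intro: has_derivative_at_withinI)
    show "onorm (\<lambda>h. h *\<^sub>R g' r) \<le> B"
      using assms(2)[of r] r by (intro onorm_le) (auto simp: mult.commute[of B] intro: mult_left_mono)
  qed auto
  then show ?thesis by simp
qed

lemma has_vector_derivative_along_line: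
  assumes "(F has_derivative F') (at (p + r *\<^sub>R q))"
  shows "((\<lambda>r. F (p + r *\<^sub>R q)) has_vector_derivative F' q) (at r)"
proof -
  have "((\<lambda>r. p + r *\<^sub>R q) has_vector_derivative q) (at r)"
    by (auto intro!: derivative_eq_intros)
  from has_derivative_compose[OF this[unfolded has_vector_derivative_def] assms] show ?thesis
    unfolding has_vector_derivative_def
    by (simp add: linear_scale[OF has_derivative_linear[OF assms]])
qed

lemma norm_convex_comb_le:
  fixes a b :: "'a::real_normed_vector"
  assumes "0 \<le> r" "r \<le> 1" "norm a \<le> \<delta>" "norm b \<le> \<delta>"
  shows "norm (a + r *\<^sub>R (b - a)) \<le> \<delta>"
proof -
  have "a + r *\<^sub>R (b - a) = (1 - r) *\<^sub>R a + r *\<^sub>R b" by (simp add: algebra_simps)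
  also have "norm \<dots> \<le> (1 - r) * \<delta> + r * \<delta>"
    using assms by (intro norm_triangle_mono) (auto intro: mult_left_mono)
  finally show ?thesis by (simp add: algebra_simps)
qed

text \<open>The segments from w01 to w11 and from w00 to w10 are followed simultaneously; they stay
  within distance \<open>\<delta>\<close>. The derivative of the difference is F' applied to the
  second difference plus a difference of F' applied to w10 - w00. The modulus e is left free, so
  that the lemma serves both for Lipschitz and for Hoelder derivatives.\<close>

lemma four_point:
  fixes F :: "'a::real_normed_vector \<Rightarrow> 'b::real_normed_vector"
  assumes D: "\<And>x. (F has_derivative blinfun_apply (F' x)) (at x)"
    and c: "\<And>x. norm (F' x) \<le> c"
    and e: "\<And>x y. norm (x - y) \<le> \<delta> \<Longrightarrow> norm (F' x - F' y) \<le> e"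
    and w: "norm (w01 - w00) \<le> \<delta>" "norm (w11 - w10) \<le> \<delta>"
  shows "norm (F w11 - F w01 - F w10 + F w00) \<le> c * norm (w11 - w01 - w10 + w00) + e * norm (w10 - w00)"
proof -
  define p where "p = (\<lambda>r. w01 + r *\<^sub>R (w11 - w01))"
  define q where "q = (\<lambda>r. w00 + r *\<^sub>R (w10 - w00))"
  define g where "g = (\<lambda>r. F (p r) - F (q r))"
  define g' where "g' = (\<lambda>r. F' (p r) (w11 - w01) - F' (q r) (w10 - w00))"
  have "norm (g 1 - g 0) \<le> c * norm (w11 - w01 - w10 + w00) + e * norm (w10 - w00)"
  proof (rule norm_increment_le_on_unit_interval)
    fix r :: real assume r: "0 \<le> r" "r \<le> 1"
    show "(g has_vector_derivative g' r) (at r)"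
      unfolding g_def g'_def p_def q_def
      by (intro has_vector_derivative_diff has_vector_derivative_along_line D)
    have "p r - q r = (w01 - w00) + r *\<^sub>R ((w11 - w10) - (w01 - w00))"
      by (simp add: p_def q_def algebra_simps)
    then have pq: "norm (F' (p r) - F' (q r)) \<le> e"
      using norm_convex_comb_le[OF r w] by (intro e) simp
    have "g' r = F' (p r) (w11 - w01 - w10 + w00) + (F' (p r) - F' (q r)) (w10 - w00)"
      by (simp add: g'_def blinfun.bilinear_simps algebra_simps)
    also have "norm \<dots> \<le> norm (F' (p r)) * norm (w11 - w01 - w10 + w00)
        + norm (F' (p r) - F' (q r)) * norm (w10 - w00)"
      by (intro norm_triangle_mono norm_blinfun)
    also have "\<dots> \<le> c * norm (w11 - w01 - w10 + w00) + e * norm (w10 - w00)"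
      using c pq by (intro add_mono mult_right_mono) auto
    finally show "norm (g' r) \<le> c * norm (w11 - w01 - w10 + w00) + e * norm (w10 - w00)" .
  qed
  moreover have "g 1 - g 0 = F w11 - F w01 - F w10 + F w00"
    by (simp add: g_def p_def q_def)
  ultimately show ?thesis by simp
qed

lemma lipschitz_of_derivative_bound:
  fixes F :: "'a::real_normed_vector \<Rightarrow> 'b::real_normed_vector"
  assumes "\<And>x. (F has_derivative blinfun_apply (F' x)) (at x)" "\<And>x. norm (F' x) \<le> c"
  shows "norm (F x - F y) \<le> c * norm (x - y)"
  by (rule differentiable_bound[of UNIV]) (use assms in \<open>auto simp flip: norm_blinfun.rep_eq\<close>)

text \<open>All four corners are moved linearly from v to u. The derivative in r is a second
  difference of products of F' and u - v, and a discrete Leibniz rule splits it into four terms.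
  Three need only bounds on F' and its Lipschitz constant; in the last the second difference falls
  on F', and \<open>four_point\<close> for F' brings in the modulus e of F''.\<close>

lemma eight_point:
  fixes F :: "'a::real_normed_vector \<Rightarrow> 'b::real_normed_vector"
  assumes D: "\<And>x. (F has_derivative blinfun_apply (F' x)) (at x)"
    and D': "\<And>x. (F' has_derivative blinfun_apply (F'' x)) (at x)"
    and c: "\<And>x. norm (F' x) \<le> c" and c': "\<And>x. norm (F'' x) \<le> c"
    and e: "\<And>x y. norm (x - y) \<le> \<delta>1 \<Longrightarrow> norm (F'' x - F'' y) \<le> e"
    and u: "norm (u10 - u00) \<le> \<delta>1" "norm (u11 - u01) \<le> \<delta>1"
      "norm (u01 - u00) \<le> \<delta>2" "norm (u11 - u10) \<le> \<delta>2" "norm (u11 - u10 - u01 + u00) \<le> \<delta>12"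
    and v: "norm (v10 - v00) \<le> \<delta>1" "norm (v11 - v01) \<le> \<delta>1"
      "norm (v01 - v00) \<le> \<delta>2" "norm (v11 - v10) \<le> \<delta>2" "norm (v11 - v10 - v01 + v00) \<le> \<delta>12"
    and z: "norm ((u11 - v11) - (u10 - v10) - (u01 - v01) + (u00 - v00)) \<le> \<zeta>12"
      "norm ((u10 - v10) - (u00 - v00)) \<le> \<zeta>1" "norm ((u01 - v01) - (u00 - v00)) \<le> \<zeta>2"
      "norm (u00 - v00) \<le> \<zeta>"
  shows "norm ((F u11 - F u10 - F u01 + F u00) - (F v11 - F v10 - F v01 + F v00))
    \<le> c * \<zeta>12 + c * \<delta>2 * \<zeta>1 + c * \<delta>1 * \<zeta>2 + (c * \<delta>12 + e * \<delta>2) * \<zeta>"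
proof -
  define w where "w = (\<lambda>u v r. v + r *\<^sub>R (u - v) :: 'a)"
  let ?w11 = "w u11 v11" and ?w10 = "w u10 v10" and ?w01 = "w u01 v01" and ?w00 = "w u00 v00"
  define g where "g = (\<lambda>r. F (?w11 r) - F (?w10 r) - F (?w01 r) + F (?w00 r))"
  define g' where "g' = (\<lambda>r. F' (?w11 r) (u11 - v11) - F' (?w10 r) (u10 - v10)
     - F' (?w01 r) (u01 - v01) + F' (?w00 r) (u00 - v00))"
  have c0: "0 \<le> c" using norm_ge_zero order_trans c by blast
  have e0: "0 \<le> e"
  proof -
    have "0 \<le> \<delta>1" using u(1) norm_ge_zero order_trans by blast
    then show ?thesis using e[of 0 0] by simp
  qed
  have pos: "0 \<le> \<delta>1" "0 \<le> \<delta>2" "0 \<le> \<delta>12"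
    using u(1,3,5) norm_ge_zero order_trans by blast+
  have "norm (g 1 - g 0) \<le> c * \<zeta>12 + c * \<delta>2 * \<zeta>1 + c * \<delta>1 * \<zeta>2 + (c * \<delta>12 + e * \<delta>2) * \<zeta>"
  proof (rule norm_increment_le_on_unit_interval)
    fix r :: real assume r: "0 \<le> r" "r \<le> 1"
    show "(g has_vector_derivative g' r) (at r)"
      unfolding g_def g'_def w_def
      by (intro has_vector_derivative_diff has_vector_derivative_add has_vector_derivative_along_line D)
    have w1: "norm (w a b r - w a' b' r) \<le> \<delta>" if "norm (a - a') \<le> \<delta>" "norm (b - b') \<le> \<delta>" for a b a' b' \<delta>
    proof -
      have "w a b r - w a' b' r = (b - b') + r *\<^sub>R ((a - a') - (b - b'))"
        by (simp add: w_def algebra_simps)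
      then show ?thesis using norm_convex_comb_le[OF r that(2,1)] by simp
    qed
    have w2: "norm (?w11 r - ?w10 r - ?w01 r + ?w00 r) \<le> \<delta>12"
    proof -
      have "?w11 r - ?w10 r - ?w01 r + ?w00 r = (v11 - v10 - v01 + v00) +
         r *\<^sub>R ((u11 - u10 - u01 + u00) - (v11 - v10 - v01 + v00))"
        by (simp add: w_def algebra_simps)
      then show ?thesis using norm_convex_comb_le[OF r v(5) u(5)] by simp
    qed
    have lip: "norm (F' x - F' y) \<le> c * norm (x - y)" for x y
      by (rule lipschitz_of_derivative_bound[OF D' c'])
    have 1: "norm (F' (?w11 r) ((u11 - v11) - (u10 - v10) - (u01 - v01) + (u00 - v00))) \<le> c * \<zeta>12"
      using z(1) c c0 by (intro order_trans[OF norm_blinfun] mult_mono) auto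
    have 2: "norm ((F' (?w11 r) - F' (?w10 r)) ((u10 - v10) - (u00 - v00))) \<le> c * \<delta>2 * \<zeta>1"
      using z(2) c0 pos by (intro order_trans[OF norm_blinfun] mult_mono order_trans[OF lip] mult_left_mono w1 u v) auto
    have 3: "norm ((F' (?w11 r) - F' (?w01 r)) ((u01 - v01) - (u00 - v00))) \<le> c * \<delta>1 * \<zeta>2"
      using z(3) c0 pos by (intro order_trans[OF norm_blinfun] mult_mono order_trans[OF lip] mult_left_mono w1 u v) auto
    \<comment> \<open>The indices 01 and 10 of \<open>four_point\<close> are exchanged, so that the
      modulus of F'' is taken at the scale \<open>\<delta>1\<close> of the first direction.\<close>
    have "norm (F' (?w11 r) - F' (?w10 r) - F' (?w01 r) + F' (?w00 r))
       \<le> c * norm (?w11 r - ?w10 r - ?w01 r + ?w00 r) + e * norm (?w01 r - ?w00 r)"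
      by (rule four_point[OF D' c' e]) (auto intro!: w1 u v)
    also have "\<dots> \<le> c * \<delta>12 + e * \<delta>2"
      using c0 e0 by (intro add_mono mult_left_mono w2 w1 u v)
    finally have 4: "norm ((F' (?w11 r) - F' (?w10 r) - F' (?w01 r) + F' (?w00 r)) (u00 - v00)) \<le> (c * \<delta>12 + e * \<delta>2) * \<zeta>"
      using z(4) c0 e0 pos by (intro order_trans[OF norm_blinfun] mult_mono) auto
    have "g' r = F' (?w11 r) ((u11 - v11) - (u10 - v10) - (u01 - v01) + (u00 - v00))
       + (F' (?w11 r) - F' (?w10 r)) ((u10 - v10) - (u00 - v00))
       + (F' (?w11 r) - F' (?w01 r)) ((u01 - v01) - (u00 - v00))
       + (F' (?w11 r) - F' (?w10 r) - F' (?w01 r) + F' (?w00 r)) (u00 - v00)"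
      by (simp add: g'_def blinfun.bilinear_simps algebra_simps)
    then show "norm (g' r) \<le> c * \<zeta>12 + c * \<delta>2 * \<zeta>1 + c * \<delta>1 * \<zeta>2 + (c * \<delta>12 + e * \<delta>2) * \<zeta>"
      using 1 2 3 4 by (auto intro!: norm_triangle_mono)
  qed
  moreover have "g 1 - g 0 = (F u11 - F u10 - F u01 + F u00) - (F v11 - F v10 - F v01 + F v00)"
    by (simp add: g_def w_def)
  ultimately show ?thesis by simp
qed

section \<open>The space C^(2+eta): closure under differences, and bounds from its norm\<close>

lemma has_derivative_fderiv:
  "f differentiable (at x) \<Longrightarrow> (f has_derivative blinfun_apply (fderiv f x)) (at x)"
  unfolding fderiv_def
  by (metis bounded_linear_Blinfun_apply frechet_derivative_works has_derivative_bounded_linear)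

lemma fderiv_eqI:
  assumes "(f has_derivative blinfun_apply f') (at x)" shows "fderiv f x = f'"
  by (rule blinfun_eqI) (metis assms differentiable_def has_derivative_fderiv has_derivative_unique)

lemma fderiv_diff:
  assumes "\<And>x. f differentiable (at x)" "\<And>x. g differentiable (at x)"
  shows "fderiv (f - g) = fderiv f - fderiv g"
proof
  fix x
  have "((\<lambda>x. f x - g x) has_derivative (\<lambda>h. fderiv f x h - fderiv g x h)) (at x)"
    by (intro has_derivative_diff has_derivative_fderiv assms)
  then show "fderiv (f - g) x = (fderiv f - fderiv g) x"
    by (intro fderiv_eqI) (simp add: fun_diff_def blinfun.bilinear_simps[abs_def])
qed

lemma C2_holder_diff:
  assumes f: "f \<in> C2_holder \<eta>" and g: "g \<in> C2_holder \<eta>" shows "f - g \<in> C2_holder \<eta>"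
proof -
  have 1: "fderiv (f - g) = fderiv f - fderiv g"
    using f g by (intro fderiv_diff) (auto simp: C2_holder_def)
  have 2: "fderiv (fderiv f - fderiv g) = fderiv (fderiv f) - fderiv (fderiv g)"
    using f g by (intro fderiv_diff) (auto simp: C2_holder_def)
  have b: "bounded (range (p - q))" if pq: "bounded (range p)" "bounded (range q)"
    for p q :: "'x \<Rightarrow> 'y::real_normed_vector"
  proof -
    obtain P where "\<And>x. norm (p x) \<le> P" using pq(1) unfolding bounded_iff by auto
    moreover obtain Q where "\<And>x. norm (q x) \<le> Q" using pq(2) unfolding bounded_iff by auto
    ultimately have "norm (p x - q x) \<le> P + Q" for x
      by (meson add_mono norm_triangle_ineq4 order_trans)
    then show ?thesis unfolding bounded_iff by auto
  qed
  obtain C where C: "\<And>x y. norm (fderiv (fderiv f) x - fderiv (fderiv f) y) \<le> C * norm (x - y) powr \<eta>"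
    using f by (auto simp: C2_holder_def)
  obtain C' where C': "\<And>x y. norm (fderiv (fderiv g) x - fderiv (fderiv g) y) \<le> C' * norm (x - y) powr \<eta>"
    using g by (auto simp: C2_holder_def)
  have "norm ((fderiv (fderiv f) x - fderiv (fderiv g) x) - (fderiv (fderiv f) y - fderiv (fderiv g) y)) \<le> (C + C') * norm (x - y) powr \<eta>" for x y
  proof -
    have "(fderiv (fderiv f) x - fderiv (fderiv g) x) - (fderiv (fderiv f) y - fderiv (fderiv g) y)
      = (fderiv (fderiv f) x - fderiv (fderiv f) y) - (fderiv (fderiv g) x - fderiv (fderiv g) y)" by simp
    then show ?thesis using norm_triangle_le_diff[OF add_mono[OF C[of x y] C'[of x y]]]
      by (simp add: algebra_simps)
  qed
  then show ?thesis using f g unfolding C2_holder_def mem_Collect_eq 1 2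
    by (auto simp: fun_diff_def intro!: continuous_on_diff differentiable_diff b[unfolded fun_diff_def])
qed

text \<open>A real supremum bounds its members only when the set is bounded above, which membership
  in \<open>C2_holder\<close> provides. All four suprema are nonnegative, so a bound on their total
  bounds each of them.\<close>

lemma C2_holder_bounds:
  fixes f :: "'a::real_normed_vector \<Rightarrow> 'b::real_normed_vector"
  assumes f: "f \<in> C2_holder \<eta>" and N: "C2_holder_norm \<eta> f \<le> c"
  shows "\<And>x. (f has_derivative blinfun_apply (fderiv f x)) (at x)"
    and "\<And>x. (fderiv f has_derivative blinfun_apply (fderiv (fderiv f) x)) (at x)"
    and "\<And>x. norm (f x) \<le> c" and "\<And>x. norm (fderiv f x) \<le> c" and "\<And>x. norm (fderiv (fderiv f) x) \<le> c"
    and "\<And>x y. norm (fderiv (fderiv f) x - fderiv (fderiv f) y) \<le> c * norm (x - y) powr \<eta>"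
proof -
  define q where "q = (\<lambda>(x, y). norm (fderiv (fderiv f) x - fderiv (fderiv f) y) / norm (x - y) powr \<eta>)"
  show "\<And>x. (f has_derivative blinfun_apply (fderiv f x)) (at x)"
    "\<And>x. (fderiv f has_derivative blinfun_apply (fderiv (fderiv f) x)) (at x)"
    using f by (auto simp: C2_holder_def intro: has_derivative_fderiv)
  have bdd: "bdd_above (range (\<lambda>x. norm (h x)))" if "bounded (range h)" for h :: "'x \<Rightarrow> 'y::real_normed_vector"
    using that by (auto simp: bounded_iff bdd_above_def)
  have up: "norm (h x) \<le> (SUP x. norm (h x))" if "bounded (range h)" for h :: "'x \<Rightarrow> 'y::real_normed_vector" and x
    by (rule cSUP_upper[OF UNIV_I bdd[OF that]])
  have b: "bounded (range f)" "bounded (range (fderiv f))" "bounded (range (fderiv (fderiv f)))"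
    using f by (auto simp: C2_holder_def)
  obtain C where C: "\<And>x y. norm (fderiv (fderiv f) x - fderiv (fderiv f) y) \<le> C * norm (x - y) powr \<eta>"
    using f by (auto simp: C2_holder_def)
  have "q (x, y) \<le> \<bar>C\<bar>" for x y
  proof (cases "x = y")
    case False
    then show ?thesis using C[of x y] by (auto simp: q_def divide_le_eq intro: order_trans[OF _ mult_right_mono[of C "\<bar>C\<bar>"]])
  qed (simp add: q_def)
  then have "bdd_above (range q)" by (auto simp: bdd_above_def)
  then have q: "q p \<le> (SUP p. q p)" for p by (intro cSUP_upper) auto
  have q0: "0 \<le> (SUP p. q p)" using q[of "(0, 0)"] by (simp add: q_def)
  have n0: "0 \<le> (SUP x. norm (h x))" if "bounded (range h)" for h :: "'x \<Rightarrow> 'y::real_normed_vector"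
    using up[OF that] norm_ge_zero order_trans by blast
  have N': "(SUP x. norm (f x)) + (SUP x. norm (fderiv f x)) + (SUP x. norm (fderiv (fderiv f) x)) + (SUP p. q p) \<le> c"
    using N by (simp add: C2_holder_norm_def q_def)
  show "norm (f x) \<le> c" "norm (fderiv f x) \<le> c" "norm (fderiv (fderiv f) x) \<le> c" for x
    using N' up[OF b(1), of x] up[OF b(2), of x] up[OF b(3), of x] n0[OF b(1)] n0[OF b(2)] n0[OF b(3)] q0 by linarith+
  show "norm (fderiv (fderiv f) x - fderiv (fderiv f) y) \<le> c * norm (x - y) powr \<eta>" for x y
  proof (cases "x = y")
    case False
    have "q (x, y) \<le> c" using N' q[of "(x, y)"] n0[OF b(1)] n0[OF b(2)] n0[OF b(3)] by linarith
    then show ?thesis using False by (simp add: q_def divide_le_eq)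
  qed simp
qed

lemma C2_holder_rect_incr:
  assumes "\<forall>t\<in>square T. A t \<in> C2_holder \<eta>" "s \<in> square T" "t \<in> square T"
  shows "rect_incr s t A \<in> C2_holder \<eta>"
proof -
  have "rect_incr s t A = (A (fst t, snd t) - A (fst t, snd s)) - (A (fst s, snd t) - A (fst s, snd s))"
    by (simp add: rect_incr_def algebra_simps)
  then show ?thesis using assms by (auto intro!: C2_holder_diff simp: square_def)
qed

section \<open>The nonlinear Young integral\<close>

text \<open>The germ is controlled only on the small rectangle, so the constants are local, although
  the integrals start at (a1, a2).\<close>

lemma germ_sewing_bound:
  fixes \<Xi> :: "real \<Rightarrow> real \<Rightarrow> real \<Rightarrow> real \<Rightarrow> 'b::banach"
  assumes I: "has_sewing \<Xi> a1 t1 a2 t2 (I (t1, t2))" "has_sewing \<Xi> a1 s1 a2 t2 (I (s1, t2))"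
      "has_sewing \<Xi> a1 t1 a2 s2 (I (t1, s2))" "has_sewing \<Xi> a1 s1 a2 s2 (I (s1, s2))"
    and le: "a1 \<le> s1" "s1 \<le> t1" "a2 \<le> s2" "s2 \<le> t2"
    and G: "germ s1 t1 s2 t2 g1 g2 z1 z2 L1 L2 L12 \<Xi>"
  shows "norm (rect_incr (s1, s2) (t1, t2) I - \<Xi> s1 t1 s2 t2)
    \<le> sew_const z1 * (L1 * (t2 - s2) powr g2 + sew_const z2 * L12 * (t2 - s2) powr z2) * (t1 - s1) powr z1
      + sew_const z2 * L2 * (t1 - s1) powr g1 * (t2 - s2) powr z2"
proof -
  interpret germ s1 t1 s2 t2 g1 g2 z1 z2 L1 L2 L12 \<Xi> by (rule G)
  show ?thesis
    unfolding rect_incr_def fst_conv snd_conv R1_def[symmetric]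
    by (rule has_sewing_rect_bound[OF I le dsum_bound])
qed

lemma psum_tendsto:
  assumes "\<And>a b. a \<in> set xs \<Longrightarrow> b \<in> set xs \<Longrightarrow> ((\<lambda>n. f n a b) \<longlongrightarrow> g a b) F"
  shows "((\<lambda>n. psum (f n) xs) \<longlongrightarrow> psum g xs) F"
  using assms by (induction g xs rule: psum.induct) (auto intro!: tendsto_add)

text \<open>A quantitative form of \<open>holder_plane\<close> on a rectangle. Three constants are
  kept apart because, at a scale h, one-dimensional and rectangular increments have different bounds
  in the existence argument.\<close>

definition holder_rect :: "real \<Rightarrow> real \<Rightarrow> real \<Rightarrow> real \<Rightarrow> real \<Rightarrow> real \<Rightarrow> real \<Rightarrow> real \<Rightarrow> real \<Rightarrow>
    (real \<times> real \<Rightarrow> 'a::real_normed_vector) \<Rightarrow> bool" where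
  "holder_rect g1 g2 a b c d X1 X2 X12 y \<longleftrightarrow>
    (\<forall>u v r s. a \<le> u \<longrightarrow> u \<le> v \<longrightarrow> v \<le> b \<longrightarrow> c \<le> r \<longrightarrow> r \<le> s \<longrightarrow> s \<le> d \<longrightarrow>
      norm (y (v, r) - y (u, r)) \<le> X1 * (v - u) powr g1 \<and>
      norm (y (v, s) - y (u, s)) \<le> X1 * (v - u) powr g1 \<and>
      norm (y (u, s) - y (u, r)) \<le> X2 * (s - r) powr g2 \<and>
      norm (y (v, s) - y (v, r)) \<le> X2 * (s - r) powr g2 \<and>
      norm (rect_incr (u, r) (v, s) y) \<le> X12 * ((v - u) powr g1 * (s - r) powr g2))"

lemma holder_rectD:
  assumes "holder_rect g1 g2 a b c d X1 X2 X12 y" "a \<le> u" "u \<le> v" "v \<le> b" "c \<le> r" "r \<le> s" "s \<le> d"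
  shows "norm (y (v, r) - y (u, r)) \<le> X1 * (v - u) powr g1"
    "norm (y (v, s) - y (u, s)) \<le> X1 * (v - u) powr g1"
    "norm (y (u, s) - y (u, r)) \<le> X2 * (s - r) powr g2"
    "norm (y (v, s) - y (v, r)) \<le> X2 * (s - r) powr g2"
    "norm (rect_incr (u, r) (v, s) y) \<le> X12 * ((v - u) powr g1 * (s - r) powr g2)"
  using assms unfolding holder_rect_def by blast+

lemma holder_rectI:
  assumes "\<And>u v r. a \<le> u \<Longrightarrow> u \<le> v \<Longrightarrow> v \<le> b \<Longrightarrow> c \<le> r \<Longrightarrow> r \<le> d \<Longrightarrow> norm (y (v, r) - y (u, r)) \<le> X1 * (v - u) powr g1"
    "\<And>u r s. a \<le> u \<Longrightarrow> u \<le> b \<Longrightarrow> c \<le> r \<Longrightarrow> r \<le> s \<Longrightarrow> s \<le> d \<Longrightarrow> norm (y (u, s) - y (u, r)) \<le> X2 * (s - r) powr g2"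
    "\<And>u v r s. a \<le> u \<Longrightarrow> u \<le> v \<Longrightarrow> v \<le> b \<Longrightarrow> c \<le> r \<Longrightarrow> r \<le> s \<Longrightarrow> s \<le> d \<Longrightarrow>
      norm (rect_incr (u, r) (v, s) y) \<le> X12 * ((v - u) powr g1 * (s - r) powr g2)"
  shows "holder_rect g1 g2 a b c d X1 X2 X12 y"
  unfolding holder_rect_def using assms by auto

lemma holder_rect_subset:
  assumes "holder_rect g1 g2 a b c d X1 X2 X12 y" "a \<le> a'" "b' \<le> b" "c \<le> c'" "d' \<le> d"
  shows "holder_rect g1 g2 a' b' c' d' X1 X2 X12 y"
  using assms unfolding holder_rect_def by (meson order_trans)

lemma is_partition_bounds:
  assumes "is_partition b n p" "i \<le> n" shows "0 \<le> p i" "p i \<le> b"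
proof -
  have "\<And>i. i < n \<Longrightarrow> p i \<le> p (Suc i)" using assms(1) by (simp add: is_partition_def less_imp_le)
  then have "part (p 0) (p n) (map p [0..<Suc n])" by (rule part_map_upt)
  moreover have "p i \<in> set (map p [0..<Suc n])" using assms(2) by (simp add: less_Suc_eq_le del: upt_Suc)
  ultimately show "0 \<le> p i" "p i \<le> b"
    using part_bounds assms(1) unfolding is_partition_def by metis+
qed

lemma has_young_integral_cong:
  assumes "\<And>s. 0 \<le> fst s \<Longrightarrow> fst s \<le> fst t \<Longrightarrow> 0 \<le> snd s \<Longrightarrow> snd s \<le> snd t \<Longrightarrow> y s = y' s"
  shows "has_young_integral A y t I \<longleftrightarrow> has_young_integral A y' t I"
proof -
  have "young_sum A y m p n q = young_sum A y' m p n q"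
    if "is_partition (fst t) m p" "is_partition (snd t) n q" for m p n q
    unfolding young_sum_def
  proof (intro sum.cong refl)
    fix i j assume "i \<in> {..<m}" "j \<in> {..<n}"
    then have "y (p i, q j) = y' (p i, q j)"
      using is_partition_bounds[OF that(1), of i] is_partition_bounds[OF that(2), of j] by (intro assms) auto
    then show "rect_incr (p i, q j) (p (Suc i), q (Suc j)) (\<lambda>r. A r (y (p i, q j)))
      = rect_incr (p i, q j) (p (Suc i), q (Suc j)) (\<lambda>r. A r (y' (p i, q j)))" by simp
  qed
  then show ?thesis unfolding has_young_integral_def by (simp cong: conj_cong)
qed

lemma is_partition_0: "is_partition 0 n p \<Longrightarrow> n = 0"
  using is_partition_bounds(2)[of 0 n p 1] by (cases n) (auto simp: is_partition_def)

text \<open>A degenerate side admits only the partition without cells, so every sum is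
  empty.\<close>

lemma has_young_integral_axes:
  assumes "fst t = 0 \<or> snd t = 0" shows "has_young_integral A y t 0"
proof -
  have "young_sum A y m p n q = 0" if "is_partition (fst t) m p" "is_partition (snd t) n q" for m p n q
  proof -
    have "m = 0 \<or> n = 0" using assms that is_partition_0 by metis
    then show ?thesis by (auto simp: young_sum_def)
  qed
  then show ?thesis unfolding has_young_integral_def by (auto intro!: exI[of _ 1])
qed

text \<open>Arbitrary where the integral does not exist.\<close>

definition young_integral :: "(real \<times> real \<Rightarrow> 'a \<Rightarrow> 'b::real_normed_vector) \<Rightarrow> (real \<times> real \<Rightarrow> 'a) \<Rightarrow> real \<times> real \<Rightarrow> 'b" where
  "young_integral A y t = (SOME I. has_young_integral A y t I)"

lemma young_integral_eqI:
  assumes "0 \<le> fst t" "0 \<le> snd t" "has_young_integral A y t I" shows "young_integral A y t = I"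
  using has_young_integral_unique[OF assms(1,2) _ assms(3)] someI[of "has_young_integral A y t", OF assms(3)]
  unfolding young_integral_def by blast

locale young_driver =
  fixes T \<eta> C g1 g2 :: real and A :: "real \<times> real \<Rightarrow> 'a::euclidean_space \<Rightarrow> 'b::euclidean_space"
  assumes T: "0 < T" and \<eta>: "0 < \<eta>" "\<eta> < 1" and C: "0 \<le> C"
    and g1: "1/2 < g1" "g1 \<le> 1" and g2: "1/2 < g2" "g2 \<le> 1"
    and A_in: "\<forall>t\<in>square T. A t \<in> C2_holder \<eta>"
    and A_le: "\<And>u v r s. 0 \<le> u \<Longrightarrow> u \<le> v \<Longrightarrow> v \<le> T \<Longrightarrow> 0 \<le> r \<Longrightarrow> r \<le> s \<Longrightarrow> s \<le> T \<Longrightarrow>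
      C2_holder_norm \<eta> (rect_incr (u, r) (v, s) A) \<le> C * ((v - u) powr g1 * (s - r) powr g2)"
begin

abbreviation F where "F u v r s \<equiv> rect_incr (u, r) (v, s) A"
abbreviation F' where "F' u v r s \<equiv> fderiv (F u v r s)"
abbreviation F'' where "F'' u v r s \<equiv> fderiv (F' u v r s)"
abbreviation incr_weight where "incr_weight u v r s \<equiv> C * ((v - u) powr g1 * (s - r) powr g2)"

lemma F_facts:
  assumes "0 \<le> u" "u \<le> v" "v \<le> T" "0 \<le> r" "r \<le> s" "s \<le> T"
  shows "\<And>x. (F u v r s has_derivative blinfun_apply (F' u v r s x)) (at x)"
    and "\<And>x. (F' u v r s has_derivative blinfun_apply (F'' u v r s x)) (at x)"
    and "\<And>x. norm (F u v r s x) \<le> incr_weight u v r s" and "\<And>x. norm (F' u v r s x) \<le> incr_weight u v r s"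
    and "\<And>x. norm (F'' u v r s x) \<le> incr_weight u v r s"
    and "\<And>x y. norm (F'' u v r s x - F'' u v r s y) \<le> incr_weight u v r s * norm (x - y) powr \<eta>"
    and "\<And>x y. norm (F u v r s x - F u v r s y) \<le> incr_weight u v r s * norm (x - y)"
    and "\<And>x y. norm (F' u v r s x - F' u v r s y) \<le> incr_weight u v r s * norm (x - y)"
    and "0 \<le> incr_weight u v r s"
proof -
  have "F u v r s \<in> C2_holder \<eta>"
    using assms by (intro C2_holder_rect_incr[OF A_in]) (auto simp: square_def)
  note B = C2_holder_bounds[OF this A_le[OF assms]]
  show "\<And>x. (F u v r s has_derivative blinfun_apply (F' u v r s x)) (at x)"
    "\<And>x. (F' u v r s has_derivative blinfun_apply (F'' u v r s x)) (at x)"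
    "\<And>x. norm (F u v r s x) \<le> incr_weight u v r s" "\<And>x. norm (F' u v r s x) \<le> incr_weight u v r s"
    "\<And>x. norm (F'' u v r s x) \<le> incr_weight u v r s"
    "\<And>x y. norm (F'' u v r s x - F'' u v r s y) \<le> incr_weight u v r s * norm (x - y) powr \<eta>"
    "\<And>x y. norm (F u v r s x - F u v r s y) \<le> incr_weight u v r s * norm (x - y)"
    "\<And>x y. norm (F' u v r s x - F' u v r s y) \<le> incr_weight u v r s * norm (x - y)"
    "0 \<le> incr_weight u v r s"
    using lipschitz_of_derivative_bound[OF B(1) B(4)] lipschitz_of_derivative_bound[OF B(2) B(5)] C B by auto
qed

text \<open>Rectangular increments of A are additive, so a defect sees only the change of the point
  at which the increment over the later piece is evaluated. The same reason gives
  \<open>germ_defect2\<close> and \<open>germ_defect12\<close>.\<close>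

lemma germ_defect1:
  "young_germ A y u w r s - young_germ A y u v r s - young_germ A y v w r s
     = F v w r s (y (u, r)) - F v w r s (y (v, r))"
  by (simp add: young_germ_def rect_incr_def)

lemma germ_defect2:
  "young_germ A y u v r t - young_germ A y u v r s - young_germ A y u v s t
     = F u v s t (y (u, r)) - F u v s t (y (u, s))"
  by (simp add: young_germ_def rect_incr_def)

lemma germ_defect12:
  "(young_germ A y u w r t - young_germ A y u v r t - young_germ A y v w r t)
     - (young_germ A y u w r s - young_germ A y u v r s - young_germ A y v w r s)
     - (young_germ A y u w s t - young_germ A y u v s t - young_germ A y v w s t)
   = F v w s t (y (u, r)) - F v w s t (y (v, r)) - F v w s t (y (u, s)) + F v w s t (y (v, s))"
  by (simp add: young_germ_def rect_incr_def)

lemma incr_weight_mono: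
  assumes "u \<le> v" "v \<le> q" "r \<le> s" "s \<le> t"
  shows "incr_weight v q s t \<le> incr_weight u q r t"
  using C g1 g2 assms by (intro mult_left_mono mult_mono powr_mono2) auto

lemma powr_double: "x powr (2 * g) = x powr g * x powr g" for x g :: real
  by (simp add: powr_add[symmetric])

text \<open>Each exponent is doubled: one factor comes from the increment of A, the other from the
  increment of y at which it is evaluated. The one-variable defects use the Lipschitz bound of the
  increment, the mixed one \<open>four_point\<close>, whence the constant X12 + X1 X2.\<close>

lemma germ_young:
  assumes R: "0 \<le> a" "b \<le> T" "0 \<le> c" "d \<le> T"
    and y: "holder_rect g1 g2 a b c d X1 X2 X12 y" and X: "0 \<le> X1" "0 \<le> X2" "0 \<le> X12"
  shows "germ a b c d g1 g2 (2 * g1) (2 * g2) (C * X1) (C * X2) (C * (X12 + X1 * X2)) (young_germ A y)"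
proof (unfold_locales, goal_cases)
  case (8 u v q r s)
  note ff = F_facts[of v q r s]
  have "norm (F v q r s (y (u, r)) - F v q r s (y (v, r))) \<le> incr_weight v q r s * norm (y (u, r) - y (v, r))"
    using 8 R by (intro ff) auto
  also have "\<dots> \<le> incr_weight u q r s * (X1 * (q - u) powr g1)"
  proof (rule mult_mono)
    have "norm (y (u, r) - y (v, r)) \<le> X1 * (v - u) powr g1"
      using holder_rectD(1)[OF y, of u v r s] 8 by (simp add: norm_minus_commute)
    also have "\<dots> \<le> X1 * (q - u) powr g1" using X 8 g1 by (intro mult_left_mono powr_mono2) auto
    finally show "norm (y (u, r) - y (v, r)) \<le> X1 * (q - u) powr g1" .
  qed (use 8 C in \<open>auto intro: incr_weight_mono\<close>)
  finally show ?case unfolding germ_defect1 powr_double by (simp add: mult_ac)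
next
  case (9 u v r s t)
  note ff = F_facts[of u v s t]
  have "norm (F u v s t (y (u, r)) - F u v s t (y (u, s))) \<le> incr_weight u v s t * norm (y (u, r) - y (u, s))"
    using 9 R by (intro ff) auto
  also have "\<dots> \<le> incr_weight u v r t * (X2 * (t - r) powr g2)"
  proof (rule mult_mono)
    have "norm (y (u, r) - y (u, s)) \<le> X2 * (s - r) powr g2"
      using holder_rectD(3)[OF y, of u v r s] 9 by (simp add: norm_minus_commute)
    also have "\<dots> \<le> X2 * (t - r) powr g2" using X 9 g2 by (intro mult_left_mono powr_mono2) auto
    finally show "norm (y (u, r) - y (u, s)) \<le> X2 * (t - r) powr g2" .
  qed (use 9 C in \<open>auto intro: incr_weight_mono\<close>)
  finally show ?case unfolding germ_defect2 powr_double by (simp add: mult_ac)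
next
  case (10 u v q r s t)
  let ?a = "(q - u) powr g1" and ?b = "(t - r) powr g2"
  have F_hyp: "0 \<le> v" "v \<le> q" "q \<le> T" "0 \<le> s" "s \<le> t" "t \<le> T" using 10 R by auto
  note ff = F_facts[OF F_hyp]
  have yD: "norm (y (v, r) - y (u, r)) \<le> X1 * (v - u) powr g1"
    "norm (y (v, s) - y (u, s)) \<le> X1 * (v - u) powr g1"
    "norm (y (u, s) - y (u, r)) \<le> X2 * (s - r) powr g2"
    "norm (y (v, s) - y (v, r)) \<le> X2 * (s - r) powr g2"
    "norm (rect_incr (u, r) (v, s) y) \<le> X12 * ((v - u) powr g1 * (s - r) powr g2)"
    using 10 by (auto intro!: holder_rectD[OF y])
  have le: "(v - u) powr g1 \<le> ?a" "(s - r) powr g2 \<le> ?b"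
    using 10 g1 g2 by (auto intro!: powr_mono2)
  let ?c = "incr_weight v q s t" and ?d = "X1 * (v - u) powr g1"
  have "norm (F v q s t (y (v, s)) - F v q s t (y (v, r)) - F v q s t (y (u, s)) + F v q s t (y (u, r)))
     \<le> ?c * norm (y (v, s) - y (v, r) - y (u, s) + y (u, r)) + (?c * ?d) * norm (y (u, s) - y (u, r))"
  \<comment> \<open>The separation of the segments is the increment of y in the first direction; F'
    is Lipschitz, so its modulus there is the weight times that increment.\<close>
  proof (rule four_point[OF ff(1,4)])
    show "norm (F' v q s t x - F' v q s t x') \<le> ?c * ?d" if "norm (x - x') \<le> ?d" for x x'
      using order_trans[OF ff(8) mult_left_mono[OF that ff(9)]] .
  qed (rule yD)+
  also have "y (v, s) - y (v, r) - y (u, s) + y (u, r) = rect_incr (u, r) (v, s) y"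
    by (simp add: rect_incr_def)
  also have "?c * norm (rect_incr (u, r) (v, s) y) + (?c * ?d) * norm (y (u, s) - y (u, r))
    \<le> incr_weight u q r t * (X12 * (?a * ?b)) + (incr_weight u q r t * (X1 * ?a)) * (X2 * ?b)"
  proof -
    have 1: "norm (rect_incr (u, r) (v, s) y) \<le> X12 * (?a * ?b)"
      using X le by (intro order_trans[OF yD(5)] mult_left_mono mult_mono) auto
    have 2: "norm (y (u, s) - y (u, r)) \<le> X2 * ?b"
      using X le by (intro order_trans[OF yD(3)] mult_left_mono) auto
    have 3: "?d \<le> X1 * ?a" using X le by (intro mult_left_mono)
    have 4: "?c \<le> incr_weight u q r t" using 10 by (intro incr_weight_mono) auto
    then have 5: "?c * ?d \<le> incr_weight u q r t * (X1 * ?a)"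
      using 3 X ff(9) by (intro mult_mono[OF 4 3]) auto
    have 6: "0 \<le> incr_weight u q r t" using C by simp
    show ?thesis using X 6
      by (intro add_mono mult_mono[OF 4 1] mult_mono[OF 5 2] mult_nonneg_nonneg[OF 6]) auto
  qed
  also have "\<dots> = C * (X12 + X1 * X2) * (q - u) powr (2 * g1) * (t - r) powr (2 * g2)"
    unfolding powr_double by (simp add: algebra_simps)
  also have "F v q s t (y (v, s)) - F v q s t (y (v, r)) - F v q s t (y (u, s)) + F v q s t (y (u, r))
     = F v q s t (y (u, r)) - F v q s t (y (v, r)) - F v q s t (y (u, s)) + F v q s t (y (v, s))"
    by (simp add: algebra_simps)
  finally show ?case unfolding germ_defect12 .
qed (use g1 g2 C X in auto)

abbreviation J where "J \<equiv> young_integral A"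

lemma
  assumes y: "holder_rect g1 g2 0 T 0 T X X X y" and X: "0 \<le> X" and ab: "0 \<le> a" "a \<le> T" "0 \<le> b" "b \<le> T"
  shows has_sewing_J: "has_sewing (young_germ A y) 0 a 0 b (J y (a, b))"
    and dsum_J_bound: "0 < \<mu> \<Longrightarrow> part 0 a xs \<Longrightarrow> mesh_le \<mu> xs \<Longrightarrow> part 0 b ys \<Longrightarrow> mesh_le \<mu> ys \<Longrightarrow>
      norm (dsum (young_germ A y) xs ys - J y (a, b))
        \<le> germ.sew_mod 0 a 0 b g1 g2 (2 * g1) (2 * g2) (C * X) (C * X) (C * (X + X * X)) \<mu>"
    and has_young_integral_J: "has_young_integral A y (a, b) (J y (a, b))"
proof -
  interpret germ 0 a 0 b g1 g2 "2 * g1" "2 * g2" "C * X" "C * X" "C * (X + X * X)" "young_germ A y"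
    using ab X by (intro germ_young holder_rect_subset[OF y]) auto
  obtain I where I: "\<forall>\<mu>>0. \<forall>xs ys. part 0 a xs \<longrightarrow> mesh_le \<mu> xs \<longrightarrow> part 0 b ys \<longrightarrow> mesh_le \<mu> ys
    \<longrightarrow> norm (dsum (young_germ A y) xs ys - I) \<le> sew_mod \<mu>"
    using ex_limit ab by blast
  then have S: "has_sewing (young_germ A y) 0 a 0 b I" by (rule has_sewingI)
  then have Y: "has_young_integral A y (a, b) I" by (rule has_sewing_imp_young)
  then have J: "J y (a, b) = I" using ab by (intro young_integral_eqI) auto
  show "has_sewing (young_germ A y) 0 a 0 b (J y (a, b))" "has_young_integral A y (a, b) (J y (a, b))"
    using S Y J by auto
  show "norm (dsum (young_germ A y) xs ys - J y (a, b)) \<le> sew_mod \<mu>"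
    if "0 < \<mu>" "part 0 a xs" "mesh_le \<mu> xs" "part 0 b ys" "mesh_le \<mu> ys"
    using I that unfolding J by blast
qed

lemma J_axes: "0 \<le> a \<Longrightarrow> J y (a, 0) = 0" "0 \<le> b \<Longrightarrow> J y (0, b) = 0"
  by (auto intro!: young_integral_eqI has_young_integral_axes)

text \<open>The bound on the whole square guarantees that the integrals exist, while the estimate
  uses the constants on the cell. Once their products with the side lengths are at most 1, they
  disappear from the result; this makes the rectangular bound universal.\<close>

lemma J_rect_bound:
  assumes y: "holder_rect g1 g2 0 T 0 T X X X y" "0 \<le> X"
    and R: "0 \<le> u" "u \<le> v" "v \<le> T" "0 \<le> r" "r \<le> s" "s \<le> T"
    and loc: "holder_rect g1 g2 u v r s X1 X2 X12 y" "0 \<le> X1" "0 \<le> X2" "0 \<le> X12"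
    and small: "X1 * (v - u) powr g1 \<le> 1" "X2 * (s - r) powr g2 \<le> 1"
      "X12 * ((v - u) powr g1 * (s - r) powr g2) \<le> 1"
  shows "norm (rect_incr (u, r) (v, s) (J y))
    \<le> C * (1 + sew_const (2 * g1) + sew_const (2 * g2) + 2 * sew_const (2 * g1) * sew_const (2 * g2))
      * ((v - u) powr g1 * (s - r) powr g2)"
proof -
  let ?a = "(v - u) powr g1" and ?b = "(s - r) powr g2"
  let ?K1 = "sew_const (2 * g1)" and ?K2 = "sew_const (2 * g2)"
  have K: "0 \<le> ?K1" "0 \<le> ?K2" using sew_const(1)[of "2 * g1"] sew_const(1)[of "2 * g2"] g1 g2 by auto
  have "norm (rect_incr (u, r) (v, s) (J y) - young_germ A y u v r s)
      \<le> ?K1 * (C * X1 * ?b + ?K2 * (C * (X12 + X1 * X2)) * (s - r) powr (2 * g2)) * (v - u) powr (2 * g1)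
        + ?K2 * (C * X2) * ?a * (s - r) powr (2 * g2)"
    using R loc by (intro germ_sewing_bound[where ?a1.0 = 0 and ?a2.0 = 0] has_sewing_J[OF y] germ_young) auto
  also have "\<dots> = C * (?a * ?b) * (?K1 * (X1 * ?a) + ?K1 * ?K2 * (X12 * (?a * ?b) + (X1 * ?a) * (X2 * ?b)) + ?K2 * (X2 * ?b))"
    unfolding powr_double by (simp add: algebra_simps)
  \<comment> \<open>The mixed defect contributes two products, one from the rectangular increment of
    y and one from the two one-dimensional increments, each at most 1.\<close>
  also have "\<dots> \<le> C * (?a * ?b) * (?K1 * 1 + ?K1 * ?K2 * (1 + 1 * 1) + ?K2 * 1)"
    using C K small loc by (intro mult_left_mono add_mono mult_mono) auto
  finally have "norm (rect_incr (u, r) (v, s) (J y) - young_germ A y u v r s)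
      \<le> C * (?a * ?b) * (?K1 * 1 + ?K1 * ?K2 * (1 + 1 * 1) + ?K2 * 1)" .
  moreover have "norm (young_germ A y u v r s) \<le> C * (?a * ?b)"
    unfolding young_germ_def by (rule F_facts(3)[OF R])
  ultimately have "norm (rect_incr (u, r) (v, s) (J y))
      \<le> C * (?a * ?b) * (?K1 * 1 + ?K1 * ?K2 * (1 + 1 * 1) + ?K2 * 1) + C * (?a * ?b)"
    using norm_triangle_sub order_trans add_mono by (smt (verit))
  then show ?thesis by (simp add: algebra_simps)
qed

text \<open>Causality: sums for t sample y only to the left of t. This is what makes the iteration
  of the delayed equation stabilise.\<close>

lemma J_cong:
  assumes "t \<in> square T" "\<And>s. s \<in> square T \<Longrightarrow> fst s \<le> fst t \<Longrightarrow> y s = y' s"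
  shows "J y t = J y' t"
proof -
  have "has_young_integral A y t = has_young_integral A y' t"
  proof
    fix I show "has_young_integral A y t I = has_young_integral A y' t I"
      by (rule has_young_integral_cong) (use assms in \<open>auto simp: square_def\<close>)
  qed
  then show ?thesis by (simp add: young_integral_def)
qed

text \<open>One pair of partitions approximates all the integrals within a third of the error, by
  the common rate \<open>sew_mod\<close>. For fixed partitions the sum involves finitely many values
  of continuous maps, so pointwise convergence suffices.\<close>

lemma J_tendsto:
  assumes y: "\<And>n. holder_rect g1 g2 0 T 0 T X X X (y n)" "holder_rect g1 g2 0 T 0 T X X X z" "0 \<le> X"
    and lim: "\<And>t. t \<in> square T \<Longrightarrow> (\<lambda>n. y n t) \<longlonglongrightarrow> z t" and t: "t \<in> square T"
  shows "(\<lambda>n. J (y n) t) \<longlonglongrightarrow> J z t"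
proof (rule LIMSEQ_I)
  fix \<epsilon> :: real assume "0 < \<epsilon>"
  obtain a b where ab: "t = (a, b)" "0 \<le> a" "a \<le> T" "0 \<le> b" "b \<le> T"
    using t by (cases t) (auto simp: square_def)
  interpret germ 0 a 0 b g1 g2 "2 * g1" "2 * g2" "C * X" "C * X" "C * (X + X * X)" "young_germ A z"
    using ab y(3) by (intro germ_young holder_rect_subset[OF y(2)]) auto
  obtain \<mu> where \<mu>: "\<mu> > 0" "sew_mod \<mu> < \<epsilon> / 3"
    using sew_mod_small[of "\<epsilon> / 3"] \<open>0 < \<epsilon>\<close> by (metis divide_pos_pos order_refl zero_less_numeral)
  obtain xs where xs: "part 0 a xs" "mesh_le \<mu> xs" using ex_part \<mu> ab by blast
  obtain ys where ys: "part 0 b ys" "mesh_le \<mu> ys" using ex_part \<mu> ab by blast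
  have bound: "norm (dsum (young_germ A x) xs ys - J x (a, b)) < \<epsilon> / 3" if "holder_rect g1 g2 0 T 0 T X X X x" for x
    using dsum_J_bound[OF that y(3) ab(2-5) \<mu>(1) xs ys] \<mu>(2) by linarith
  have "(\<lambda>n. dsum (young_germ A (y n)) xs ys) \<longlonglongrightarrow> dsum (young_germ A z) xs ys"
    unfolding dsum_def
  proof (intro psum_tendsto)
    fix u v r s assume h: "u \<in> set xs" "v \<in> set xs" "r \<in> set ys" "s \<in> set ys"
    have sq: "(u, r) \<in> square T" "(v, s) \<in> square T"
      using part_bounds[OF xs(1) h(1)] part_bounds[OF xs(1) h(2)] part_bounds[OF ys(1) h(3)]
        part_bounds[OF ys(1) h(4)] ab by (auto simp: square_def)
    have "(\<lambda>n. f (y n (u, r))) \<longlonglongrightarrow> f (z (u, r))" if "f \<in> C2_holder \<eta>" for f :: "'a \<Rightarrow> 'b"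
    proof (rule isCont_tendsto_compose[where g = f])
      show "isCont f (z (u, r))"
        using that by (auto simp: C2_holder_def intro: differentiable_imp_continuous_within)
    qed (rule lim[OF sq(1)])
    moreover have "F u v r s \<in> C2_holder \<eta>" by (rule C2_holder_rect_incr[OF A_in sq])
    ultimately show "(\<lambda>n. young_germ A (y n) u v r s) \<longlonglongrightarrow> young_germ A z u v r s"
      unfolding young_germ_def by blast
  qed
  then obtain N where N: "\<And>n. n \<ge> N \<Longrightarrow> norm (dsum (young_germ A (y n)) xs ys - dsum (young_germ A z) xs ys) < \<epsilon> / 3"
    using LIMSEQ_D[of _ _ "\<epsilon> / 3"] \<open>0 < \<epsilon>\<close> by (metis divide_pos_pos zero_less_numeral)
  show "\<exists>N. \<forall>n\<ge>N. norm (J (y n) t - J z t) < \<epsilon>"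
  proof (intro exI[of _ N] allI impI)
    fix n assume "n \<ge> N"
    have "J (y n) t - J z t = (dsum (young_germ A (y n)) xs ys - dsum (young_germ A z) xs ys)
       - (dsum (young_germ A (y n)) xs ys - J (y n) (a, b)) + (dsum (young_germ A z) xs ys - J z (a, b))"
      by (simp add: ab)
    then have "norm (J (y n) t - J z t) \<le> norm (dsum (young_germ A (y n)) xs ys - dsum (young_germ A z) xs ys)
      + norm (dsum (young_germ A (y n)) xs ys - J (y n) (a, b)) + norm (dsum (young_germ A z) xs ys - J z (a, b))"
      using norm_triangle_ineq norm_triangle_ineq4 order_trans add_mono by (smt (verit))
    also have "\<dots> < \<epsilon>" using N[OF \<open>n \<ge> N\<close>] bound[OF y(1)[of n]] bound[OF y(2)] by linarith
    finally show "norm (J (y n) t - J z t) < \<epsilon>" .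
  qed
qed

end

section \<open>Delayed equations\<close>

text \<open>Backward steps of length h, the last one cut off at a, reach a from b; at most
  \<open>T / h + 1\<close> of them are needed.\<close>

lemma norm_increment_le_by_short_steps:
  fixes \<phi> :: "real \<Rightarrow> 'b::real_normed_vector"
  assumes h: "0 < h" and "0 \<le> B" and ab: "a \<le> b" "b - a \<le> T"
    and step: "\<And>x x'. a \<le> x \<Longrightarrow> x \<le> x' \<Longrightarrow> x' \<le> b \<Longrightarrow> x' - x \<le> h \<Longrightarrow> norm (\<phi> x' - \<phi> x) \<le> B"
  shows "norm (\<phi> b - \<phi> a) \<le> (T / h + 1) * B"
proof -
  have *: "norm (\<phi> x - \<phi> a) \<le> real n * B" if "a \<le> x" "x \<le> b" "x - a \<le> real n * h" for n x
    using that
  proof (induction n arbitrary: x)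
    case (Suc n)
    define x' where "x' = max a (x - h)"
    have "norm (\<phi> x' - \<phi> a) \<le> real n * B"
      using Suc.prems h by (intro Suc.IH) (auto simp: x'_def max_def algebra_simps)
    moreover have "norm (\<phi> x - \<phi> x') \<le> B"
      using Suc.prems h by (intro step) (auto simp: x'_def)
    ultimately have "norm (\<phi> x - \<phi> a) \<le> B + real n * B" by (rule norm_diff_triangle_le[rotated])
    then show ?case by (simp add: algebra_simps)
  qed simp
  define n where "n = nat \<lceil>T / h\<rceil>"
  have T0: "0 \<le> T / h" using h ab by simp
  have n: "T / h \<le> real n" "real n \<le> T / h + 1"
    using T0 unfolding n_def by linarith+
  have "T \<le> real n * h" using n(1) h by (simp add: field_simps)
  then have "norm (\<phi> b - \<phi> a) \<le> real n * B" using ab by (intro *) auto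
  also have "\<dots> \<le> (T / h + 1) * B" using n(2) \<open>0 \<le> B\<close> by (rule mult_right_mono)
  finally show ?thesis .
qed

lemma holder_rect_mono:
  assumes "holder_rect g1 g2 a b c d X1 X2 X12 y" "X1 \<le> X1'" "X2 \<le> X2'" "X12 \<le> X12'"
  shows "holder_rect g1 g2 a b c d X1' X2' X12' y"
proof (rule holder_rectI)
  fix u v r assume "a \<le> u" "u \<le> v" "v \<le> b" "c \<le> r" "r \<le> d"
  then show "norm (y (v, r) - y (u, r)) \<le> X1' * (v - u) powr g1"
    using holder_rectD(1)[OF assms(1), of u v r r] mult_right_mono[OF assms(2), of "(v - u) powr g1"] by simp
next
  fix u r s assume "a \<le> u" "u \<le> b" "c \<le> r" "r \<le> s" "s \<le> d"
  then show "norm (y (u, s) - y (u, r)) \<le> X2' * (s - r) powr g2"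
    using holder_rectD(3)[OF assms(1), of u u r s] mult_right_mono[OF assms(3), of "(s - r) powr g2"] by simp
next
  fix u v r s assume "a \<le> u" "u \<le> v" "v \<le> b" "c \<le> r" "r \<le> s" "s \<le> d"
  then show "norm (rect_incr (u, r) (v, s) y) \<le> X12' * ((v - u) powr g1 * (s - r) powr g2)"
    using holder_rectD(5)[OF assms(1), of u v r s] mult_right_mono[OF assms(4), of "(v - u) powr g1 * (s - r) powr g2"] by simp
qed

lemma rect_incr_degenerate:
  "u = v \<or> r = s \<Longrightarrow> rect_incr (u, r) (v, s) f = 0"
  by (auto simp: rect_incr_def)

locale young_equation = young_driver T \<eta> C g1 g2 A
  for T \<eta> C g1 g2 :: real and A :: "real \<times> real \<Rightarrow> 'a::euclidean_space \<Rightarrow> 'a" +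
  fixes \<xi> :: "real \<times> real \<Rightarrow> 'a" and K0 :: real
  assumes K0: "0 \<le> K0" and \<xi>: "holder_rect g1 g2 0 T 0 T K0 K0 K0 \<xi>"
    and rect_\<xi>: "\<And>u v r s. 0 \<le> u \<Longrightarrow> u < v \<Longrightarrow> v \<le> T \<Longrightarrow> 0 \<le> r \<Longrightarrow> r < s \<Longrightarrow> s \<le> T \<Longrightarrow>
      rect_incr (u, r) (v, s) \<xi> = 0"
begin

lemma rect_\<xi>_0:
  assumes "0 \<le> u" "u \<le> v" "v \<le> T" "0 \<le> r" "r \<le> s" "s \<le> T"
  shows "rect_incr (u, r) (v, s) \<xi> = 0"
  using assms rect_\<xi>[of u v r s] by (cases "u = v \<or> r = s") (auto simp: rect_incr_degenerate)

text \<open>The constant of \<open>J_rect_bound\<close>. It depends on A and the exponents, not on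
  \<open>\<xi>\<close>, \<open>K0\<close> or h, so h can be chosen after it.\<close>

definition cell_const where
  "cell_const = C * (1 + sew_const (2 * g1) + sew_const (2 * g2) + 2 * sew_const (2 * g1) * sew_const (2 * g2))"

lemma cell_const_nonneg: "0 \<le> cell_const"
  using C sew_const(1)[of "2 * g1"] sew_const(1)[of "2 * g2"] g1 g2 by (auto simp: cell_const_def)

text \<open>On the axes the bounds are those of \<open>\<xi>\<close>, with which every
  \<open>\<Gamma> y\<close> agrees there. The rectangular bound is asked only at scale h, where it
  reproduces itself under \<open>\<Gamma>\<close>; a bound for large rectangles would not do so with
  the same constant.\<close>

definition cells :: "real \<Rightarrow> (real \<times> real \<Rightarrow> 'a) set" where
  "cells h = {y. (\<forall>u v. 0 \<le> u \<longrightarrow> u \<le> v \<longrightarrow> v \<le> T \<longrightarrow> norm (y (v, 0) - y (u, 0)) \<le> K0 * (v - u) powr g1)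
    \<and> (\<forall>r s. 0 \<le> r \<longrightarrow> r \<le> s \<longrightarrow> s \<le> T \<longrightarrow> norm (y (0, s) - y (0, r)) \<le> K0 * (s - r) powr g2)
    \<and> (\<forall>u v r s. 0 \<le> u \<longrightarrow> u \<le> v \<longrightarrow> v \<le> T \<longrightarrow> 0 \<le> r \<longrightarrow> r \<le> s \<longrightarrow> s \<le> T \<longrightarrow> v - u \<le> h \<longrightarrow> s - r \<le> h \<longrightarrow>
        norm (rect_incr (u, r) (v, s) y) \<le> cell_const * ((v - u) powr g1 * (s - r) powr g2))}"

lemma cells_D:
  assumes "y \<in> cells h"
  shows "0 \<le> u \<Longrightarrow> u \<le> v \<Longrightarrow> v \<le> T \<Longrightarrow> norm (y (v, 0) - y (u, 0)) \<le> K0 * (v - u) powr g1"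
    and "0 \<le> r \<Longrightarrow> r \<le> s \<Longrightarrow> s \<le> T \<Longrightarrow> norm (y (0, s) - y (0, r)) \<le> K0 * (s - r) powr g2"
    and "0 \<le> u \<Longrightarrow> u \<le> v \<Longrightarrow> v \<le> T \<Longrightarrow> 0 \<le> r \<Longrightarrow> r \<le> s \<Longrightarrow> s \<le> T \<Longrightarrow> v - u \<le> h \<Longrightarrow> s - r \<le> h \<Longrightarrow>
        norm (rect_incr (u, r) (v, s) y) \<le> cell_const * ((v - u) powr g1 * (s - r) powr g2)"
  using assms by (auto simp: cells_def)

text \<open>An increment off the axis is the one on the axis plus a stack of at most
  \<open>T / h + 1\<close> rectangular increments of height at most h.\<close>

definition incr_const1 where "incr_const1 h = K0 + (T / h + 1) * (cell_const * h powr g2)"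
definition incr_const2 where "incr_const2 h = K0 + (T / h + 1) * (cell_const * h powr g1)"

lemma incr_const_nonneg: "0 < h \<Longrightarrow> 0 \<le> incr_const1 h" "0 < h \<Longrightarrow> 0 \<le> incr_const2 h"
  using K0 cell_const_nonneg T by (auto simp: incr_const1_def incr_const2_def)

lemma cells_increments:
  assumes y: "y \<in> cells h" and h: "0 < h"
  shows "0 \<le> u \<Longrightarrow> u \<le> v \<Longrightarrow> v \<le> T \<Longrightarrow> 0 \<le> r \<Longrightarrow> r \<le> T \<Longrightarrow> v - u \<le> h \<Longrightarrow>
      norm (y (v, r) - y (u, r)) \<le> incr_const1 h * (v - u) powr g1"
    and "0 \<le> r \<Longrightarrow> r \<le> s \<Longrightarrow> s \<le> T \<Longrightarrow> 0 \<le> u \<Longrightarrow> u \<le> T \<Longrightarrow> s - r \<le> h \<Longrightarrow>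
      norm (y (u, s) - y (u, r)) \<le> incr_const2 h * (s - r) powr g2"
proof -
  assume a: "0 \<le> u" "u \<le> v" "v \<le> T" "0 \<le> r" "r \<le> T" "v - u \<le> h"
  let ?\<phi> = "\<lambda>x. y (v, x) - y (u, x)"
  have "norm (?\<phi> r - ?\<phi> 0) \<le> (T / h + 1) * (cell_const * ((v - u) powr g1 * h powr g2))"
  proof (rule norm_increment_le_by_short_steps[OF h])
    fix x x' assume x: "0 \<le> x" "x \<le> x'" "x' \<le> r" "x' - x \<le> h"
    have "norm (?\<phi> x' - ?\<phi> x) \<le> cell_const * ((v - u) powr g1 * (x' - x) powr g2)"
      using cells_D(3)[OF y, of u v x x'] a x by (simp add: rect_incr_def algebra_simps)
    also have "\<dots> \<le> cell_const * ((v - u) powr g1 * h powr g2)"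
      using x cell_const_nonneg g2 by (intro mult_left_mono powr_mono2) auto
    finally show "norm (?\<phi> x' - ?\<phi> x) \<le> cell_const * ((v - u) powr g1 * h powr g2)" .
  qed (use a cell_const_nonneg in auto)
  moreover have "norm (?\<phi> 0) \<le> K0 * (v - u) powr g1" using a by (intro cells_D(1)[OF y])
  ultimately have "norm (?\<phi> r - 0) \<le> (T / h + 1) * (cell_const * ((v - u) powr g1 * h powr g2)) + K0 * (v - u) powr g1"
    by (intro norm_diff_triangle_le) auto
  then show "norm (y (v, r) - y (u, r)) \<le> incr_const1 h * (v - u) powr g1"
    by (simp add: incr_const1_def algebra_simps)
next
  assume a: "0 \<le> r" "r \<le> s" "s \<le> T" "0 \<le> u" "u \<le> T" "s - r \<le> h"
  let ?\<phi> = "\<lambda>x. y (x, s) - y (x, r)"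
  have "norm (?\<phi> u - ?\<phi> 0) \<le> (T / h + 1) * (cell_const * (h powr g1 * (s - r) powr g2))"
  proof (rule norm_increment_le_by_short_steps[OF h])
    fix x x' assume x: "0 \<le> x" "x \<le> x'" "x' \<le> u" "x' - x \<le> h"
    have "norm (?\<phi> x' - ?\<phi> x) \<le> cell_const * ((x' - x) powr g1 * (s - r) powr g2)"
      using cells_D(3)[OF y, of x x' r s] a x by (simp add: rect_incr_def algebra_simps)
    also have "\<dots> \<le> cell_const * (h powr g1 * (s - r) powr g2)"
      using x cell_const_nonneg g1 by (intro mult_left_mono mult_right_mono powr_mono2) auto
    finally show "norm (?\<phi> x' - ?\<phi> x) \<le> cell_const * (h powr g1 * (s - r) powr g2)" .
  qed (use a cell_const_nonneg in auto)
  moreover have "norm (?\<phi> 0) \<le> K0 * (s - r) powr g2" using a by (intro cells_D(2)[OF y])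
  ultimately have "norm (?\<phi> u - 0) \<le> (T / h + 1) * (cell_const * (h powr g1 * (s - r) powr g2)) + K0 * (s - r) powr g2"
    by (intro norm_diff_triangle_le) auto
  then show "norm (y (u, s) - y (u, r)) \<le> incr_const2 h * (s - r) powr g2"
    by (simp add: incr_const2_def algebra_simps)
qed

lemma cells_local:
  assumes "y \<in> cells h" "0 < h" "0 \<le> u" "v \<le> T" "0 \<le> r" "s \<le> T" "v - u \<le> h" "s - r \<le> h"
  shows "holder_rect g1 g2 u v r s (incr_const1 h) (incr_const2 h) cell_const y"
  using assms by (intro holder_rectI cells_increments cells_D(3)) auto

text \<open>May blow up as h tends to 0; it is used with h fixed, for existence of the integrals and
  for compactness. The three terms are summed to have one constant for all kinds of
  increments.\<close>

definition holder_const where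
  "holder_const h = (T / h + 1) * incr_const1 h + (T / h + 1) * incr_const2 h + (T / h + 1) * ((T / h + 1) * cell_const)"

lemma holder_const_nonneg: "0 < h \<Longrightarrow> 0 \<le> holder_const h"
  using incr_const_nonneg[of h] cell_const_nonneg T by (auto simp: holder_const_def)

lemma cells_global:
  assumes y: "y \<in> cells h" and h: "0 < h"
  shows "holder_rect g1 g2 0 T 0 T (holder_const h) (holder_const h) (holder_const h) y"
proof (rule holder_rect_mono)
  show "holder_rect g1 g2 0 T 0 T ((T / h + 1) * incr_const1 h) ((T / h + 1) * incr_const2 h) ((T / h + 1) * ((T / h + 1) * cell_const)) y"
  proof (rule holder_rectI)
    fix u v r assume a: "0 \<le> u" "u \<le> v" "v \<le> T" "0 \<le> r" "r \<le> T"
    have "norm (y (v, r) - y (u, r)) \<le> (T / h + 1) * (incr_const1 h * (v - u) powr g1)"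
    proof (rule norm_increment_le_by_short_steps[OF h])
      fix x x' assume x: "u \<le> x" "x \<le> x'" "x' \<le> v" "x' - x \<le> h"
      have "norm (y (x', r) - y (x, r)) \<le> incr_const1 h * (x' - x) powr g1"
        using x a by (intro cells_increments[OF y h]) auto
      also have "\<dots> \<le> incr_const1 h * (v - u) powr g1"
        using x g1 incr_const_nonneg h by (intro mult_left_mono powr_mono2) auto
      finally show "norm (y (x', r) - y (x, r)) \<le> incr_const1 h * (v - u) powr g1" .
    qed (use a incr_const_nonneg h in auto)
    then show "norm (y (v, r) - y (u, r)) \<le> (T / h + 1) * incr_const1 h * (v - u) powr g1" by (simp add: mult_ac)
  next
    fix u r s assume a: "0 \<le> u" "u \<le> T" "0 \<le> r" "r \<le> s" "s \<le> T"
    have "norm (y (u, s) - y (u, r)) \<le> (T / h + 1) * (incr_const2 h * (s - r) powr g2)"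
    proof (rule norm_increment_le_by_short_steps[OF h])
      fix x x' assume x: "r \<le> x" "x \<le> x'" "x' \<le> s" "x' - x \<le> h"
      have "norm (y (u, x') - y (u, x)) \<le> incr_const2 h * (x' - x) powr g2"
        using x a by (intro cells_increments[OF y h]) auto
      also have "\<dots> \<le> incr_const2 h * (s - r) powr g2"
        using x g2 incr_const_nonneg h by (intro mult_left_mono powr_mono2) auto
      finally show "norm (y (u, x') - y (u, x)) \<le> incr_const2 h * (s - r) powr g2" .
    qed (use a incr_const_nonneg h in auto)
    then show "norm (y (u, s) - y (u, r)) \<le> (T / h + 1) * incr_const2 h * (s - r) powr g2" by (simp add: mult_ac)
  next
    fix u v r s assume a: "0 \<le> u" "u \<le> v" "v \<le> T" "0 \<le> r" "r \<le> s" "s \<le> T"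
    let ?\<phi> = "\<lambda>x. y (x, s) - y (x, r)" and ?B = "cell_const * ((v - u) powr g1 * (s - r) powr g2)"
    have B: "0 \<le> ?B" using cell_const_nonneg by simp
    have "norm (?\<phi> v - ?\<phi> u) \<le> (T / h + 1) * ((T / h + 1) * ?B)"
    proof (rule norm_increment_le_by_short_steps[OF h])
      fix x x' assume x: "u \<le> x" "x \<le> x'" "x' \<le> v" "x' - x \<le> h"
      let ?\<psi> = "\<lambda>z. y (x', z) - y (x, z)"
      have "norm (?\<psi> s - ?\<psi> r) \<le> (T / h + 1) * ?B"
      proof (rule norm_increment_le_by_short_steps[OF h B])
        fix z z' assume z: "r \<le> z" "z \<le> z'" "z' \<le> s" "z' - z \<le> h"
        have "norm (?\<psi> z' - ?\<psi> z) \<le> cell_const * ((x' - x) powr g1 * (z' - z) powr g2)"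
          using cells_D(3)[OF y, of x x' z z'] a x z by (simp add: rect_incr_def algebra_simps)
        also have "\<dots> \<le> ?B"
          using x z cell_const_nonneg g1 g2 by (intro mult_left_mono mult_mono powr_mono2) auto
        finally show "norm (?\<psi> z' - ?\<psi> z) \<le> ?B" .
      qed (use a in auto)
      then show "norm (?\<phi> x' - ?\<phi> x) \<le> (T / h + 1) * ?B" by (simp add: algebra_simps)
    qed (use a B T h in auto)
    then show "norm (rect_incr (u, r) (v, s) y) \<le> (T / h + 1) * ((T / h + 1) * cell_const) * ((v - u) powr g1 * (s - r) powr g2)"
      by (simp add: rect_incr_def algebra_simps)
  qed
qed (use incr_const_nonneg[OF h] cell_const_nonneg T h in \<open>auto simp: holder_const_def\<close>)

text \<open>Expanding the first two products leaves a multiple of a positive power of h, one of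
  h^(g1+g2-1) and one of h^(g1+g2). The middle one carries the factor T/h from the number of
  cells.\<close>

lemma ex_small_scale:
  "\<exists>h>0. incr_const1 h * h powr g1 \<le> 1 \<and> incr_const2 h * h powr g2 \<le> 1 \<and> cell_const * (h powr g1 * h powr g2) \<le> 1"
proof -
  have p: "((\<lambda>h. h powr w) \<longlongrightarrow> 0) (at_right 0)" if "0 < w" for w :: real
  proof -
    have "((\<lambda>h. h powr w) \<longlongrightarrow> 0 powr w) (at_right 0)"
      by (rule tendsto_powr') (use that in \<open>auto simp: eventually_at_filter\<close>)
    then show ?thesis by simp
  qed
  have lim: "((\<lambda>h. K0 * h powr g + T * cell_const * h powr (g1 + g2 - 1) + cell_const * h powr (g1 + g2)) \<longlongrightarrow>
      K0 * 0 + T * cell_const * 0 + cell_const * 0) (at_right 0)" if "0 < g" for g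
    using that g1 g2 by (intro tendsto_intros p) auto
  have ev: "\<forall>\<^sub>F h in at_right 0. K0 * h powr g + T * cell_const * h powr (g1 + g2 - 1) + cell_const * h powr (g1 + g2) < 1" if "0 < g" for g
    using order_tendstoD(2)[OF lim[OF that], of 1] by simp
  have "\<forall>\<^sub>F h in at_right 0. K0 * h powr g1 + T * cell_const * h powr (g1 + g2 - 1) + cell_const * h powr (g1 + g2) < 1 \<and>
     K0 * h powr g2 + T * cell_const * h powr (g1 + g2 - 1) + cell_const * h powr (g1 + g2) < 1 \<and> 0 < h"
    using ev[of g1] ev[of g2] g1 g2 eventually_at_right_less[of "0::real"] by (intro eventually_conj) auto
  then obtain h where h: "K0 * h powr g1 + T * cell_const * h powr (g1 + g2 - 1) + cell_const * h powr (g1 + g2) < 1"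
     "K0 * h powr g2 + T * cell_const * h powr (g1 + g2 - 1) + cell_const * h powr (g1 + g2) < 1" "0 < h"
    using eventually_happens'[OF trivial_limit_at_right_real] by blast
  have e: "h powr (g1 + g2 - 1) = h powr g1 * h powr g2 / h" "h powr (g1 + g2) = h powr g1 * h powr g2"
    using h(3) by (auto simp: powr_diff powr_add)
  have "incr_const1 h * h powr g1 \<le> 1" "incr_const2 h * h powr g2 \<le> 1"
    using h(1,2) unfolding e by (simp_all add: incr_const1_def incr_const2_def algebra_simps)
  moreover have "cell_const * (h powr g1 * h powr g2) \<le> 1"
  proof -
    have "0 \<le> K0 * h powr g1" "0 \<le> T * cell_const * h powr (g1 + g2 - 1)" using K0 T cell_const_nonneg by auto
    then show ?thesis using h(1) e(2) by simp
  qed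
  ultimately show ?thesis using h(3) by blast
qed

definition \<Gamma> where "\<Gamma> y t = \<xi> t + J y t"

lemma \<Gamma>_axes: "0 \<le> a \<Longrightarrow> \<Gamma> y (a, 0) = \<xi> (a, 0)" "0 \<le> b \<Longrightarrow> \<Gamma> y (0, b) = \<xi> (0, b)"
  by (simp_all add: \<Gamma>_def J_axes)

text \<open>The vanishing rectangular increments of \<open>\<xi>\<close> enter here: they keep
  \<open>\<xi>\<close> out of the bound that has to reproduce itself.\<close>

lemma rect_\<Gamma>:
  assumes "0 \<le> u" "u \<le> v" "v \<le> T" "0 \<le> r" "r \<le> s" "s \<le> T"
  shows "rect_incr (u, r) (v, s) (\<Gamma> y) = rect_incr (u, r) (v, s) (J y)"
proof -
  have "rect_incr (u, r) (v, s) (\<Gamma> y) = rect_incr (u, r) (v, s) \<xi> + rect_incr (u, r) (v, s) (J y)"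
    by (simp add: rect_incr_def \<Gamma>_def)
  then show ?thesis using rect_\<xi>_0[OF assms] by simp
qed

lemma \<Gamma>_cells:
  assumes h: "0 < h" "incr_const1 h * h powr g1 \<le> 1" "incr_const2 h * h powr g2 \<le> 1" "cell_const * (h powr g1 * h powr g2) \<le> 1"
    and y: "y \<in> cells h"
  shows "\<Gamma> y \<in> cells h"
proof -
  have "norm (rect_incr (u, r) (v, s) (\<Gamma> y)) \<le> cell_const * ((v - u) powr g1 * (s - r) powr g2)"
    if a: "0 \<le> u" "u \<le> v" "v \<le> T" "0 \<le> r" "r \<le> s" "s \<le> T" "v - u \<le> h" "s - r \<le> h" for u v r s
    unfolding rect_\<Gamma>[OF a(1-6)] cell_const_def
  proof (rule J_rect_bound[OF cells_global[OF y h(1)] holder_const_nonneg[OF h(1)] a(1-6) cells_local[OF y h(1) a(1,3,4,6-8)]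
        incr_const_nonneg[OF h(1)] cell_const_nonneg])
    have le: "(v - u) powr g1 \<le> h powr g1" "(s - r) powr g2 \<le> h powr g2"
      using a g1 g2 by (auto intro!: powr_mono2)
    then show "incr_const1 h * (v - u) powr g1 \<le> 1" "incr_const2 h * (s - r) powr g2 \<le> 1"
      using incr_const_nonneg[OF h(1)] h by (meson mult_left_mono order_trans)+
    have "cell_const * ((v - u) powr g1 * (s - r) powr g2) \<le> cell_const * (h powr g1 * h powr g2)"
      using le cell_const_nonneg by (intro mult_left_mono mult_mono) auto
    then show "cell_const * ((v - u) powr g1 * (s - r) powr g2) \<le> 1" using h(4) by linarith
  qed
  then show ?thesis
    using holder_rectD(1)[OF \<xi>, of _ _ 0 0] holder_rectD(3)[OF \<xi>, of 0 0] T by (auto simp: cells_def \<Gamma>_axes)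
qed

text \<open>The delay acts on the first variable only, which already makes the equation explicit.
  Clamping at 0 continues y constantly to the left of the edge.\<close>

definition delay :: "real \<Rightarrow> (real \<times> real \<Rightarrow> 'a) \<Rightarrow> real \<times> real \<Rightarrow> 'a" where
  "delay e y t = y (max 0 (fst t - e), snd t)"

text \<open>The map u to max 0 (u - e) is monotone and 1-Lipschitz and fixes 0, so axes go to axes
  and rectangles to rectangles that are no wider.\<close>

lemma delay_cells:
  assumes y: "y \<in> cells h" and e: "0 \<le> e" shows "delay e y \<in> cells h"
proof -
  let ?m = "\<lambda>u. max 0 (u - e)"
  have m: "0 \<le> ?m u" "?m u \<le> ?m v" "?m v \<le> T" "?m v - ?m u \<le> v - u" if "0 \<le> u" "u \<le> v" "v \<le> T" for u v
    using that e T by auto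
  have "norm (delay e y (v, 0) - delay e y (u, 0)) \<le> K0 * (v - u) powr g1" if "0 \<le> u" "u \<le> v" "v \<le> T" for u v
  proof -
    have "norm (y (?m v, 0) - y (?m u, 0)) \<le> K0 * (?m v - ?m u) powr g1" using m[OF that] by (intro cells_D[OF y])
    also have "\<dots> \<le> K0 * (v - u) powr g1" using m[OF that] g1 K0 by (intro mult_left_mono powr_mono2) auto
    finally show ?thesis by (simp add: delay_def)
  qed
  moreover have "norm (delay e y (0, s) - delay e y (0, r)) \<le> K0 * (s - r) powr g2" if "0 \<le> r" "r \<le> s" "s \<le> T" for r s
    using cells_D(2)[OF y that] e by (simp add: delay_def max_def)
  moreover have "norm (rect_incr (u, r) (v, s) (delay e y)) \<le> cell_const * ((v - u) powr g1 * (s - r) powr g2)"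
    if "0 \<le> u" "u \<le> v" "v \<le> T" "0 \<le> r" "r \<le> s" "s \<le> T" "v - u \<le> h" "s - r \<le> h" for u v r s
  proof -
    have "rect_incr (u, r) (v, s) (delay e y) = rect_incr (?m u, r) (?m v, s) y"
      by (simp add: rect_incr_def delay_def)
    also have "norm \<dots> \<le> cell_const * ((?m v - ?m u) powr g1 * (s - r) powr g2)"
      using m[OF that(1-3)] that by (intro cells_D[OF y]) auto
    also have "\<dots> \<le> cell_const * ((v - u) powr g1 * (s - r) powr g2)"
      using m[OF that(1-3)] g1 cell_const_nonneg by (intro mult_left_mono mult_right_mono powr_mono2) auto
    finally show ?thesis .
  qed
  ultimately show ?thesis by (simp add: cells_def)
qed

lemma \<xi>_cells: "\<xi> \<in> cells h"
  using holder_rectD(1)[OF \<xi>, of _ _ 0 0] holder_rectD(3)[OF \<xi>, of 0 0] T cell_const_nonneg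
  by (auto simp: cells_def rect_\<xi>_0)

text \<open>The right-hand side at first coordinate x uses the unknown only up to x - e, so each
  iteration settles a further strip of width e.\<close>

lemma ex_delayed_solution:
  assumes h: "0 < h" "incr_const1 h * h powr g1 \<le> 1" "incr_const2 h * h powr g2 \<le> 1" "cell_const * (h powr g1 * h powr g2) \<le> 1"
    and e: "0 < e"
  shows "\<exists>y\<in>cells h. \<forall>t\<in>square T. y t = \<Gamma> (delay e y) t"
proof -
  define Y where "Y k = ((\<lambda>y. \<Gamma> (delay e y)) ^^ k) \<xi>" for k
  have Y_Suc: "Y (Suc k) = \<Gamma> (delay e (Y k))" for k by (simp add: Y_def)
  have S: "Y k \<in> cells h" for k
    by (induction k) (use \<xi>_cells \<Gamma>_cells[OF h] delay_cells e in \<open>auto simp: Y_Suc Y_def[of 0]\<close>)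
  \<comment> \<open>On the left edge every iterate equals \<open>\<xi>\<close>, which starts the
    induction at k = 0; the delay moves (k + 1) e back to k e.\<close>
  have stable: "\<forall>t\<in>square T. fst t \<le> real k * e \<longrightarrow> Y (Suc k) t = Y k t" for k
  proof (induction k)
    case 0
    then show ?case by (auto simp: Y_Suc Y_def[of 0] square_def \<Gamma>_axes)
  next
    case (Suc k)
    show ?case
    proof (intro ballI impI)
      fix t assume t: "t \<in> square T" "fst t \<le> real (Suc k) * e"
      have "J (delay e (Y (Suc k))) t = J (delay e (Y k)) t"
      proof (rule J_cong[OF t(1)])
        fix s assume s: "s \<in> square T" "fst s \<le> fst t"
        then have "(max 0 (fst s - e), snd s) \<in> square T" "max 0 (fst s - e) \<le> real k * e"
          using e t T by (auto simp: square_def algebra_simps)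
        then show "delay e (Y (Suc k)) s = delay e (Y k) s" using Suc.IH unfolding delay_def by simp
      qed
      then show "Y (Suc (Suc k)) t = Y (Suc k) t" unfolding Y_Suc[of "Suc k"] Y_Suc[of k] by (simp add: \<Gamma>_def)
    qed
  qed
  obtain k :: nat where k: "T / e < real k" using reals_Archimedean2 by blast
  then have "T \<le> real k * e" using e by (simp add: field_simps)
  then have "\<forall>t\<in>square T. Y k t = \<Gamma> (delay e (Y k)) t"
    using stable[of k] by (auto simp: square_def Y_Suc)
  then show ?thesis using S by blast
qed

end

section \<open>Passing between ordered and unordered Hoelder bounds\<close>

lemma holder_rect_norm_diff_le:
  assumes y: "holder_rect g1 g2 a b c d X1 X2 X12 y"
    and "u \<in> {a..b}" "v \<in> {a..b}" "r \<in> {c..d}" "s \<in> {c..d}"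
  shows "norm (y (v, r) - y (u, r)) \<le> X1 * \<bar>v - u\<bar> powr g1"
    and "norm (y (u, s) - y (u, r)) \<le> X2 * \<bar>s - r\<bar> powr g2"
    and "norm (rect_incr (u, r) (v, s) y) \<le> X12 * (\<bar>v - u\<bar> powr g1 * \<bar>s - r\<bar> powr g2)"
proof -
  show "norm (y (v, r) - y (u, r)) \<le> X1 * \<bar>v - u\<bar> powr g1"
    using holder_rectD(1)[OF y, of u v r r] holder_rectD(1)[OF y, of v u r r] assms
    by (cases "u \<le> v") (auto simp: norm_minus_commute)
  show "norm (y (u, s) - y (u, r)) \<le> X2 * \<bar>s - r\<bar> powr g2"
    using holder_rectD(3)[OF y, of u u r s] holder_rectD(3)[OF y, of u u s r] assms
    by (cases "r \<le> s") (auto simp: norm_minus_commute)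
  have *: "norm (rect_incr (u, r) (v, s) y) = norm (rect_incr (min u v, min r s) (max u v, max r s) y)"
  proof -
    have "rect_incr (u, r) (v, s) y = - rect_incr (v, r) (u, s) y"
      "rect_incr (u, r) (v, s) y = - rect_incr (u, s) (v, r) y" for u v r s
      by (simp_all add: rect_incr_def)
    then have 1: "norm (rect_incr (u, r) (v, s) y) = norm (rect_incr (v, r) (u, s) y)"
      and 2: "norm (rect_incr (u, r) (v, s) y) = norm (rect_incr (u, s) (v, r) y)" for u v r s
      by (metis norm_minus_cancel)+
    show ?thesis
      using 1[of u r v s] 2[of u r v s] 2[of v r u s] by (auto simp: min_def max_def)
  qed
  have "norm (rect_incr (min u v, min r s) (max u v, max r s) y)
      \<le> X12 * ((max u v - min u v) powr g1 * (max r s - min r s) powr g2)"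
    using assms by (intro holder_rectD(5)[OF y]) auto
  moreover have "max u v - min u v = \<bar>v - u\<bar>" "max r s - min r s = \<bar>s - r\<bar>" by auto
  ultimately show "norm (rect_incr (u, r) (v, s) y) \<le> X12 * (\<bar>v - u\<bar> powr g1 * \<bar>s - r\<bar> powr g2)"
    unfolding * by simp
qed

lemma holder_plane_of_holder_rect:
  assumes "holder_rect g1 g2 0 T 0 T X X X y"
  shows "holder_plane UNIV norm T (g1, g2) y"
  unfolding holder_plane_def
proof (intro conjI exI[of _ X] ballI)
  fix s t assume st: "s \<in> square T" "t \<in> square T"
  obtain u r v q where e: "s = (u, r)" "t = (v, q)" by (cases s, cases t)
  note B = holder_rect_norm_diff_le[OF assms, of u v r q]
  show "norm (y (fst t, snd s) - y (fst s, snd s)) \<le> X * \<bar>fst t - fst s\<bar> powr fst (g1, g2)"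
    "norm (y (fst s, snd t) - y (fst s, snd s)) \<le> X * \<bar>snd t - snd s\<bar> powr snd (g1, g2)"
    "norm (rect_incr s t y) \<le> X * (\<bar>fst t - fst s\<bar> powr fst (g1, g2) * \<bar>snd t - snd s\<bar> powr snd (g1, g2))"
    using B st unfolding e by (auto simp: square_def)
qed simp

text \<open>The normalisation 1 \<le> X makes X^eta at most X in
  \<open>strip_contraction\<close>.\<close>

lemma holder_rect_of_holder_plane:
  assumes "holder_plane V norm T \<gamma> y"
  shows "\<exists>X\<ge>1. holder_rect (fst \<gamma>) (snd \<gamma>) 0 T 0 T X X X y"
proof -
  obtain C where C: "\<And>s t. s \<in> square T \<Longrightarrow> t \<in> square T \<Longrightarrow>
        norm (y (fst t, snd s) - y (fst s, snd s)) \<le> C * \<bar>fst t - fst s\<bar> powr fst \<gamma> \<and>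
        norm (y (fst s, snd t) - y (fst s, snd s)) \<le> C * \<bar>snd t - snd s\<bar> powr snd \<gamma> \<and>
        norm (rect_incr s t y) \<le> C * (\<bar>fst t - fst s\<bar> powr fst \<gamma> * \<bar>snd t - snd s\<bar> powr snd \<gamma>)"
    using assms unfolding holder_plane_def by blast
  have "holder_rect (fst \<gamma>) (snd \<gamma>) 0 T 0 T C C C y"
  proof (rule holder_rectI)
    fix u v r assume "0 \<le> u" "u \<le> v" "v \<le> T" "0 \<le> r" "r \<le> T"
    then show "norm (y (v, r) - y (u, r)) \<le> C * (v - u) powr fst \<gamma>"
      using C[of "(u, r)" "(v, r)"] by (auto simp: square_def)
  next
    fix u r s assume "0 \<le> u" "u \<le> T" "0 \<le> r" "r \<le> s" "s \<le> T"
    then show "norm (y (u, s) - y (u, r)) \<le> C * (s - r) powr snd \<gamma>"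
      using C[of "(u, r)" "(u, s)"] by (auto simp: square_def)
  next
    fix u v r s assume "0 \<le> u" "u \<le> v" "v \<le> T" "0 \<le> r" "r \<le> s" "s \<le> T"
    then show "norm (rect_incr (u, r) (v, s) y) \<le> C * ((v - u) powr fst \<gamma> * (s - r) powr snd \<gamma>)"
      using C[of "(u, r)" "(v, s)"] by (auto simp: square_def)
  qed
  then have "holder_rect (fst \<gamma>) (snd \<gamma>) 0 T 0 T (max 1 C) (max 1 C) (max 1 C) y"
    by (rule holder_rect_mono) auto
  then show ?thesis by (intro exI[of _ "max 1 C"]) simp
qed

context young_equation
begin

text \<open>Each condition is a non-strict inequality between finitely many values, hence stable
  under pointwise limits without loss of exponent.\<close>

lemma cells_closed:
  assumes y: "\<And>n. y n \<in> cells h" and lim: "\<And>t. t \<in> square T \<Longrightarrow> (\<lambda>n. y n t) \<longlonglongrightarrow> z t"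
  shows "z \<in> cells h"
proof -
  have c: "norm l \<le> B" if "f \<longlonglongrightarrow> l" "\<And>n. norm (f n) \<le> B" for f :: "nat \<Rightarrow> 'a" and l B
    using Lim_bounded[OF tendsto_norm[OF that(1)]] that(2) by blast
  have sq: "0 \<le> u \<Longrightarrow> u \<le> T \<Longrightarrow> 0 \<le> r \<Longrightarrow> r \<le> T \<Longrightarrow> (\<lambda>n. y n (u, r)) \<longlonglongrightarrow> z (u, r)" for u r
    by (rule lim) (simp add: square_def)
  show ?thesis unfolding cells_def mem_Collect_eq
  proof (intro conjI allI impI)
    fix u v assume a: "0 \<le> u" "u \<le> v" "v \<le> T"
    show "norm (z (v, 0) - z (u, 0)) \<le> K0 * (v - u) powr g1"
      by (rule c[of "\<lambda>n. y n (v, 0) - y n (u, 0)"], intro tendsto_intros sq) (use a T cells_D(1)[OF y] in auto)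
  next
    fix r s assume a: "0 \<le> r" "r \<le> s" "s \<le> T"
    show "norm (z (0, s) - z (0, r)) \<le> K0 * (s - r) powr g2"
      by (rule c[of "\<lambda>n. y n (0, s) - y n (0, r)"], intro tendsto_intros sq) (use a T cells_D(2)[OF y] in auto)
  next
    fix u v r s assume a: "0 \<le> u" "u \<le> v" "v \<le> T" "0 \<le> r" "r \<le> s" "s \<le> T" "v - u \<le> h" "s - r \<le> h"
    show "norm (rect_incr (u, r) (v, s) z) \<le> cell_const * ((v - u) powr g1 * (s - r) powr g2)"
      by (rule c[of "\<lambda>n. rect_incr (u, r) (v, s) (y n)"], unfold rect_incr_def fst_conv snd_conv, intro tendsto_intros sq)
         (use a T cells_D(3)[OF y a] in \<open>auto simp: rect_incr_def\<close>)
  qed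
qed

text \<open>Membership in \<open>cells h\<close> gives one Hoelder constant for all the delayed
  solutions, hence equicontinuity. The limit again lies in \<open>cells h\<close>, so
  \<open>J_tendsto\<close> applies and the delayed equations pass to the limit.\<close>

lemma ex_solution: "\<exists>h>0. \<exists>y\<in>cells h. \<forall>t\<in>square T. y t = \<Gamma> y t"
proof -
  obtain h where h: "0 < h" "incr_const1 h * h powr g1 \<le> 1" "incr_const2 h * h powr g2 \<le> 1" "cell_const * (h powr g1 * h powr g2) \<le> 1"
    using ex_small_scale by blast
  define X where "X = holder_const h"
  have X: "0 \<le> X" "\<And>y. y \<in> cells h \<Longrightarrow> holder_rect g1 g2 0 T 0 T X X X y"
    using holder_const_nonneg cells_global h by (auto simp: X_def)
  define e where "e n = 1 / real (Suc n)" for n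
  have e: "0 < e n" for n by (simp add: e_def)
  obtain y where y: "\<And>n. y n \<in> cells h" "\<And>n t. t \<in> square T \<Longrightarrow> y n t = \<Gamma> (delay (e n) (y n)) t"
    using ex_delayed_solution[OF h e] by metis
  have diff: "norm (y n t - y n s) \<le> X * \<bar>fst t - fst s\<bar> powr g1 + X * \<bar>snd t - snd s\<bar> powr g2"
    if st: "s \<in> square T" "t \<in> square T" for n s t
  proof -
    obtain u r v q where e: "s = (u, r)" "t = (v, q)" by (cases s, cases t)
    have "norm (y n (v, q) - y n (v, r)) \<le> X * \<bar>q - r\<bar> powr g2" "norm (y n (v, r) - y n (u, r)) \<le> X * \<bar>v - u\<bar> powr g1"
      using st holder_rect_norm_diff_le(2)[OF X(2)[OF y(1)[of n]], of v v r q]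
        holder_rect_norm_diff_le(1)[OF X(2)[OF y(1)[of n]], of u v r r] by (auto simp: e square_def)
    from norm_diff_triangle_le[OF this] show ?thesis by (simp add: e add.commute)
  qed
  have powr0: "((\<lambda>d. X * d powr g1 + X * d powr g2) \<longlongrightarrow> 0) (at_right 0)"
  proof -
    have "((\<lambda>d. X * d powr g1 + X * d powr g2) \<longlongrightarrow> X * 0 powr g1 + X * 0 powr g2) (at_right 0)"
      by (intro tendsto_intros tendsto_powr') (use g1 g2 in \<open>auto simp: eventually_at_filter\<close>)
    then show ?thesis by simp
  qed
  have zero: "(0, 0) \<in> square T" using T by (simp add: square_def)
  obtain g k where k: "strict_mono (k :: nat \<Rightarrow> nat)"
    and g: "\<And>\<epsilon>. 0 < \<epsilon> \<Longrightarrow> \<exists>N. \<forall>n x. n \<ge> N \<and> x \<in> square T \<longrightarrow> norm (y (k n) x - g x) < \<epsilon>"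
  proof (rule Arzela_Ascoli[of "square T" y "X * T powr g1 + X * T powr g2 + norm (\<xi> (0, 0))"])
    show "compact (square T)" unfolding square_def by (intro compact_Times compact_Icc)
  next
    fix n x assume x: "x \<in> square T"
    \<comment> \<open>The common value at the corner turns the Hoelder bound into a uniform
      bound.\<close>
    have "y n (0, 0) = \<xi> (0, 0)" using y(2)[OF zero] by (simp add: \<Gamma>_axes)
    then have "norm (y n x) \<le> norm (y n x - y n (0, 0)) + norm (\<xi> (0, 0))"
      using norm_triangle_sub[of "y n x" "y n (0, 0)"] by simp
    also have "\<dots> \<le> X * \<bar>fst x\<bar> powr g1 + X * \<bar>snd x\<bar> powr g2 + norm (\<xi> (0, 0))"
      using diff[OF zero x] by simp
    also have "\<dots> \<le> X * T powr g1 + X * T powr g2 + norm (\<xi> (0, 0))"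
      using x X(1) g1 g2 by (intro add_right_mono add_mono mult_left_mono powr_mono2) (auto simp: square_def)
    finally show "norm (y n x) \<le> X * T powr g1 + X * T powr g2 + norm (\<xi> (0, 0))" .
  next
    fix x :: "real \<times> real" and \<epsilon> :: real assume x: "x \<in> square T" "0 < \<epsilon>"
    have "\<forall>\<^sub>F d in at_right 0. X * d powr g1 + X * d powr g2 < \<epsilon> \<and> 0 < d"
      using order_tendstoD(2)[OF powr0 x(2)] eventually_at_right_less by (rule eventually_conj)
    then obtain d where d: "X * d powr g1 + X * d powr g2 < \<epsilon>" "0 < d"
      using eventually_happens'[OF trivial_limit_at_right_real] by blast
    show "\<exists>d>0. \<forall>n z. z \<in> square T \<and> norm (x - z) < d \<longrightarrow> norm (y n x - y n z) < \<epsilon>"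
    proof (intro exI[of _ d] conjI allI impI d(2); elim conjE)
      fix n z assume z: "z \<in> square T" "norm (x - z) < d"
      have "\<bar>fst x - fst z\<bar> \<le> d" "\<bar>snd x - snd z\<bar> \<le> d"
        using z(2) norm_fst_le[of "fst x - fst z" "snd x - snd z"] norm_snd_le[of "snd x - snd z" "fst x - fst z"]
        by (auto simp: minus_prod_def)
      then have "X * \<bar>fst x - fst z\<bar> powr g1 + X * \<bar>snd x - snd z\<bar> powr g2 \<le> X * d powr g1 + X * d powr g2"
        using X(1) g1 g2 by (intro add_mono mult_left_mono powr_mono2) auto
      then show "norm (y n x - y n z) < \<epsilon>" using diff[OF z(1) x(1), of n] d(1) by linarith
    qed
  next
    fix g and k :: "nat \<Rightarrow> nat" assume "strict_mono k"
      "\<And>\<epsilon>. 0 < \<epsilon> \<Longrightarrow> \<exists>N. \<forall>n x. n \<ge> N \<and> x \<in> square T \<longrightarrow> norm (y (k n) x - g x) < \<epsilon>"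
    then show thesis by (rule that)
  qed
  have lim: "(\<lambda>n. y (k n) t) \<longlonglongrightarrow> g t" if "t \<in> square T" for t
    using g that by (intro LIMSEQ_I) blast
  define v where "v n = delay (e (k n)) (y (k n))" for n
  have vS: "v n \<in> cells h" for n unfolding v_def using delay_cells y(1) e less_imp_le by blast
  have vlim: "(\<lambda>n. v n t) \<longlonglongrightarrow> g t" if t: "t \<in> square T" for t
  proof -
    \<comment> \<open>The arguments differ by at most e, so the common Hoelder bound forces the
      delayed functions to the same limit.\<close>
    have "(\<lambda>n. v n t - y (k n) t) \<longlonglongrightarrow> 0"
    proof (rule Lim_null_comparison)
      show "\<forall>\<^sub>F n in sequentially. norm (v n t - y (k n) t) \<le> X * e (k n) powr g1"
      proof (intro always_eventually allI)
        fix n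
        let ?s = "(max 0 (fst t - e (k n)), snd t)"
        have s: "?s \<in> square T" using t T e[of "k n"] by (auto simp: square_def)
        have "norm (y (k n) ?s - y (k n) t) \<le> X * \<bar>fst ?s - fst t\<bar> powr g1 + X * \<bar>snd ?s - snd t\<bar> powr g2"
          by (rule diff[OF t s])
        also have "\<dots> \<le> X * e (k n) powr g1"
          using X(1) g1 e[of "k n"] t by (auto simp: square_def intro!: mult_left_mono powr_mono2)
        finally show "norm (v n t - y (k n) t) \<le> X * e (k n) powr g1" by (simp add: v_def delay_def)
      qed
      have "e \<longlonglongrightarrow> 0" unfolding e_def[abs_def] by (rule LIMSEQ_inverse_real_of_nat[unfolded inverse_eq_divide])
      then have "(e \<circ> k) \<longlonglongrightarrow> 0" using k by (rule LIMSEQ_subseq_LIMSEQ)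
      then have "(\<lambda>n. X * e (k n) powr g1) \<longlonglongrightarrow> X * 0 powr g1"
        using g1 less_imp_le[OF e] by (intro tendsto_intros tendsto_powr') (auto simp: o_def)
      then show "(\<lambda>n. X * e (k n) powr g1) \<longlonglongrightarrow> 0" by simp
    qed
    from tendsto_add[OF this lim[OF t]] show ?thesis by simp
  qed
  have gS: "g \<in> cells h" by (rule cells_closed[OF y(1) lim])
  have "g t = \<Gamma> g t" if t: "t \<in> square T" for t
  proof -
    have "(\<lambda>n. \<xi> t + J (v n) t) \<longlonglongrightarrow> \<xi> t + J g t"
      by (intro tendsto_intros J_tendsto[OF X(2)[OF vS] X(2)[OF gS] X(1) vlim t])
    moreover have "\<xi> t + J (v n) t = y (k n) t" for n
      using y(2)[OF t] by (simp add: v_def \<Gamma>_def)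
    ultimately show ?thesis using LIMSEQ_unique[OF _ lim[OF t]] by (simp add: \<Gamma>_def)
  qed
  then show ?thesis using gS h(1) by blast
qed

end

section \<open>Uniqueness\<close>

lemma germ_subset:
  assumes "germ a b c d g1 g2 z1 z2 L1 L2 L12 \<Xi>" "a \<le> a'" "b' \<le> b" "c \<le> c'" "d' \<le> d"
  shows "germ a' b' c' d' g1 g2 z1 z2 L1 L2 L12 \<Xi>"
proof -
  interpret germ a b c d g1 g2 z1 z2 L1 L2 L12 \<Xi> by fact
  show ?thesis
    by unfold_locales
      (use z1 z2 L1 L2 L12 g1 g2 assms in \<open>auto intro!: d1 d2 d12\<close>)
qed

context young_equation
begin

text \<open>The difference of the two solutions is an integral of the difference
  \<open>\<Xi>\<close> of their germs, and every defect of \<open>\<Xi>\<close> is linear in N. The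
  strip is thin only in the first variable; B bounds the powers of heights in the other one. In the
  result B comes from the one-term approximation, the term with K1 from sewing in the first variable
  and the last term from the second.\<close>

lemma strip_contraction:
  fixes y y' :: "real \<times> real \<Rightarrow> 'a"
  assumes y: "holder_rect g1 g2 0 T 0 T X X X y" and y': "holder_rect g1 g2 0 T 0 T X X X y'" and X: "1 \<le> X"
    and sol: "\<And>t. t \<in> square T \<Longrightarrow> y t = \<Gamma> y t" "\<And>t. t \<in> square T \<Longrightarrow> y' t = \<Gamma> y' t"
    and ab: "0 \<le> a" "a \<le> b" "b \<le> T" "b - a \<le> h" and h: "0 < h" "h \<le> 1"
    and eq: "\<And>r. 0 \<le> r \<Longrightarrow> r \<le> T \<Longrightarrow> y (a, r) = y' (a, r)"
    and N: "0 \<le> N" "\<And>u v r s. a \<le> u \<Longrightarrow> u \<le> v \<Longrightarrow> v \<le> b \<Longrightarrow> 0 \<le> r \<Longrightarrow> r \<le> s \<Longrightarrow> s \<le> T \<Longrightarrow>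
      norm (rect_incr (u, r) (v, s) (y - y')) \<le> N * ((v - u) powr g1 * (s - r) powr g2)"
    and \<eta>1: "1 < (1 + \<eta>) * g1"
    and R: "a \<le> u0" "u0 \<le> v0" "v0 \<le> b" "0 \<le> r0" "r0 \<le> s0" "s0 \<le> T"
  defines "B \<equiv> 1 + T powr g2"
  defines "P \<equiv> 1 + X * B + X + (X + X * X) * B"
  defines "K1 \<equiv> sew_const ((1 + \<eta>) * g1)" and "K2 \<equiv> sew_const (2 * g2)"
  shows "norm (rect_incr (u0, r0) (v0, s0) (y - y'))
    \<le> C * (B + K1 * (B * (1 + X) + K2 * P * B) + K2 * (1 + B * X) * B) * h powr (\<eta> * g1) * N
      * ((v0 - u0) powr g1 * (s0 - r0) powr g2)"
proof -
  define z where "z = y - y'"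
  define H where "H = h powr (\<eta> * g1)"
  have z: "z t = y t - y' t" for t by (simp add: z_def)
  have B: "1 \<le> B" by (simp add: B_def)
  have P: "0 \<le> P" using X B by (simp add: P_def)
  have hH: "h powr g1 \<le> H" "h powr g1 \<le> 1" "0 \<le> H"
    using h \<eta> g1 by (auto simp: H_def intro!: powr_mono' powr_le1)
  have NN: "norm (rect_incr (u, r) (v, s) z) \<le> N * ((v - u) powr g1 * (s - r) powr g2)"
    if "a \<le> u" "u \<le> v" "v \<le> b" "0 \<le> r" "r \<le> s" "s \<le> T" for u v r s
    using N(2)[OF that] by (simp add: z_def)
  have z_axis: "z (x, 0) = 0" if "0 \<le> x" "x \<le> T" for x
  proof -
    have "(x, 0) \<in> square T" using that T by (simp add: square_def)
    from sol(1)[OF this] sol(2)[OF this] show ?thesis using that by (simp add: z \<Gamma>_axes)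
  qed
  have za: "z (a, r) = 0" if "0 \<le> r" "r \<le> T" for r using eq[OF that] by (simp add: z)
  have gB: "r powr g2 \<le> B" if "0 \<le> r" "r \<le> T" for r
  proof -
    have "r powr g2 \<le> T powr g2" using that g2 by (intro powr_mono2) auto
    then show ?thesis by (simp add: B_def)
  qed
  have hpow: "(v - u) powr g1 \<le> h powr g1" if "a \<le> u" "u \<le> v" "v \<le> b" for u v
    using that ab g1 by (intro powr_mono2) auto
  \<comment> \<open>The difference vanishes on the bottom and on the left edge. Its one-dimensional
    increments are therefore rectangular increments over rectangles reaching those edges, and all
    its sizes are controlled by N. Reaching the left edge gains the factor h^g1.\<close>
  have z1: "norm (z (v, r) - z (u, r)) \<le> N * B * (v - u) powr g1"
    if a: "a \<le> u" "u \<le> v" "v \<le> b" "0 \<le> r" "r \<le> T" for u v r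
  proof -
    have "norm (rect_incr (u, 0) (v, r) z) \<le> N * ((v - u) powr g1 * (r - 0) powr g2)"
      using a by (intro NN) auto
    also have "\<dots> \<le> N * ((v - u) powr g1 * B)"
      using N gB[of r] a by (intro mult_left_mono) auto
    finally show ?thesis using a ab z_axis[of u] z_axis[of v] by (simp add: rect_incr_def mult_ac)
  qed
  have z2: "norm (z (u, s) - z (u, r)) \<le> N * h powr g1 * (s - r) powr g2"
    if a: "a \<le> u" "u \<le> b" "0 \<le> r" "r \<le> s" "s \<le> T" for u r s
  proof -
    have "norm (rect_incr (a, r) (u, s) z) \<le> N * ((u - a) powr g1 * (s - r) powr g2)"
      using a ab by (intro NN) auto
    also have "\<dots> \<le> N * (h powr g1 * (s - r) powr g2)"
      using N hpow[of a u] a by (intro mult_left_mono mult_right_mono) auto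
    finally show ?thesis using a za[of r] za[of s] by (simp add: rect_incr_def mult_ac)
  qed
  have z0: "norm (z (u, r)) \<le> N * B * h powr g1" if a: "a \<le> u" "u \<le> b" "0 \<le> r" "r \<le> T" for u r
  proof -
    have "norm (z (u, r) - z (a, r)) \<le> N * B * (u - a) powr g1" using a ab by (intro z1) auto
    also have "\<dots> \<le> N * B * h powr g1" using N B hpow[of a u] a by (intro mult_left_mono) auto
    finally show ?thesis using za[of r] a by simp
  qed
  define \<Xi> where "\<Xi> = (\<lambda>u v r s. young_germ A y u v r s - young_germ A y' u v r s)"
  \<comment> \<open>The second-variable defect has only exponent g1 in the first variable, so its
    constant must contain the small factor H. The other two gain it later from the exponent (1 +
    eta) g1.\<close>
  have G: "germ a b 0 T g1 g2 ((1 + \<eta>) * g1) (2 * g2)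
      (C * N * (B * (1 + X))) (C * N * H * (1 + B * X)) (C * N * P) \<Xi>"
  proof (unfold_locales, goal_cases)
    case (8 u v q r s)
    have sq: "0 \<le> v" "v \<le> q" "q \<le> T" "0 \<le> r" "r \<le> s" "s \<le> T" using 8 ab by auto
    note ff = F_facts[OF sq]
    let ?c = "incr_weight v q r s" and ?d = "N * B * h powr g1"
    have "norm (F v q r s (y (u, r)) - F v q r s (y (v, r)) - F v q r s (y' (u, r)) + F v q r s (y' (v, r)))
       \<le> ?c * norm (y (u, r) - y (v, r) - y' (u, r) + y' (v, r)) + (?c * ?d) * norm (y' (u, r) - y' (v, r))"
    proof (rule four_point[OF ff(1,4)])
      show "norm (F' v q r s x - F' v q r s x') \<le> ?c * ?d" if "norm (x - x') \<le> ?d" for x x'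
        using order_trans[OF ff(8) mult_left_mono[OF that ff(9)]] .
      show "norm (y (v, r) - y' (v, r)) \<le> ?d" "norm (y (u, r) - y' (u, r)) \<le> ?d"
        using z0[of v r] z0[of u r] 8 by (auto simp: z)
    qed
    also have "\<dots> \<le> ?c * (N * B * (v - u) powr g1) + (?c * (N * B)) * (X * (v - u) powr g1)"
    proof (rule add_mono[OF mult_left_mono mult_mono])
      have "norm (y (u, r) - y (v, r) - y' (u, r) + y' (v, r)) = norm (z (v, r) - z (u, r))"
        using norm_minus_commute[of "z (v, r)" "z (u, r)"] by (simp add: z algebra_simps)
      then show "norm (y (u, r) - y (v, r) - y' (u, r) + y' (v, r)) \<le> N * B * (v - u) powr g1"
        using z1[of u v r] 8 by simp
      show "norm (y' (u, r) - y' (v, r)) \<le> X * (v - u) powr g1"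
        using holder_rectD(1)[OF y', of u v r r] 8 ab by (simp add: norm_minus_commute)
      show "?c * ?d \<le> ?c * (N * B)" using hH(2) N B ff(9) by (intro mult_left_mono) (simp_all add: mult_left_le)
    qed (use C X N B in auto)
    also have "\<dots> = ?c * (N * B * (1 + X)) * (v - u) powr g1" by (simp add: algebra_simps)
    also have "\<dots> \<le> incr_weight u q r s * (N * B * (1 + X)) * (q - u) powr g1"
    proof (intro mult_mono[OF mult_right_mono])
      show "?c \<le> incr_weight u q r s" using 8 by (intro incr_weight_mono) auto
      show "(v - u) powr g1 \<le> (q - u) powr g1" using 8 g1 by (intro powr_mono2) auto
    qed (use C X N B in auto)
    also have "\<dots> = C * N * (B * (1 + X)) * (q - u) powr (2 * g1) * (s - r) powr g2"
      unfolding powr_double by (simp add: mult_ac)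
    \<comment> \<open>This defect has exponent 2 g1; it is lowered, for lengths at most 1, to the
      exponent available for the mixed defect.\<close>
    also have "\<dots> \<le> C * N * (B * (1 + X)) * (q - u) powr ((1 + \<eta>) * g1) * (s - r) powr g2"
      using 8 C X N B ab h \<eta> g1 by (intro mult_right_mono mult_left_mono powr_mono') auto
    also have "F v q r s (y (u, r)) - F v q r s (y (v, r)) - F v q r s (y' (u, r)) + F v q r s (y' (v, r))
       = \<Xi> u q r s - \<Xi> u v r s - \<Xi> v q r s"
      using germ_defect1[of y u q r s v] germ_defect1[of y' u q r s v] by (simp add: \<Xi>_def algebra_simps)
    finally show ?case .
  next
    case (9 u v r s t)
    have sq: "0 \<le> u" "u \<le> v" "v \<le> T" "0 \<le> s" "s \<le> t" "t \<le> T" using 9 ab by auto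
    note ff = F_facts[OF sq]
    let ?c = "incr_weight u v s t" and ?d = "N * B * h powr g1"
    have "norm (F u v s t (y (u, r)) - F u v s t (y (u, s)) - F u v s t (y' (u, r)) + F u v s t (y' (u, s)))
       \<le> ?c * norm (y (u, r) - y (u, s) - y' (u, r) + y' (u, s)) + (?c * ?d) * norm (y' (u, r) - y' (u, s))"
    proof (rule four_point[OF ff(1,4)])
      show "norm (F' u v s t x - F' u v s t x') \<le> ?c * ?d" if "norm (x - x') \<le> ?d" for x x'
        using order_trans[OF ff(8) mult_left_mono[OF that ff(9)]] .
      show "norm (y (u, s) - y' (u, s)) \<le> ?d" "norm (y (u, r) - y' (u, r)) \<le> ?d"
        using z0[of u s] z0[of u r] 9 by (auto simp: z)
    qed
    also have "\<dots> \<le> ?c * (N * H * (s - r) powr g2) + (?c * (N * B * H)) * (X * (s - r) powr g2)"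
    proof (rule add_mono[OF mult_left_mono mult_mono])
      have "norm (y (u, r) - y (u, s) - y' (u, r) + y' (u, s)) = norm (z (u, s) - z (u, r))"
        using norm_minus_commute[of "z (u, s)" "z (u, r)"] by (simp add: z algebra_simps)
      also have "\<dots> \<le> N * h powr g1 * (s - r) powr g2" using 9 by (intro z2) auto
      also have "\<dots> \<le> N * H * (s - r) powr g2" using hH N by (intro mult_right_mono mult_left_mono) auto
      finally show "norm (y (u, r) - y (u, s) - y' (u, r) + y' (u, s)) \<le> N * H * (s - r) powr g2" .
      show "norm (y' (u, r) - y' (u, s)) \<le> X * (s - r) powr g2"
        using holder_rectD(3)[OF y', of u u r s] 9 ab by (simp add: norm_minus_commute)
      show "?c * ?d \<le> ?c * (N * B * H)" using hH N B ff(9) by (intro mult_left_mono) auto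
    qed (use C X N B hH in auto)
    also have "\<dots> = ?c * (N * H * (1 + B * X)) * (s - r) powr g2" by (simp add: algebra_simps)
    also have "\<dots> \<le> incr_weight u v r t * (N * H * (1 + B * X)) * (t - r) powr g2"
    proof (intro mult_mono[OF mult_right_mono])
      show "?c \<le> incr_weight u v r t" using 9 by (intro incr_weight_mono) auto
      show "(s - r) powr g2 \<le> (t - r) powr g2" using 9 g2 by (intro powr_mono2) auto
    qed (use C X N B hH in auto)
    also have "\<dots> = C * N * H * (1 + B * X) * (v - u) powr g1 * (t - r) powr (2 * g2)"
      unfolding powr_double by (simp add: mult_ac)
    also have "F u v s t (y (u, r)) - F u v s t (y (u, s)) - F u v s t (y' (u, r)) + F u v s t (y' (u, s))
       = \<Xi> u v r t - \<Xi> u v r s - \<Xi> u v s t"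
      using germ_defect2[of y u v r t s] germ_defect2[of y' u v r t s] by (simp add: \<Xi>_def algebra_simps)
    finally show ?case .
  next
    case (10 u v q r s t)
    have sq: "0 \<le> v" "v \<le> q" "q \<le> T" "0 \<le> s" "s \<le> t" "t \<le> T" using 10 ab by auto
    have sq': "0 \<le> u" "u \<le> v" "v \<le> T" "0 \<le> r" "r \<le> s" "s \<le> T" using 10 ab by auto
    note ff = F_facts[OF sq]
    let ?c = "incr_weight v q s t" and ?a = "(v - u) powr g1" and ?b = "(s - r) powr g2" and ?a\<eta> = "(v - u) powr (\<eta> * g1)"
    have a1: "?a \<le> ?a\<eta>" "?a \<le> 1"
      using 10 ab h \<eta> g1 by (auto intro!: powr_mono' powr_le1)
    have rr: "rect_incr (u, r) (v, s) f = f (v, s) - f (v, r) - f (u, s) + f (u, r)" for f :: "real \<times> real \<Rightarrow> 'a"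
      by (simp add: rect_incr_def)
    have "norm ((F v q s t (y (v, s)) - F v q s t (y (v, r)) - F v q s t (y (u, s)) + F v q s t (y (u, r)))
        - (F v q s t (y' (v, s)) - F v q s t (y' (v, r)) - F v q s t (y' (u, s)) + F v q s t (y' (u, r))))
      \<le> ?c * (N * (?a * ?b)) + ?c * (X * ?b) * (N * B * ?a) + ?c * (X * ?a) * (N * ?b)
        + (?c * (X * (?a * ?b)) + (?c * (X * ?a\<eta>)) * (X * ?b)) * (N * B)"
    \<comment> \<open>The eight points are y and y' at the corners of [u, v] x [r, s]: index 10
      stands for (v, r) and 01 for (u, s).\<close>
    proof (rule eight_point[OF ff(1,2,4,5)])
      fix x x' :: 'a assume x: "norm (x - x') \<le> X * ?a"
      have "norm (F'' v q s t x - F'' v q s t x') \<le> ?c * norm (x - x') powr \<eta>" by (rule ff(6))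
      also have "\<dots> \<le> ?c * (X * ?a) powr \<eta>" using x \<eta> ff(9) by (intro mult_left_mono powr_mono2) auto
      also have "(X * ?a) powr \<eta> = X powr \<eta> * ?a\<eta>"
        using X by (simp add: powr_mult powr_powr mult.commute)
      also have "?c * (X powr \<eta> * ?a\<eta>) \<le> ?c * (X * ?a\<eta>)"
        using X \<eta> ff(9) powr_mono[of \<eta> 1 X] by (intro mult_left_mono mult_right_mono) auto
      finally show "norm (F'' v q s t x - F'' v q s t x') \<le> ?c * (X * ?a\<eta>)" .
    next
      show "norm (y (v, s) - y' (v, s) - (y (v, r) - y' (v, r)) - (y (u, s) - y' (u, s)) + (y (u, r) - y' (u, r)))
          \<le> N * (?a * ?b)"
        using NN[of u v r s] 10 unfolding rr z by auto
      show "norm (y (v, r) - y' (v, r) - (y (u, r) - y' (u, r))) \<le> N * B * ?a"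
        using z1[of u v r] 10 by (simp add: z)
      have "norm (z (u, s) - z (u, r)) \<le> N * h powr g1 * ?b" using 10 by (intro z2) auto
      also have "\<dots> \<le> N * 1 * ?b" using hH N by (intro mult_right_mono mult_left_mono) auto
      finally show "norm (y (u, s) - y' (u, s) - (y (u, r) - y' (u, r))) \<le> N * ?b" by (simp add: z)
      have "norm (z (u, r)) \<le> N * B * h powr g1" using 10 by (intro z0) auto
      also have "\<dots> \<le> N * B * 1" using hH N B by (intro mult_left_mono) auto
      finally show "norm (y (u, r) - y' (u, r)) \<le> N * B" by (simp add: z)
    qed (use holder_rectD[OF y sq'] holder_rectD[OF y' sq'] in \<open>auto simp: rr\<close>)
    also have "\<dots> = ?c * N * ?b * (?a + X * B * ?a + X * ?a + (X * ?a + X * X * ?a\<eta>) * B)"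
      by (simp add: algebra_simps)
    also have "\<dots> \<le> ?c * N * ?b * (?a\<eta> + X * B * ?a\<eta> + X * ?a\<eta> + (X * ?a\<eta> + X * X * ?a\<eta>) * B)"
      using a1 X B N ff(9) by (intro mult_left_mono add_mono mult_right_mono) auto
    \<comment> \<open>The summands 1, X B, X and (X + X X) B of P are the coefficients of the four
      terms of \<open>eight_point\<close>, after all powers of v - u have been reduced to the
      exponent eta g1.\<close>
    also have "\<dots> = ?c * (N * P) * (?a\<eta> * ?b)" by (simp add: P_def algebra_simps)
    also have "\<dots> \<le> incr_weight u q r t * (N * P) * ((q - u) powr (\<eta> * g1) * (t - r) powr g2)"
    proof (intro mult_mono[OF mult_right_mono] mult_mono[of ?a\<eta>])
      show "?c \<le> incr_weight u q r t" using 10 by (intro incr_weight_mono) auto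
      show "?a\<eta> \<le> (q - u) powr (\<eta> * g1)" "?b \<le> (t - r) powr g2"
        using 10 g1 g2 \<eta> by (auto intro!: powr_mono2)
    qed (use C N P in auto)
    also have "\<dots> = C * N * P * (q - u) powr ((1 + \<eta>) * g1) * (t - r) powr (2 * g2)"
      unfolding powr_double distrib_right powr_add by (simp add: mult_ac)
    also have "(F v q s t (y (v, s)) - F v q s t (y (v, r)) - F v q s t (y (u, s)) + F v q s t (y (u, r)))
        - (F v q s t (y' (v, s)) - F v q s t (y' (v, r)) - F v q s t (y' (u, s)) + F v q s t (y' (u, r)))
      = (\<Xi> u q r t - \<Xi> u v r t - \<Xi> v q r t) - (\<Xi> u q r s - \<Xi> u v r s - \<Xi> v q r s)
        - (\<Xi> u q s t - \<Xi> u v s t - \<Xi> v q s t)"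
    proof -
      have E: "(\<Xi> u q r t - \<Xi> u v r t - \<Xi> v q r t) - (\<Xi> u q r s - \<Xi> u v r s - \<Xi> v q r s) - (\<Xi> u q s t - \<Xi> u v s t - \<Xi> v q s t)
        = ((young_germ A y u q r t - young_germ A y u v r t - young_germ A y v q r t)
         - (young_germ A y u q r s - young_germ A y u v r s - young_germ A y v q r s)
         - (young_germ A y u q s t - young_germ A y u v s t - young_germ A y v q s t))
        - ((young_germ A y' u q r t - young_germ A y' u v r t - young_germ A y' v q r t)
         - (young_germ A y' u q r s - young_germ A y' u v r s - young_germ A y' v q r s)
         - (young_germ A y' u q s t - young_germ A y' u v s t - young_germ A y' v q s t))"
        by (simp add: \<Xi>_def)
      show ?thesis unfolding E germ_defect12 by (simp add: algebra_simps)
    qed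
    finally show ?case .
  qed (use g1 g2 C X N B P hH \<eta>1 in auto)
  let ?a = "(v0 - u0) powr g1" and ?b = "(s0 - r0) powr g2"
  define I where "I t = J y t - J y' t" for t
  have K: "0 \<le> K1" "0 \<le> K2"
    using sew_const(1)[OF \<eta>1] sew_const(1)[of "2 * g2"] g2 by (auto simp: K1_def K2_def)
  have hs: "has_sewing \<Xi> 0 u 0 r (I (u, r))" if "0 \<le> u" "u \<le> T" "0 \<le> r" "r \<le> T" for u r
    unfolding \<Xi>_def I_def using X that
    by (intro has_sewing_diff has_sewing_J[OF y] has_sewing_J[OF y']) auto
  have R': "0 \<le> u0" "u0 \<le> T" "0 \<le> v0" "v0 \<le> T" "0 \<le> r0" "r0 \<le> T" "0 \<le> s0" "s0 \<le> T" using R ab by auto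
  have "norm (rect_incr (u0, r0) (v0, s0) I - \<Xi> u0 v0 r0 s0)
     \<le> K1 * (C * N * (B * (1 + X)) * ?b + K2 * (C * N * P) * (s0 - r0) powr (2 * g2)) * (v0 - u0) powr ((1 + \<eta>) * g1)
       + K2 * (C * N * H * (1 + B * X)) * ?a * (s0 - r0) powr (2 * g2)"
    unfolding K1_def K2_def
    by (intro germ_sewing_bound[where ?a1.0 = 0 and ?a2.0 = 0] germ_subset[OF G] hs R R')
  \<comment> \<open>The first-variable exponent splits into g1, kept for the Hoelder bound, and eta
    g1, which yields H.\<close>
  also have "\<dots> = C * N * (?a * ?b) * (K1 * (B * (1 + X) + K2 * P * ?b) * (v0 - u0) powr (\<eta> * g1) + K2 * H * (1 + B * X) * ?b)"
    unfolding powr_double distrib_right[of 1 \<eta>] powr_add by (simp add: algebra_simps)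
  also have "\<dots> \<le> C * N * (?a * ?b) * (K1 * (B * (1 + X) + K2 * P * B) * H + K2 * H * (1 + B * X) * B)"
  proof -
    have 1: "?b \<le> B" using gB[of "s0 - r0"] R by simp
    have 2: "(v0 - u0) powr (\<eta> * g1) \<le> H" unfolding H_def using R ab g1 \<eta> by (intro powr_mono2) auto
    have "K1 * (B * (1 + X) + K2 * P * ?b) * (v0 - u0) powr (\<eta> * g1) \<le> K1 * (B * (1 + X) + K2 * P * B) * H"
      using 1 2 K B X P by (intro mult_mono add_mono mult_left_mono) auto
    moreover have "K2 * H * (1 + B * X) * ?b \<le> K2 * H * (1 + B * X) * B"
      using 1 K B X hH by (intro mult_left_mono) auto
    ultimately show ?thesis using C N(1) by (intro mult_left_mono[OF add_mono]) auto
  qed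
  finally have 1: "norm (rect_incr (u0, r0) (v0, s0) I - \<Xi> u0 v0 r0 s0)
     \<le> C * N * (?a * ?b) * (K1 * (B * (1 + X) + K2 * P * B) * H + K2 * H * (1 + B * X) * B)" .
  have 2: "norm (\<Xi> u0 v0 r0 s0) \<le> C * N * (?a * ?b) * (B * H)"
  proof -
    have "norm (\<Xi> u0 v0 r0 s0) \<le> incr_weight u0 v0 r0 s0 * norm (y (u0, r0) - y' (u0, r0))"
      unfolding \<Xi>_def young_germ_def by (rule F_facts(7)) (use R R' in auto)
    also have "\<dots> \<le> incr_weight u0 v0 r0 s0 * (N * B * H)"
    proof (intro mult_left_mono)
      have "norm (z (u0, r0)) \<le> N * B * h powr g1" using R by (intro z0) auto
      also have "\<dots> \<le> N * B * H" using hH N B by (intro mult_left_mono) auto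
      finally show "norm (y (u0, r0) - y' (u0, r0)) \<le> N * B * H" by (simp add: z)
    qed (use C in auto)
    finally show ?thesis by (simp add: mult_ac)
  qed
  have zI: "rect_incr (u0, r0) (v0, s0) z = rect_incr (u0, r0) (v0, s0) I"
  proof -
    have "z t = I t" if "t \<in> square T" for t
      using sol(1)[OF that] sol(2)[OF that] by (simp add: z I_def \<Gamma>_def)
    then show ?thesis using R R' by (simp add: rect_incr_def square_def)
  qed
  have "norm (rect_incr (u0, r0) (v0, s0) z)
      \<le> C * N * (?a * ?b) * (K1 * (B * (1 + X) + K2 * P * B) * H + K2 * H * (1 + B * X) * B) + C * N * (?a * ?b) * (B * H)"
    unfolding zI using norm_diff_triangle_le[OF 1, of 0] 2 by simp
  also have "\<dots> = C * (B + K1 * (B * (1 + X) + K2 * P * B) + K2 * (1 + B * X) * B) * H * N * (?a * ?b)"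
    by (simp add: algebra_simps)
  finally show ?thesis unfolding z_def H_def .
qed

text \<open>Halving the constant repeatedly, starting from the crude 2 X, shows that the difference
  has vanishing rectangular increments on a strip; as it vanishes on the left and bottom edges, it
  is 0 there. The width h depends on X but not on the position of the strip, so finitely many strips
  cover the square.\<close>

lemma fixed_point_unique:
  fixes y y' :: "real \<times> real \<Rightarrow> 'a"
  assumes y: "holder_rect g1 g2 0 T 0 T X X X y" and y': "holder_rect g1 g2 0 T 0 T X X X y'" and X: "1 \<le> X"
    and sol: "\<And>t. t \<in> square T \<Longrightarrow> y t = \<Gamma> y t" "\<And>t. t \<in> square T \<Longrightarrow> y' t = \<Gamma> y' t"
    and \<eta>1: "1 < (1 + \<eta>) * g1" and t: "t \<in> square T"
  shows "y t = y' t"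
proof -
  define B where "B = 1 + T powr g2"
  define P where "P = 1 + X * B + X + (X + X * X) * B"
  define K1 where "K1 = sew_const ((1 + \<eta>) * g1)"
  define K2 where "K2 = sew_const (2 * g2)"
  define Q where "Q = C * (B + K1 * (B * (1 + X) + K2 * P * B) + K2 * (1 + B * X) * B)"
  have "((\<lambda>h. Q * h powr (\<eta> * g1)) \<longlongrightarrow> Q * 0 powr (\<eta> * g1)) (at_right 0)"
    by (intro tendsto_intros tendsto_powr') (use \<eta> g1 in \<open>auto simp: eventually_at_filter\<close>)
  from order_tendstoD(2)[OF this, of "1/2"]
  have "\<forall>\<^sub>F h in at_right 0. Q * h powr (\<eta> * g1) < 1/2" by simp
  moreover have "\<forall>\<^sub>F h in at_right 0. h \<in> {0<..<1::real}"
    by (rule eventually_at_right_real) simp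
  ultimately have "\<forall>\<^sub>F h in at_right 0. Q * h powr (\<eta> * g1) < 1/2 \<and> h \<in> {0<..<1}"
    by (rule eventually_conj)
  then obtain h where h: "Q * h powr (\<eta> * g1) < 1/2" "0 < h" "h < 1"
    using eventually_happens'[OF trivial_limit_at_right_real] by fastforce
  have strip: "y (b, r) = y' (b, r)"
    if ab: "0 \<le> a" "a \<le> b" "b \<le> T" "b - a \<le> h" and r: "0 \<le> r" "r \<le> T"
      and eq: "\<And>r. 0 \<le> r \<Longrightarrow> r \<le> T \<Longrightarrow> y (a, r) = y' (a, r)" for a b r
  proof -
    have bound: "norm (rect_incr (u, r) (v, s) (y - y')) \<le> 2 * X * (1/2) ^ n * ((v - u) powr g1 * (s - r) powr g2)"
      if "a \<le> u" "u \<le> v" "v \<le> b" "0 \<le> r" "r \<le> s" "s \<le> T" for n u v r s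
      using that
    proof (induction n arbitrary: u v r s)
      case 0
      then have R: "0 \<le> u" "u \<le> v" "v \<le> T" "0 \<le> r" "r \<le> s" "s \<le> T" using ab by auto
      have "rect_incr (u, r) (v, s) (y - y') = rect_incr (u, r) (v, s) y - rect_incr (u, r) (v, s) y'"
        by (simp add: rect_incr_def)
      also have "norm \<dots> \<le> X * ((v - u) powr g1 * (s - r) powr g2) + X * ((v - u) powr g1 * (s - r) powr g2)"
        by (intro norm_triangle_le_diff add_mono holder_rectD(5)[OF y R] holder_rectD(5)[OF y' R])
      also have "\<dots> = 2 * X * (1/2) ^ 0 * ((v - u) powr g1 * (s - r) powr g2)" by simp
      finally show ?case .
    next
      case (Suc n)
      let ?N = "2 * X * (1/2) ^ n"
      have "norm (rect_incr (u, r) (v, s) (y - y')) \<le> Q * h powr (\<eta> * g1) * ?N * ((v - u) powr g1 * (s - r) powr g2)"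
        unfolding Q_def P_def B_def K1_def K2_def
        by (rule strip_contraction[OF y y' X sol ab h(2) _ eq _ Suc.IH \<eta>1]) (use Suc.prems h X in auto)
      also have "\<dots> \<le> 1/2 * ?N * ((v - u) powr g1 * (s - r) powr g2)"
        using h X by (intro mult_right_mono) auto
      also have "\<dots> = 2 * X * (1/2) ^ Suc n * ((v - u) powr g1 * (s - r) powr g2)" by simp
      finally show ?case .
    qed
    have "norm (rect_incr (a, 0) (b, r) (y - y')) \<le> 0"
    proof (rule LIMSEQ_le_const)
      have "(\<lambda>n. 2 * X * (1/2) ^ n * ((b - a) powr g1 * (r - 0) powr g2)) \<longlonglongrightarrow> 2 * X * 0 * ((b - a) powr g1 * (r - 0) powr g2)"
        by (intro tendsto_intros LIMSEQ_realpow_zero) auto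
      then show "(\<lambda>n. 2 * X * (1/2) ^ n * ((b - a) powr g1 * (r - 0) powr g2)) \<longlonglongrightarrow> 0" by simp
    qed (intro exI[of _ 0] allI impI bound; use ab r in simp)
    moreover have "y (b, 0) = y' (b, 0)"
    proof -
      have "(b, 0) \<in> square T" using ab T by (simp add: square_def)
      from sol(1)[OF this] sol(2)[OF this] show ?thesis using ab by (simp add: \<Gamma>_axes)
    qed
    ultimately show ?thesis using eq r T by (simp add: rect_incr_def)
  qed
  \<comment> \<open>The left edge of the first strip is the axis, on which both solutions equal
    \<open>\<xi>\<close>.\<close>
  have "\<forall>t\<in>square T. fst t \<le> real n * h \<longrightarrow> y t = y' t" for n
  proof (induction n)
    case 0
    show ?case
    proof (intro ballI impI)
      fix t assume t: "t \<in> square T" "fst t \<le> real 0 * h"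
      then obtain r where "t = (0, r)" "0 \<le> r" by (cases t) (auto simp: square_def)
      then show "y t = y' t" using sol(1)[OF t(1)] sol(2)[OF t(1)] by (simp add: \<Gamma>_axes)
    qed
  next
    case (Suc n)
    show ?case
    proof (intro ballI impI)
      fix t assume t: "t \<in> square T" "fst t \<le> real (Suc n) * h"
      show "y t = y' t"
      proof (cases "fst t \<le> real n * h")
        case False
        have "y (fst t, snd t) = y' (fst t, snd t)"
        proof (rule strip[of "real n * h"])
          show "fst t - real n * h \<le> h" using t(2) by (simp add: algebra_simps)
          fix r assume "0 \<le> r" "r \<le> T"
          then show "y (real n * h, r) = y' (real n * h, r)"
            using Suc.IH t(1) False h(2) by (auto simp: square_def)
        qed (use t(1) False h(2) in \<open>auto simp: square_def\<close>)
        then show ?thesis by simp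
      qed (use Suc.IH t in blast)
    qed
  qed
  moreover obtain n :: nat where "T / h < real n" using reals_Archimedean2 by blast
  then have "fst t \<le> real n * h" using h t by (auto simp: square_def field_simps)
  ultimately show ?thesis using t by blast
qed

text \<open>A Hoelder function has a Young integral, and its value is unique; the existential in
  \<open>young_solution\<close> is therefore the fixed point equation for
  \<open>\<Gamma>\<close>.\<close>

lemma young_solution_iff:
  "young_solution T (g1, g2) A \<xi> y \<longleftrightarrow> holder_plane UNIV norm T (g1, g2) y \<and> (\<forall>t\<in>square T. y t = \<Gamma> y t)"
proof (cases "holder_plane UNIV norm T (g1, g2) y")
  case True
  obtain X where X: "1 \<le> X" "holder_rect g1 g2 0 T 0 T X X X y"
    using holder_rect_of_holder_plane[OF True] by auto
  have "(\<exists>I. has_young_integral A y t I \<and> y t = \<xi> t + I) \<longleftrightarrow> y t = \<Gamma> y t" if t: "t \<in> square T" for t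
  proof -
    obtain a b where ab: "t = (a, b)" "0 \<le> a" "a \<le> T" "0 \<le> b" "b \<le> T"
      using t by (cases t) (auto simp: square_def)
    have "has_young_integral A y t (J y t)"
      unfolding ab(1) using X ab by (intro has_young_integral_J[of X]) auto
    moreover have "has_young_integral A y t I \<Longrightarrow> J y t = I" for I
      using ab by (intro young_integral_eqI) auto
    ultimately show ?thesis unfolding \<Gamma>_def by metis
  qed
  then show ?thesis using True by (simp add: young_solution_def)
qed (simp add: young_solution_def)

end

theorem theorem21:
  fixes T \<eta> :: real and \<gamma> :: "real \<times> real"
    and A :: "real \<times> real \<Rightarrow> real ^ 'd \<Rightarrow> real ^ 'd"
    and \<xi> :: "real \<times> real \<Rightarrow> real ^ 'd"
  assumes "0 < T"
    and "\<gamma> \<in> {1/2<..1} \<times> {1/2<..1}"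
    and "0 < \<eta>" and "\<eta> < 1"
    and "holder_plane (C2_holder \<eta>) (C2_holder_norm \<eta>) T \<gamma> A"
    and "holder_plane UNIV norm T \<gamma> \<xi>"
    and "\<And>s t. s \<in> square T \<Longrightarrow> t \<in> square T \<Longrightarrow> fst s < fst t \<Longrightarrow> snd s < snd t
           \<Longrightarrow> rect_incr s t \<xi> = 0"
    and "(1 + \<eta>) * fst \<gamma> > 1" and "(1 + \<eta>) * snd \<gamma> > 1"
  shows "(\<exists>\<theta>. young_solution T \<gamma> A \<xi> \<theta>) \<and>
         (\<forall>\<theta> \<theta>'. young_solution T \<gamma> A \<xi> \<theta> \<longrightarrow> young_solution T \<gamma> A \<xi> \<theta>' \<longrightarrow>
            (\<forall>t\<in>square T. \<theta> t = \<theta>' t))"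
proof -
  obtain g1 g2 where \<gamma>: "\<gamma> = (g1, g2)" by (cases \<gamma>)
  obtain C where C: "\<And>s t. s \<in> square T \<Longrightarrow> t \<in> square T \<Longrightarrow> C2_holder_norm \<eta> (rect_incr s t A)
      \<le> C * (\<bar>fst t - fst s\<bar> powr g1 * \<bar>snd t - snd s\<bar> powr g2)"
    using assms(5) unfolding holder_plane_def \<gamma> by auto
  obtain K0 where K0: "1 \<le> K0" "holder_rect g1 g2 0 T 0 T K0 K0 K0 \<xi>"
    using holder_rect_of_holder_plane[OF assms(6)] by (auto simp: \<gamma>)
  \<comment> \<open>The Hoelder constant of A is not known to be nonnegative, as the locale
    requires; hence the absolute value.\<close>
  interpret young_equation T \<eta> "\<bar>C\<bar>" g1 g2 A \<xi> K0
  proof (unfold_locales, goal_cases)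
    case (10 u v r s)
    have "C2_holder_norm \<eta> (rect_incr (u, r) (v, s) A) \<le> C * ((v - u) powr g1 * (s - r) powr g2)"
      using C[of "(u, r)" "(v, s)"] 10 by (auto simp: square_def)
    also have "\<dots> \<le> \<bar>C\<bar> * ((v - u) powr g1 * (s - r) powr g2)" by (intro mult_right_mono) auto
    finally show ?case .
  next
    case (13 u v r s)
    then show ?case by (intro assms(7)) (auto simp: square_def)
  qed (use assms K0 in \<open>auto simp: \<gamma> holder_plane_def\<close>)
  have "\<exists>\<theta>. young_solution T \<gamma> A \<xi> \<theta>"
  proof -
    obtain h y where y: "0 < h" "y \<in> cells h" "\<forall>t\<in>square T. y t = \<Gamma> y t" using ex_solution by blast
    then show ?thesis unfolding \<gamma> young_solution_iff
      using holder_plane_of_holder_rect[OF cells_global] by blast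
  qed
  moreover have "\<theta> t = \<theta>' t"
    if sol: "young_solution T \<gamma> A \<xi> \<theta>" "young_solution T \<gamma> A \<xi> \<theta>'" and t: "t \<in> square T" for \<theta> \<theta>' t
  proof -
    note s = sol[unfolded \<gamma> young_solution_iff]
    obtain X where X: "1 \<le> X" "holder_rect g1 g2 0 T 0 T X X X \<theta>"
      using holder_rect_of_holder_plane[of UNIV T "(g1, g2)" \<theta>] s by auto
    obtain X' where X': "1 \<le> X'" "holder_rect g1 g2 0 T 0 T X' X' X' \<theta>'"
      using holder_rect_of_holder_plane[of UNIV T "(g1, g2)" \<theta>'] s by auto
    \<comment> \<open>\<open>fixed_point_unique\<close> takes one constant for both
      solutions.\<close>
    let ?X = "max X X'"
    show ?thesis
    proof (rule fixed_point_unique[of ?X])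
      show "holder_rect g1 g2 0 T 0 T ?X ?X ?X \<theta>" by (rule holder_rect_mono[OF X(2)]) auto
      show "holder_rect g1 g2 0 T 0 T ?X ?X ?X \<theta>'" by (rule holder_rect_mono[OF X'(2)]) auto
    qed (use s t X assms in \<open>auto simp: \<gamma>\<close>)
  qed
  ultimately show ?thesis by blast
qed

end
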